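(* Let $\mathcal{A}$ be a small $2$-category. For any $2$-functor $P:\mathcal{A}\to\mathcal{C}at$ there is a pseudo-equivalence, that is, an equivalence in $\mathcal{H}om_p(\mathcal{A},\mathcal{C}at)$: $$P\;\approx\;\underset{(x,A)\in\mathcal{E}l_P^{op}}{\sigma\mathrm{colim}^{\mathscr{C}_P}}\;\mathcal{A}(A,-),$$ where the right-hand side is the conical $\sigma$-colimit in $\mathcal{H}om_p(\mathcal{A},\mathcal{C}at)$, with respect to $\mathscr{C}_P$, of the $2$-functor $\mathcal{E}l_P^{op}\xrightarrow{\Diamond_P^{op}}\mathcal{A}^{op}\xrightarrow{h}\mathcal{H}om_p(\mathcal{A},\mathcal{C}at)$, $hA=\mathcal{A}(A,-)$.
   Context: $2$-categories and $2$-functors are strict; $\mathcal{A}^{op}$ reverses $1$-cells but not $2$-cells. $\mathcal{H}om_p(\mathcal{A},\mathcal{B})$ is the $2$-category of $2$-functors, pseudonatural transformations and modifications. $\mathcal{E}l_P$: objects are pairs $(x,A)$, $A\in\mathcal{A}$, $x\in PA$; a morphism $(x,A)\to(y,B)$ is a pair $(f,\varphi)$ with $f:A\to B$ in $\mathcal{A}$ and $\varphi:Pf(x)\to y$ in $PB$; a $2$-cell $(f,\varphi)\Rightarrow(g,\psi)$ is a $2$-cell $\theta:f\Rightarrow g$ of $\mathcal{A}$ with $\psi\circ(P\theta)_x=\varphi$. Composition: $(g,\psi)(f,\varphi)=(gf,\psi\,Pg(\varphi))$; $2$-cells compose as in $\mathcal{A}$. $\Diamond_P:\mathcal{E}l_P\to\mathcal{A}$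 is the projection. $\mathscr{C}_P$ consists of the arrows $(f,\varphi)$ with $\varphi$ an isomorphism, also regarded as a $1$-subcategory of $\mathcal{E}l_P^{op}$. Conical $\sigma$-colimit of a $2$-functor $F:\mathcal{I}\to\mathcal{B}$ with respect to a wide $1$-subcategory $\Sigma$ of $\mathcal{I}$ (a subcategory of the underlying category containing all objects): an object $L$ with a universal $\sigma$-cone. A $\sigma$-cone with vertex $E$ is an op-lax natural transformation $\theta:F\Rightarrow k_E$ to the constant $2$-functor, that is, arrows $\theta_i:Fi\to E$ and $2$-cells $\theta_u:\theta_jFu\Rightarrow\theta_i$ for $u:i\to j$, with $\theta_{id}=id$, $\theta_{vu}=\theta_u\circ\theta_vFu$, $\theta_v\circ\theta_jF\gamma=\theta_u$ for $\gamma:u\Rightarrow v$, such that $\theta_u$ is invertible for $u\in\Sigma$. Morphisms of $\sigma$-cones are modifications. Universality: precomposition $\mathcal{B}(L,E)\to Cones_\sigma(F,E)$ is an isomorphism of categories for every $E$. *)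

theory Defs
  imports "HOL-Library.FuncSet"
begin

section \<open>Categories, functors, natural transformations\<close>

record ('o, 'a) cat =
  Ob :: "'o set"
  Ar :: "'a set"
  src :: "'a \<Rightarrow> 'o"
  tgt :: "'a \<Rightarrow> 'o"
  ide :: "'o \<Rightarrow> 'a"
  cmp :: "'a \<Rightarrow> 'a \<Rightarrow> 'a"  \<comment> \<open>\<open>cmp C g f\<close> is \<open>g \<circ> f\<close>\<close>

definition arrows :: "('o, 'a) cat \<Rightarrow> 'o \<Rightarrow> 'o \<Rightarrow> 'a set" where
  "arrows C x y = {f \<in> Ar C. src C f = x \<and> tgt C f = y}"

locale category =
  fixes C :: "('o, 'a) cat"
  assumes src_in: "f \<in> Ar C \<Longrightarrow> src C f \<in> Ob C"
    and tgt_in: "f \<in> Ar C \<Longrightarrow> tgt C f \<in> Ob C"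
    and ide_in: "x \<in> Ob C \<Longrightarrow> ide C x \<in> arrows C x x"
    and cmp_in: "f \<in> arrows C x y \<Longrightarrow> g \<in> arrows C y z \<Longrightarrow> cmp C g f \<in> arrows C x z"
    and cmp_ide: "f \<in> arrows C x y \<Longrightarrow> cmp C f (ide C x) = f"
    and ide_cmp: "f \<in> arrows C x y \<Longrightarrow> cmp C (ide C y) f = f"
    and cmp_assoc: "f \<in> arrows C w x \<Longrightarrow> g \<in> arrows C x y \<Longrightarrow> h \<in> arrows C y z
          \<Longrightarrow> cmp C h (cmp C g f) = cmp C (cmp C h g) f"

definition iso_arrow :: "('o, 'a) cat \<Rightarrow> 'a \<Rightarrow> bool" where
  "iso_arrow C f \<longleftrightarrow> f \<in> Ar C \<and> (\<exists>g \<in> arrows C (tgt C f) (src C f).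
     cmp C g f = ide C (src C f) \<and> cmp C f g = ide C (tgt C f))"

definition isomorphic :: "('o, 'a) cat \<Rightarrow> 'o \<Rightarrow> 'o \<Rightarrow> bool" where
  "isomorphic C x y \<longleftrightarrow> (\<exists>f \<in> arrows C x y. iso_arrow C f)"

text \<open>Functors are extensional functions (\<open>undefined\<close> off the objects and arrows of the source), and
  likewise for all families below that serve as 1-cells or 2-cells. Thus equality of these data is
  equality of the functors, transformations and modifications they present, as is required for
  the strict universal property of \<open>\<sigma>\<close>-colimits. No such normalisation is imposed on categories
  and 2-functors, which occur as objects and are never tested for equality.\<close>

record ('o, 'a, 'p, 'b) fctr =
  FO :: "'o \<Rightarrow> 'p"
  FA :: "'a \<Rightarrow> 'b"

locale is_functor = C: category C + D: category D
  for C :: "('o, 'a) cat" and D :: "('p, 'b) cat" +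
  fixes F :: "('o, 'a, 'p, 'b) fctr"
  assumes FO_in: "FO F \<in> Ob C \<rightarrow>\<^sub>E Ob D"
    and FA_in: "FA F \<in> Ar C \<rightarrow>\<^sub>E Ar D"
    and FA_src: "f \<in> Ar C \<Longrightarrow> src D (FA F f) = FO F (src C f)"
    and FA_tgt: "f \<in> Ar C \<Longrightarrow> tgt D (FA F f) = FO F (tgt C f)"
    and FA_ide: "x \<in> Ob C \<Longrightarrow> FA F (ide C x) = ide D (FO F x)"
    and FA_cmp: "f \<in> arrows C x y \<Longrightarrow> g \<in> arrows C y z
          \<Longrightarrow> FA F (cmp C g f) = cmp D (FA F g) (FA F f)"

definition fun_id :: "('o, 'a) cat \<Rightarrow> ('o, 'a, 'o, 'a) fctr" where
  "fun_id C = \<lparr>FO = (\<lambda>x\<in>Ob C. x), FA = (\<lambda>f\<in>Ar C. f)\<rparr>"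

definition fun_comp ::
  "('o, 'a) cat \<Rightarrow> ('p, 'b, 'q, 'c) fctr \<Rightarrow> ('o, 'a, 'p, 'b) fctr \<Rightarrow> ('o, 'a, 'q, 'c) fctr" where
  "fun_comp C G F = \<lparr>FO = (\<lambda>x\<in>Ob C. FO G (FO F x)), FA = (\<lambda>f\<in>Ar C. FA G (FA F f))\<rparr>"

definition cat_isomorphism ::
  "('o, 'a) cat \<Rightarrow> ('p, 'b) cat \<Rightarrow> ('o, 'a, 'p, 'b) fctr \<Rightarrow> bool" where
  "cat_isomorphism C D F \<longleftrightarrow> is_functor C D F \<and>
     (\<exists>G. is_functor D C G \<and> fun_comp C G F = fun_id C \<and> fun_comp D F G = fun_id D)"

text \<open>A category whose arrows from \<open>F\<close> to \<open>G\<close> are the elements \<open>a\<close> of \<open>M F G\<close>, made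
  into arrows with a definite source and target by passing to \<open>(F, a, G)\<close>.\<close>

definition tagged_cat ::
  "'x set \<Rightarrow> ('x \<Rightarrow> 'x \<Rightarrow> 'm set) \<Rightarrow> ('x \<Rightarrow> 'm) \<Rightarrow> ('m \<Rightarrow> 'm \<Rightarrow> 'm) \<Rightarrow> ('x, 'x \<times> 'm \<times> 'x) cat" where
  "tagged_cat X M i c =
    \<lparr>Ob = X,
     Ar = {(F, a, G). F \<in> X \<and> G \<in> X \<and> a \<in> M F G},
     src = (\<lambda>(F, a, G). F),
     tgt = (\<lambda>(F, a, G). G),
     ide = (\<lambda>F. (F, i F, F)),
     cmp = (\<lambda>(G, b, H) (F, a, _). (F, c b a, H))\<rparr>"

definition nat_transfs :: "('o, 'a) cat \<Rightarrow> ('p, 'b) cat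
    \<Rightarrow> ('o, 'a, 'p, 'b) fctr \<Rightarrow> ('o, 'a, 'p, 'b) fctr \<Rightarrow> ('o \<Rightarrow> 'b) set" where
  "nat_transfs C D F G = {\<eta> \<in> extensional (Ob C).
     (\<forall>x \<in> Ob C. \<eta> x \<in> arrows D (FO F x) (FO G x)) \<and>
     (\<forall>f \<in> Ar C. cmp D (\<eta> (tgt C f)) (FA F f) = cmp D (FA G f) (\<eta> (src C f)))}"

type_synonym ('o, 'a, 'p, 'b) nt =
  "('o, 'a, 'p, 'b) fctr \<times> ('o \<Rightarrow> 'b) \<times> ('o, 'a, 'p, 'b) fctr"

definition functor_cat ::
  "('o, 'a) cat \<Rightarrow> ('p, 'b) cat \<Rightarrow> (('o, 'a, 'p, 'b) fctr, ('o, 'a, 'p, 'b) nt) cat" where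
  "functor_cat C D = tagged_cat {F. is_functor C D F} (nat_transfs C D)
     (\<lambda>F. \<lambda>x\<in>Ob C. ide D (FO F x))
     (\<lambda>b a. \<lambda>x\<in>Ob C. cmp D (b x) (a x))"


section \<open>2-categories and 2-functors\<close>

text \<open>A 2-category is given by its hom-categories, whose objects and arrows are the 1-cells and the
  2-cells. \<open>cmp1 A a b c\<close> and \<open>cmp2 A a b c\<close> are the object and the arrow part of the composition
  functor \<open>Hom A b c \<times> Hom A a b \<rightarrow> Hom A a c\<close>.\<close>

record ('o, 'a, 'c) twocat =
  Obj :: "'o set"
  Hom :: "'o \<Rightarrow> 'o \<Rightarrow> ('a, 'c) cat"
  one :: "'o \<Rightarrow> 'a"
  cmp1 :: "'o \<Rightarrow> 'o \<Rightarrow> 'o \<Rightarrow> 'a \<Rightarrow> 'a \<Rightarrow> 'a"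
  cmp2 :: "'o \<Rightarrow> 'o \<Rightarrow> 'o \<Rightarrow> 'c \<Rightarrow> 'c \<Rightarrow> 'c"

locale two_category =
  fixes A :: "('o, 'a, 'c) twocat"
  assumes Hom_category: "a \<in> Obj A \<Longrightarrow> b \<in> Obj A \<Longrightarrow> category (Hom A a b)"
    and one_in: "a \<in> Obj A \<Longrightarrow> one A a \<in> Ob (Hom A a a)"
    and cmp1_in: "a \<in> Obj A \<Longrightarrow> b \<in> Obj A \<Longrightarrow> c \<in> Obj A
      \<Longrightarrow> f \<in> Ob (Hom A a b) \<Longrightarrow> g \<in> Ob (Hom A b c) \<Longrightarrow> cmp1 A a b c g f \<in> Ob (Hom A a c)"
    and cmp2_in: "a \<in> Obj A \<Longrightarrow> b \<in> Obj A \<Longrightarrow> c \<in> Obj A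
      \<Longrightarrow> \<alpha> \<in> arrows (Hom A a b) f f' \<Longrightarrow> \<beta> \<in> arrows (Hom A b c) g g'
      \<Longrightarrow> cmp2 A a b c \<beta> \<alpha> \<in> arrows (Hom A a c) (cmp1 A a b c g f) (cmp1 A a b c g' f')"
    and cmp2_ide: "a \<in> Obj A \<Longrightarrow> b \<in> Obj A \<Longrightarrow> c \<in> Obj A
      \<Longrightarrow> f \<in> Ob (Hom A a b) \<Longrightarrow> g \<in> Ob (Hom A b c)
      \<Longrightarrow> cmp2 A a b c (ide (Hom A b c) g) (ide (Hom A a b) f) = ide (Hom A a c) (cmp1 A a b c g f)"
    and interchange: "a \<in> Obj A \<Longrightarrow> b \<in> Obj A \<Longrightarrow> c \<in> Obj A
      \<Longrightarrow> \<alpha> \<in> arrows (Hom A a b) f f' \<Longrightarrow> \<alpha>' \<in> arrows (Hom A a b) f' f''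
      \<Longrightarrow> \<beta> \<in> arrows (Hom A b c) g g' \<Longrightarrow> \<beta>' \<in> arrows (Hom A b c) g' g''
      \<Longrightarrow> cmp2 A a b c (cmp (Hom A b c) \<beta>' \<beta>) (cmp (Hom A a b) \<alpha>' \<alpha>)
          = cmp (Hom A a c) (cmp2 A a b c \<beta>' \<alpha>') (cmp2 A a b c \<beta> \<alpha>)"
    and cmp1_one: "a \<in> Obj A \<Longrightarrow> b \<in> Obj A \<Longrightarrow> f \<in> Ob (Hom A a b) \<Longrightarrow> cmp1 A a a b f (one A a) = f"
    and one_cmp1: "a \<in> Obj A \<Longrightarrow> b \<in> Obj A \<Longrightarrow> f \<in> Ob (Hom A a b) \<Longrightarrow> cmp1 A a b b (one A b) f = f"
    and cmp2_one: "a \<in> Obj A \<Longrightarrow> b \<in> Obj A \<Longrightarrow> \<alpha> \<in> Ar (Hom A a b)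
      \<Longrightarrow> cmp2 A a a b \<alpha> (ide (Hom A a a) (one A a)) = \<alpha>"
    and one_cmp2: "a \<in> Obj A \<Longrightarrow> b \<in> Obj A \<Longrightarrow> \<alpha> \<in> Ar (Hom A a b)
      \<Longrightarrow> cmp2 A a b b (ide (Hom A b b) (one A b)) \<alpha> = \<alpha>"
    and cmp1_assoc: "a \<in> Obj A \<Longrightarrow> b \<in> Obj A \<Longrightarrow> c \<in> Obj A \<Longrightarrow> d \<in> Obj A
      \<Longrightarrow> f \<in> Ob (Hom A a b) \<Longrightarrow> g \<in> Ob (Hom A b c) \<Longrightarrow> h \<in> Ob (Hom A c d)
      \<Longrightarrow> cmp1 A a c d h (cmp1 A a b c g f) = cmp1 A a b d (cmp1 A b c d h g) f"
    and cmp2_assoc: "a \<in> Obj A \<Longrightarrow> b \<in> Obj A \<Longrightarrow> c \<in> Obj A \<Longrightarrow> d \<in> Obj A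
      \<Longrightarrow> \<alpha> \<in> Ar (Hom A a b) \<Longrightarrow> \<beta> \<in> Ar (Hom A b c) \<Longrightarrow> \<gamma> \<in> Ar (Hom A c d)
      \<Longrightarrow> cmp2 A a c d \<gamma> (cmp2 A a b c \<beta> \<alpha>) = cmp2 A a b d (cmp2 A b c d \<gamma> \<beta>) \<alpha>"

text \<open>Whiskering: \<open>whisk_l A a b c g \<alpha>\<close> is \<open>g \<alpha>\<close> and \<open>whisk_r A a b c \<beta> f\<close> is \<open>\<beta> f\<close>,
  for \<open>f : a \<rightarrow> b\<close> and \<open>g : b \<rightarrow> c\<close>.\<close>

definition whisk_l :: "('o, 'a, 'c) twocat \<Rightarrow> 'o \<Rightarrow> 'o \<Rightarrow> 'o \<Rightarrow> 'a \<Rightarrow> 'c \<Rightarrow> 'c" where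
  "whisk_l A a b c g \<alpha> = cmp2 A a b c (ide (Hom A b c) g) \<alpha>"

definition whisk_r :: "('o, 'a, 'c) twocat \<Rightarrow> 'o \<Rightarrow> 'o \<Rightarrow> 'o \<Rightarrow> 'c \<Rightarrow> 'a \<Rightarrow> 'c" where
  "whisk_r A a b c \<beta> f = cmp2 A a b c \<beta> (ide (Hom A a b) f)"

definition op2 :: "('o, 'a, 'c) twocat \<Rightarrow> ('o, 'a, 'c) twocat" where
  "op2 A = \<lparr>Obj = Obj A, Hom = (\<lambda>a b. Hom A b a), one = one A,
     cmp1 = (\<lambda>a b c g f. cmp1 A c b a f g), cmp2 = (\<lambda>a b c \<beta> \<alpha>. cmp2 A c b a \<alpha> \<beta>)\<rparr>"

record ('o, 'a, 'c, 'p, 'b, 'd) twofun =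
  F0 :: "'o \<Rightarrow> 'p"
  FH :: "'o \<Rightarrow> 'o \<Rightarrow> ('a, 'c, 'b, 'd) fctr"  \<comment> \<open>the functors between hom-categories\<close>

definition F1 :: "('o, 'a, 'c, 'p, 'b, 'd) twofun \<Rightarrow> 'o \<Rightarrow> 'o \<Rightarrow> 'a \<Rightarrow> 'b" where
  "F1 F a b f = FO (FH F a b) f"

definition F2 :: "('o, 'a, 'c, 'p, 'b, 'd) twofun \<Rightarrow> 'o \<Rightarrow> 'o \<Rightarrow> 'c \<Rightarrow> 'd" where
  "F2 F a b \<alpha> = FA (FH F a b) \<alpha>"

locale two_functor = A: two_category A + B: two_category B
  for A :: "('o, 'a, 'c) twocat" and B :: "('p, 'b, 'd) twocat" +
  fixes F :: "('o, 'a, 'c, 'p, 'b, 'd) twofun"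
  assumes F0_in: "a \<in> Obj A \<Longrightarrow> F0 F a \<in> Obj B"
    and FH_functor: "a \<in> Obj A \<Longrightarrow> b \<in> Obj A
      \<Longrightarrow> is_functor (Hom A a b) (Hom B (F0 F a) (F0 F b)) (FH F a b)"
    and F1_one: "a \<in> Obj A \<Longrightarrow> F1 F a a (one A a) = one B (F0 F a)"
    and F1_cmp1: "a \<in> Obj A \<Longrightarrow> b \<in> Obj A \<Longrightarrow> c \<in> Obj A
      \<Longrightarrow> f \<in> Ob (Hom A a b) \<Longrightarrow> g \<in> Ob (Hom A b c)
      \<Longrightarrow> F1 F a c (cmp1 A a b c g f)
          = cmp1 B (F0 F a) (F0 F b) (F0 F c) (F1 F b c g) (F1 F a b f)"
    and F2_cmp2: "a \<in> Obj A \<Longrightarrow> b \<in> Obj A \<Longrightarrow> c \<in> Obj A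
      \<Longrightarrow> \<alpha> \<in> Ar (Hom A a b) \<Longrightarrow> \<beta> \<in> Ar (Hom A b c)
      \<Longrightarrow> F2 F a c (cmp2 A a b c \<beta> \<alpha>)
          = cmp2 B (F0 F a) (F0 F b) (F0 F c) (F2 F b c \<beta>) (F2 F a b \<alpha>)"

definition twofun_op :: "('o, 'a, 'c, 'p, 'b, 'd) twofun \<Rightarrow> ('o, 'a, 'c, 'p, 'b, 'd) twofun" where
  "twofun_op F = \<lparr>F0 = F0 F, FH = (\<lambda>a b. FH F b a)\<rparr>"

definition twofun_comp :: "('o, 'a, 'c) twocat \<Rightarrow> ('p, 'b, 'd, 'q, 'e, 'f) twofun
    \<Rightarrow> ('o, 'a, 'c, 'p, 'b, 'd) twofun \<Rightarrow> ('o, 'a, 'c, 'q, 'e, 'f) twofun" where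
  "twofun_comp A G F = \<lparr>F0 = (\<lambda>a. F0 G (F0 F a)),
     FH = (\<lambda>a b. fun_comp (Hom A a b) (FH G (F0 F a) (F0 F b)) (FH F a b))\<rparr>"

definition const2 :: "('o, 'a, 'c) twocat \<Rightarrow> ('p, 'b, 'd) twocat \<Rightarrow> 'p
    \<Rightarrow> ('o, 'a, 'c, 'p, 'b, 'd) twofun" where
  "const2 A B E = \<lparr>F0 = (\<lambda>a. E),
     FH = (\<lambda>a b. \<lparr>FO = (\<lambda>f\<in>Ob (Hom A a b). one B E),
                  FA = (\<lambda>\<alpha>\<in>Ar (Hom A a b). ide (Hom B E E) (one B E))\<rparr>)\<rparr>"

definition equivalent_in :: "('o, 'a, 'c) twocat \<Rightarrow> 'o \<Rightarrow> 'o \<Rightarrow> bool" where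
  "equivalent_in B X Y \<longleftrightarrow> X \<in> Obj B \<and> Y \<in> Obj B \<and>
     (\<exists>f \<in> Ob (Hom B X Y). \<exists>g \<in> Ob (Hom B Y X).
        isomorphic (Hom B X X) (cmp1 B X Y X g f) (one B X) \<and>
        isomorphic (Hom B Y Y) (cmp1 B Y X Y f g) (one B Y))"


section \<open>Op-lax natural transformations and modifications\<close>

text \<open>Triples \<open>(a, b, f)\<close> with \<open>f : a \<rightarrow> b\<close>.\<close>

definition cells1 :: "('o, 'a, 'c) twocat \<Rightarrow> ('o \<times> 'o \<times> 'a) set" where
  "cells1 A = {(a, b, f). a \<in> Obj A \<and> b \<in> Obj A \<and> f \<in> Ob (Hom A a b)}"

record ('o, 'a, 'b, 'd) transf =
  T0 :: "'o \<Rightarrow> 'b"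
  T1 :: "'o \<times> 'o \<times> 'a \<Rightarrow> 'd"

locale oplax_nat = F: two_functor A B F + G: two_functor A B G
  for A :: "('o, 'a, 'c) twocat" and B :: "('p, 'b, 'd) twocat"
    and F G :: "('o, 'a, 'c, 'p, 'b, 'd) twofun" +
  fixes \<theta> :: "('o, 'a, 'b, 'd) transf"
  assumes T0_ext: "T0 \<theta> \<in> extensional (Obj A)"
    and T1_ext: "T1 \<theta> \<in> extensional (cells1 A)"
    and T0_in: "a \<in> Obj A \<Longrightarrow> T0 \<theta> a \<in> Ob (Hom B (F0 F a) (F0 G a))"
    and T1_in: "a \<in> Obj A \<Longrightarrow> b \<in> Obj A \<Longrightarrow> f \<in> Ob (Hom A a b)
      \<Longrightarrow> T1 \<theta> (a, b, f) \<in> arrows (Hom B (F0 F a) (F0 G b))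
            (cmp1 B (F0 F a) (F0 F b) (F0 G b) (T0 \<theta> b) (F1 F a b f))
            (cmp1 B (F0 F a) (F0 G a) (F0 G b) (F1 G a b f) (T0 \<theta> a))"
    and T1_one: "a \<in> Obj A \<Longrightarrow> T1 \<theta> (a, a, one A a) = ide (Hom B (F0 F a) (F0 G a)) (T0 \<theta> a)"
    and T1_cmp1: "a \<in> Obj A \<Longrightarrow> b \<in> Obj A \<Longrightarrow> c \<in> Obj A
      \<Longrightarrow> f \<in> Ob (Hom A a b) \<Longrightarrow> g \<in> Ob (Hom A b c)
      \<Longrightarrow> T1 \<theta> (a, c, cmp1 A a b c g f) = cmp (Hom B (F0 F a) (F0 G c))
            (whisk_l B (F0 F a) (F0 G b) (F0 G c) (F1 G b c g) (T1 \<theta> (a, b, f)))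
            (whisk_r B (F0 F a) (F0 F b) (F0 G c) (T1 \<theta> (b, c, g)) (F1 F a b f))"
    and T1_nat: "a \<in> Obj A \<Longrightarrow> b \<in> Obj A \<Longrightarrow> \<gamma> \<in> arrows (Hom A a b) f f'
      \<Longrightarrow> cmp (Hom B (F0 F a) (F0 G b))
            (T1 \<theta> (a, b, f')) (whisk_l B (F0 F a) (F0 F b) (F0 G b) (T0 \<theta> b) (F2 F a b \<gamma>))
          = cmp (Hom B (F0 F a) (F0 G b))
            (whisk_r B (F0 F a) (F0 G a) (F0 G b) (F2 G a b \<gamma>) (T0 \<theta> a)) (T1 \<theta> (a, b, f))"

text \<open>For a family \<open>S\<close> of sets of 1-cells, \<open>S\<close>-natural transformations are those whose structure
  2-cells at 1-cells of \<open>S\<close> are invertible. Taking all 1-cells gives the pseudonatural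
  transformations; their 2-cells being invertible, the op-lax orientation is immaterial there.\<close>

definition sigma_nat :: "('o, 'a, 'c) twocat \<Rightarrow> ('p, 'b, 'd) twocat \<Rightarrow> ('o \<Rightarrow> 'o \<Rightarrow> 'a set)
    \<Rightarrow> ('o, 'a, 'c, 'p, 'b, 'd) twofun \<Rightarrow> ('o, 'a, 'c, 'p, 'b, 'd) twofun
    \<Rightarrow> ('o, 'a, 'b, 'd) transf \<Rightarrow> bool" where
  "sigma_nat A B S F G \<theta> \<longleftrightarrow> oplax_nat A B F G \<theta> \<and>
     (\<forall>a \<in> Obj A. \<forall>b \<in> Obj A. \<forall>f \<in> S a b.
        iso_arrow (Hom B (F0 F a) (F0 G b)) (T1 \<theta> (a, b, f)))"

definition modifications :: "('o, 'a, 'c) twocat \<Rightarrow> ('p, 'b, 'd) twocat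
    \<Rightarrow> ('o, 'a, 'c, 'p, 'b, 'd) twofun \<Rightarrow> ('o, 'a, 'c, 'p, 'b, 'd) twofun
    \<Rightarrow> ('o, 'a, 'b, 'd) transf \<Rightarrow> ('o, 'a, 'b, 'd) transf \<Rightarrow> ('o \<Rightarrow> 'd) set" where
  "modifications A B F G \<theta> \<theta>' = {\<rho> \<in> extensional (Obj A).
     (\<forall>a \<in> Obj A. \<rho> a \<in> arrows (Hom B (F0 F a) (F0 G a)) (T0 \<theta> a) (T0 \<theta>' a)) \<and>
     (\<forall>a \<in> Obj A. \<forall>b \<in> Obj A. \<forall>f \<in> Ob (Hom A a b).
        cmp (Hom B (F0 F a) (F0 G b))
          (whisk_l B (F0 F a) (F0 G a) (F0 G b) (F1 G a b f) (\<rho> a)) (T1 \<theta> (a, b, f))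
        = cmp (Hom B (F0 F a) (F0 G b))
          (T1 \<theta>' (a, b, f)) (whisk_r B (F0 F a) (F0 F b) (F0 G b) (\<rho> b) (F1 F a b f)))}"

type_synonym ('o, 'a, 'b, 'd) modif =
  "('o, 'a, 'b, 'd) transf \<times> ('o \<Rightarrow> 'd) \<times> ('o, 'a, 'b, 'd) transf"

definition sigma_nat_cat :: "('o, 'a, 'c) twocat \<Rightarrow> ('p, 'b, 'd) twocat \<Rightarrow> ('o \<Rightarrow> 'o \<Rightarrow> 'a set)
    \<Rightarrow> ('o, 'a, 'c, 'p, 'b, 'd) twofun \<Rightarrow> ('o, 'a, 'c, 'p, 'b, 'd) twofun
    \<Rightarrow> (('o, 'a, 'b, 'd) transf, ('o, 'a, 'b, 'd) modif) cat" where
  "sigma_nat_cat A B S F G = tagged_cat {\<theta>. sigma_nat A B S F G \<theta>} (modifications A B F G)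
     (\<lambda>\<theta>. \<lambda>a\<in>Obj A. ide (Hom B (F0 F a) (F0 G a)) (T0 \<theta> a))
     (\<lambda>\<sigma> \<rho>. \<lambda>a\<in>Obj A. cmp (Hom B (F0 F a) (F0 G a)) (\<sigma> a) (\<rho> a))"

definition transf_id :: "('o, 'a, 'c) twocat \<Rightarrow> ('p, 'b, 'd) twocat
    \<Rightarrow> ('o, 'a, 'c, 'p, 'b, 'd) twofun \<Rightarrow> ('o, 'a, 'b, 'd) transf" where
  "transf_id A B F = \<lparr>T0 = (\<lambda>a\<in>Obj A. one B (F0 F a)),
     T1 = (\<lambda>(a, b, f)\<in>cells1 A. ide (Hom B (F0 F a) (F0 F b)) (F1 F a b f))\<rparr>"

definition transf_comp :: "('o, 'a, 'c) twocat \<Rightarrow> ('p, 'b, 'd) twocat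
    \<Rightarrow> ('o, 'a, 'c, 'p, 'b, 'd) twofun \<Rightarrow> ('o, 'a, 'c, 'p, 'b, 'd) twofun
    \<Rightarrow> ('o, 'a, 'c, 'p, 'b, 'd) twofun
    \<Rightarrow> ('o, 'a, 'b, 'd) transf \<Rightarrow> ('o, 'a, 'b, 'd) transf \<Rightarrow> ('o, 'a, 'b, 'd) transf" where
  "transf_comp A B F G H \<tau> \<theta> =
    \<lparr>T0 = (\<lambda>a\<in>Obj A. cmp1 B (F0 F a) (F0 G a) (F0 H a) (T0 \<tau> a) (T0 \<theta> a)),
     T1 = (\<lambda>(a, b, f)\<in>cells1 A. cmp (Hom B (F0 F a) (F0 H b))
        (whisk_r B (F0 F a) (F0 G a) (F0 H b) (T1 \<tau> (a, b, f)) (T0 \<theta> a))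
        (whisk_l B (F0 F a) (F0 G b) (F0 H b) (T0 \<tau> b) (T1 \<theta> (a, b, f))))\<rparr>"

definition Hom_p :: "('o, 'a, 'c) twocat \<Rightarrow> ('p, 'b, 'd) twocat
    \<Rightarrow> (('o, 'a, 'c, 'p, 'b, 'd) twofun, ('o, 'a, 'b, 'd) transf, ('o, 'a, 'b, 'd) modif) twocat"
  where
  "Hom_p A B =
    \<lparr>Obj = {F. two_functor A B F},
     Hom = sigma_nat_cat A B (\<lambda>a b. Ob (Hom A a b)),
     one = transf_id A B,
     cmp1 = transf_comp A B,
     cmp2 = (\<lambda>F G H (\<tau>, \<sigma>, \<tau>') (\<theta>, \<rho>, \<theta>').
        (transf_comp A B F G H \<tau> \<theta>,
         \<lambda>a\<in>Obj A. cmp2 B (F0 F a) (F0 G a) (F0 H a) (\<sigma> a) (\<rho> a),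
         transf_comp A B F G H \<tau>' \<theta>'))\<rparr>"


section \<open>Conical \<open>\<sigma>\<close>-colimits\<close>

definition wide_subcat :: "('o, 'a, 'c) twocat \<Rightarrow> ('o \<Rightarrow> 'o \<Rightarrow> 'a set) \<Rightarrow> bool" where
  "wide_subcat I S \<longleftrightarrow>
     (\<forall>i \<in> Obj I. \<forall>j \<in> Obj I. S i j \<subseteq> Ob (Hom I i j)) \<and>
     (\<forall>i \<in> Obj I. one I i \<in> S i i) \<and>
     (\<forall>i \<in> Obj I. \<forall>j \<in> Obj I. \<forall>k \<in> Obj I. \<forall>u \<in> S i j. \<forall>v \<in> S j k. cmp1 I i j k v u \<in> S i k)"

definition sigma_cones :: "('o, 'a, 'c) twocat \<Rightarrow> ('p, 'b, 'd) twocat \<Rightarrow> ('o \<Rightarrow> 'o \<Rightarrow> 'a set)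
    \<Rightarrow> ('o, 'a, 'c, 'p, 'b, 'd) twofun \<Rightarrow> 'p
    \<Rightarrow> (('o, 'a, 'b, 'd) transf, ('o, 'a, 'b, 'd) modif) cat" where
  "sigma_cones I B S F E = sigma_nat_cat I B S F (const2 I B E)"

definition cone_comp :: "('o, 'a, 'c) twocat \<Rightarrow> ('p, 'b, 'd) twocat
    \<Rightarrow> ('o, 'a, 'c, 'p, 'b, 'd) twofun \<Rightarrow> 'p \<Rightarrow> 'p
    \<Rightarrow> ('o, 'a, 'b, 'd) transf \<Rightarrow> 'b \<Rightarrow> ('o, 'a, 'b, 'd) transf" where
  "cone_comp I B F L E l t =
    \<lparr>T0 = (\<lambda>i\<in>Obj I. cmp1 B (F0 F i) L E t (T0 l i)),
     T1 = (\<lambda>(i, j, u)\<in>cells1 I. whisk_l B (F0 F i) L E t (T1 l (i, j, u)))\<rparr>"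

definition precomposition :: "('o, 'a, 'c) twocat \<Rightarrow> ('p, 'b, 'd) twocat
    \<Rightarrow> ('o, 'a, 'c, 'p, 'b, 'd) twofun \<Rightarrow> 'p \<Rightarrow> 'p \<Rightarrow> ('o, 'a, 'b, 'd) transf
    \<Rightarrow> ('b, 'd, ('o, 'a, 'b, 'd) transf, ('o, 'a, 'b, 'd) modif) fctr" where
  "precomposition I B F L E l =
    \<lparr>FO = (\<lambda>t\<in>Ob (Hom B L E). cone_comp I B F L E l t),
     FA = (\<lambda>\<beta>\<in>Ar (Hom B L E).
        (cone_comp I B F L E l (src (Hom B L E) \<beta>),
         \<lambda>i\<in>Obj I. whisk_r B (F0 F i) L E \<beta> (T0 l i),
         cone_comp I B F L E l (tgt (Hom B L E) \<beta>)))\<rparr>"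

definition sigma_colimit :: "('o, 'a, 'c) twocat \<Rightarrow> ('p, 'b, 'd) twocat \<Rightarrow> ('o \<Rightarrow> 'o \<Rightarrow> 'a set)
    \<Rightarrow> ('o, 'a, 'c, 'p, 'b, 'd) twofun \<Rightarrow> 'p \<Rightarrow> ('o, 'a, 'b, 'd) transf \<Rightarrow> bool" where
  "sigma_colimit I B S F L l \<longleftrightarrow>
     two_functor I B F \<and> wide_subcat I S \<and> L \<in> Obj B \<and> l \<in> Ob (sigma_cones I B S F L) \<and>
     (\<forall>E \<in> Obj B. cat_isomorphism (Hom B L E) (sigma_cones I B S F E) (precomposition I B F L E l))"


section \<open>The 2-category of small categories\<close>

text \<open>Smallness is relative to an infinite regular cardinal \<open>r\<close> on the type \<open>'u\<close>: small sets are
  the sets of elements of \<open>'u\<close> of cardinality less than \<open>r\<close>. For a strongly inaccessible \<open>r\<close> these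
  are, up to bijection, the elements of a Grothendieck universe; regularity alone suffices
  for what follows and, unlike inaccessibility, is available in HOL.\<close>

unbundle cardinal_syntax

definition CAT :: "'u rel
    \<Rightarrow> (('u, 'u) cat, ('u, 'u, 'u, 'u) fctr, ('u, 'u, 'u, 'u) nt) twocat" where
  "CAT r =
    \<lparr>Obj = {C. category C \<and> |Ob C| <o r \<and> |Ar C| <o r},
     Hom = functor_cat,
     one = fun_id,
     cmp1 = (\<lambda>C D E G F. fun_comp C G F),
     cmp2 = (\<lambda>C D E (G, \<beta>, G') (F, \<alpha>, F').
        (fun_comp C G F,
         \<lambda>x\<in>Ob C. cmp E (\<beta> (FO F' x)) (FA G (\<alpha> x)),
         fun_comp C G' F'))\<rparr>"

definition small_two_category :: "'u rel \<Rightarrow> ('u, 'u, 'u) twocat \<Rightarrow> bool" where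
  "small_two_category r A \<longleftrightarrow> two_category A \<and> |Obj A| <o r \<and>
     (\<forall>a \<in> Obj A. \<forall>b \<in> Obj A. |Ob (Hom A a b)| <o r \<and> |Ar (Hom A a b)| <o r)"

type_synonym 'u cat_valued =
  "('u, 'u, 'u, ('u, 'u) cat, ('u, 'u, 'u, 'u) fctr, ('u, 'u, 'u, 'u) nt) twofun"

type_synonym 'u cat_transf =
  "('u, 'u, ('u, 'u, 'u, 'u) fctr, ('u, 'u, 'u, 'u) nt) transf"

type_synonym 'u cat_modif =
  "('u, 'u, ('u, 'u, 'u, 'u) fctr, ('u, 'u, 'u, 'u) nt) modif"


section \<open>Representable 2-functors\<close>

definition postcomp :: "('o, 'a, 'c) twocat \<Rightarrow> 'o \<Rightarrow> 'o \<Rightarrow> 'o \<Rightarrow> 'a \<Rightarrow> ('a, 'c, 'a, 'c) fctr" where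
  "postcomp A X b b' f =
    \<lparr>FO = (\<lambda>g\<in>Ob (Hom A X b). cmp1 A X b b' f g),
     FA = (\<lambda>\<alpha>\<in>Ar (Hom A X b). whisk_l A X b b' f \<alpha>)\<rparr>"

definition precomp :: "('o, 'a, 'c) twocat \<Rightarrow> 'o \<Rightarrow> 'o \<Rightarrow> 'o \<Rightarrow> 'a \<Rightarrow> ('a, 'c, 'a, 'c) fctr" where
  "precomp A Y X b u =
    \<lparr>FO = (\<lambda>g\<in>Ob (Hom A X b). cmp1 A Y X b g u),
     FA = (\<lambda>\<alpha>\<in>Ar (Hom A X b). whisk_r A Y X b \<alpha> u)\<rparr>"

definition representable :: "('u, 'u, 'u) twocat \<Rightarrow> 'u \<Rightarrow> 'u cat_valued" where
  "representable A X =
    \<lparr>F0 = Hom A X,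
     FH = (\<lambda>b b'.
       \<lparr>FO = (\<lambda>f\<in>Ob (Hom A b b'). postcomp A X b b' f),
        FA = (\<lambda>\<gamma>\<in>Ar (Hom A b b').
          (postcomp A X b b' (src (Hom A b b') \<gamma>),
           \<lambda>g\<in>Ob (Hom A X b). whisk_r A X b b' \<gamma> g,
           postcomp A X b b' (tgt (Hom A b b') \<gamma>)))\<rparr>)\<rparr>"

definition representable_transf ::
  "('u, 'u, 'u) twocat \<Rightarrow> 'u \<Rightarrow> 'u \<Rightarrow> 'u \<Rightarrow> 'u cat_transf" where
  "representable_transf A Y X u =
    \<lparr>T0 = (\<lambda>b\<in>Obj A. precomp A Y X b u),
     T1 = (\<lambda>(b, b', f)\<in>cells1 A. ide (functor_cat (Hom A X b) (Hom A Y b'))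
        (fun_comp (Hom A X b) (precomp A Y X b' u) (postcomp A X b b' f)))\<rparr>"

definition yoneda :: "('u, 'u, 'u) twocat
    \<Rightarrow> ('u, 'u, 'u, 'u cat_valued, 'u cat_transf, 'u cat_modif) twofun" where
  "yoneda A =
    \<lparr>F0 = representable A,
     FH = (\<lambda>X Y.
       \<lparr>FO = (\<lambda>u\<in>Ob (Hom A Y X). representable_transf A Y X u),
        FA = (\<lambda>\<gamma>\<in>Ar (Hom A Y X).
          (representable_transf A Y X (src (Hom A Y X) \<gamma>),
           \<lambda>b\<in>Obj A.
             (precomp A Y X b (src (Hom A Y X) \<gamma>),
              \<lambda>g\<in>Ob (Hom A X b). whisk_l A Y X b g \<gamma>,
              precomp A Y X b (tgt (Hom A Y X) \<gamma>)),
           representable_transf A Y X (tgt (Hom A Y X) \<gamma>)))\<rparr>)\<rparr>"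


section \<open>The 2-category of elements\<close>

type_synonym 'u el_cat = "('u \<times> 'u, 'u \<times> 'u, ('u \<times> 'u) \<times> 'u \<times> ('u \<times> 'u)) twocat"

definition El :: "('u, 'u, 'u) twocat \<Rightarrow> 'u cat_valued \<Rightarrow> 'u el_cat" where
  "El A P =
    \<lparr>Obj = {(x, a). a \<in> Obj A \<and> x \<in> Ob (F0 P a)},
     Hom = (\<lambda>(x, a) (y, b). tagged_cat
        {(f, \<phi>). f \<in> Ob (Hom A a b) \<and> \<phi> \<in> arrows (F0 P b) (FO (F1 P a b f) x) y}
        (\<lambda>(f, \<phi>) (g, \<psi>). {\<theta> \<in> arrows (Hom A a b) f g.
           case F2 P a b \<theta> of (_, P\<theta>, _) \<Rightarrow> cmp (F0 P b) \<psi> (P\<theta> x) = \<phi>})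
        (\<lambda>(f, \<phi>). ide (Hom A a b) f)
        (cmp (Hom A a b))),
     one = (\<lambda>(x, a). (one A a, ide (F0 P a) x)),
     cmp1 = (\<lambda>(x, a) (y, b) (z, c) (g, \<psi>) (f, \<phi>).
        (cmp1 A a b c g f, cmp (F0 P c) \<psi> (FA (F1 P b c g) \<phi>))),
     cmp2 = (\<lambda>(x, a) (y, b) (z, c) ((g, \<psi>), \<beta>, (g', \<psi>')) ((f, \<phi>), \<alpha>, (f', \<phi>')).
        ((cmp1 A a b c g f, cmp (F0 P c) \<psi> (FA (F1 P b c g) \<phi>)),
         cmp2 A a b c \<beta> \<alpha>,
         (cmp1 A a b c g' f', cmp (F0 P c) \<psi>' (FA (F1 P b c g') \<phi>'))))\<rparr>"

definition El_proj :: "('u, 'u, 'u) twocat \<Rightarrow> 'u cat_valued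
    \<Rightarrow> ('u \<times> 'u, 'u \<times> 'u, ('u \<times> 'u) \<times> 'u \<times> ('u \<times> 'u), 'u, 'u, 'u) twofun" where
  "El_proj A P =
    \<lparr>F0 = (\<lambda>(x, a). a),
     FH = (\<lambda>X Y.
       \<lparr>FO = (\<lambda>(f, \<phi>)\<in>Ob (Hom (El A P) X Y). f),
        FA = (\<lambda>(u, \<theta>, v)\<in>Ar (Hom (El A P) X Y). \<theta>)\<rparr>)\<rparr>"

definition cart_arrows :: "('u, 'u, 'u) twocat \<Rightarrow> 'u cat_valued
    \<Rightarrow> 'u \<times> 'u \<Rightarrow> 'u \<times> 'u \<Rightarrow> ('u \<times> 'u) set" where
  "cart_arrows A P X Y = {(f, \<phi>) \<in> Ob (Hom (El A P) X Y). iso_arrow (F0 P (snd Y)) \<phi>}"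

definition cart_arrows_op :: "('u, 'u, 'u) twocat \<Rightarrow> 'u cat_valued
    \<Rightarrow> 'u \<times> 'u \<Rightarrow> 'u \<times> 'u \<Rightarrow> ('u \<times> 'u) set" where
  "cart_arrows_op A P X Y = cart_arrows A P Y X"

definition El_diagram :: "('u, 'u, 'u) twocat \<Rightarrow> 'u cat_valued
    \<Rightarrow> ('u \<times> 'u, 'u \<times> 'u, ('u \<times> 'u) \<times> 'u \<times> ('u \<times> 'u),
        'u cat_valued, 'u cat_transf, 'u cat_modif) twofun" where
  "El_diagram A P = twofun_comp (op2 (El A P)) (yoneda A) (twofun_op (El_proj A P))"

end

theory Submission
  imports Defs
begin

text \<open>The colimit is computed pointwise. Its value at \<open>b\<close> has the triples \<open>(x, a, g)\<close> with \<open>x \<in> P a\<close>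
  and \<open>g : a \<rightarrow> b\<close> as objects and the arrows \<open>P g x \<rightarrow> P g' x'\<close> of \<open>P b\<close> as arrows
  \<open>(x, a, g) \<rightarrow> (x', a', g')\<close>; it is therefore equivalent to \<open>P b\<close> by \<open>(x, a, g) \<mapsto> P g x\<close>, with
  quasi-inverse \<open>x \<mapsto> (x, b, 1)\<close>, which is only pseudonatural in \<open>b\<close>. A cone \<open>\<theta>\<close> determines a functor out
  of it: the 2-cells \<open>\<theta>\<close> at the cartesian arrows \<open>(g, 1) : (x, a) \<rightarrow> (P g x, b)\<close> are invertible, so the
  image of \<open>m : P g x \<rightarrow> P g' x'\<close> must be the composite of \<open>\<theta>\<close> at \<open>(g, 1)\<close>, of \<open>\<theta>\<close> at \<open>(1, m)\<close> and of the
  inverse of \<open>\<theta>\<close> at \<open>(g', 1)\<close>. Since the definition of \<open>\<sigma>\<close>-colimit is strict, any other one is isomorphic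
  to this one.\<close>


section \<open>Categories and functors\<close>

text \<open>The universal property is an isomorphism of categories, so \<open>P\<close> itself
  cannot in general be the vertex: its coprojections would identify (x, a, g) and (x', a', g') as
  soon as P g x = P g' x', whereas a cone may send them to objects that are different and merely
  isomorphic. With all triples kept apart, the object part of the induced functor and its
  pseudonaturality cells are a copy of the data of the cone; the coprojections are strictly natural,
  and this forces those cells. The work lies in everything that involves arrows. The arrows of the
  colimit are generated under composition and inversion by the cells of the cone, so naturality and
  equality of functors are tested on these generators. Two facts about cardinals enter: triples over
  an infinite type embed into that type, which keeps the values of the colimit within the type of
  \<open>CAT r\<close>, and regularity keeps them small. As 1-cells and 2-cells are compared by
  equality, statements about functors, transformations and modifications are brought down to
  equations between arrows of single categories.\<close>

lemma in_arrows: "f \<in> arrows C x y \<longleftrightarrow> f \<in> Ar C \<and> src C f = x \<and> tgt C f = y"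
  by (auto simp: arrows_def)

text \<open>Choice turns inversion into a total function, so that inverses can occur inside terms;
  the value is meaningful only at invertible arrows.\<close>

definition arr_inv :: "('o, 'a) cat \<Rightarrow> 'a \<Rightarrow> 'a" where
  "arr_inv C f = (SOME g. g \<in> arrows C (tgt C f) (src C f) \<and>
     cmp C g f = ide C (src C f) \<and> cmp C f g = ide C (tgt C f))"

lemma iso_arrowI:
  assumes "f \<in> Ar C" "g \<in> Ar C" "src C g = tgt C f" "tgt C g = src C f"
    "cmp C g f = ide C (src C f)" "cmp C f g = ide C (tgt C f)"
  shows "iso_arrow C f"
  using assms by (auto simp: iso_arrow_def in_arrows)

lemma iso_arrow_Ar: "iso_arrow C f \<Longrightarrow> f \<in> Ar C"
  by (simp add: iso_arrow_def)

lemma arr_inv_spec: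
  assumes "iso_arrow C f"
  shows "arr_inv C f \<in> arrows C (tgt C f) (src C f) \<and>
     cmp C (arr_inv C f) f = ide C (src C f) \<and> cmp C f (arr_inv C f) = ide C (tgt C f)"
  using assms unfolding iso_arrow_def arr_inv_def Bex_def by - (rule someI_ex, simp)

lemma arr_inv [simp]:
  assumes "iso_arrow C f"
  shows "arr_inv C f \<in> Ar C" "src C (arr_inv C f) = tgt C f" "tgt C (arr_inv C f) = src C f"
    "cmp C (arr_inv C f) f = ide C (src C f)" "cmp C f (arr_inv C f) = ide C (tgt C f)"
  using arr_inv_spec [OF assms] by (auto simp: in_arrows)

context category
begin

declare src_in [simp] tgt_in [simp]

lemma ide_Ar [simp]: "x \<in> Ob C \<Longrightarrow> ide C x \<in> Ar C"
  and src_ide [simp]: "x \<in> Ob C \<Longrightarrow> src C (ide C x) = x"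
  and tgt_ide [simp]: "x \<in> Ob C \<Longrightarrow> tgt C (ide C x) = x"
  using ide_in by (auto simp: in_arrows)

lemma cmp_Ar [simp]: "\<lbrakk>f \<in> Ar C; g \<in> Ar C; src C g = tgt C f\<rbrakk> \<Longrightarrow> cmp C g f \<in> Ar C"
  and src_cmp [simp]: "\<lbrakk>f \<in> Ar C; g \<in> Ar C; src C g = tgt C f\<rbrakk> \<Longrightarrow> src C (cmp C g f) = src C f"
  and tgt_cmp [simp]: "\<lbrakk>f \<in> Ar C; g \<in> Ar C; src C g = tgt C f\<rbrakk> \<Longrightarrow> tgt C (cmp C g f) = tgt C g"
  using cmp_in [of f "src C f" "tgt C f" g "tgt C g"] by (auto simp: in_arrows)

lemma cmp_ide_right [simp]: "f \<in> Ar C \<Longrightarrow> src C f = x \<Longrightarrow> cmp C f (ide C x) = f"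
  and cmp_ide_left [simp]: "f \<in> Ar C \<Longrightarrow> tgt C f = y \<Longrightarrow> cmp C (ide C y) f = f"
  using cmp_ide ide_cmp by (auto simp: in_arrows)

lemma assoc [simp]: "\<lbrakk>f \<in> Ar C; g \<in> Ar C; h \<in> Ar C; src C g = tgt C f; src C h = tgt C g\<rbrakk>
    \<Longrightarrow> cmp C (cmp C h g) f = cmp C h (cmp C g f)"
  using cmp_assoc by (auto simp: in_arrows)

text \<open>Since \<open>assoc\<close> brackets composites to the right, an arrow and its inverse
  usually meet only in front of a third arrow \<open>h\<close>; the cancellation rules of
  \<open>arr_inv\<close> do not match there.\<close>

lemma inv_cancel [simp]:
  assumes "iso_arrow C f" "h \<in> Ar C"
  shows "tgt C h = src C f \<Longrightarrow> cmp C (arr_inv C f) (cmp C f h) = h"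
    and "tgt C h = tgt C f \<Longrightarrow> cmp C f (cmp C (arr_inv C f) h) = h"
  using assms iso_arrow_Ar [OF assms(1)]
  by (simp_all add: assoc [symmetric] del: assoc)

lemma iso_cancel_left:
  assumes "iso_arrow C f" "g \<in> Ar C" "h \<in> Ar C" "tgt C g = src C f" "tgt C h = src C f"
    "cmp C f g = cmp C f h"
  shows "g = h"
  using assms by (metis inv_cancel(1))

lemma iso_ide [simp]: "x \<in> Ob C \<Longrightarrow> iso_arrow C (ide C x)"
  by (rule iso_arrowI [where g = "ide C x"]) auto

lemma iso_inv [simp]: "iso_arrow C f \<Longrightarrow> iso_arrow C (arr_inv C f)"
  by (rule iso_arrowI [where g = f]) (auto dest: iso_arrow_Ar)

lemma iso_cmp [simp]:
  assumes "iso_arrow C f" "iso_arrow C g" "src C g = tgt C f"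
  shows "iso_arrow C (cmp C g f)"
  using assms iso_arrow_Ar [OF assms(1)] iso_arrow_Ar [OF assms(2)]
  by (intro iso_arrowI [where g = "cmp C (arr_inv C f) (arr_inv C g)"]) simp_all

lemma arr_inv_unique:
  assumes "iso_arrow C f" "g \<in> Ar C" "src C g = tgt C f" "tgt C g = src C f"
    "cmp C f g = ide C (tgt C f)"
  shows "arr_inv C f = g"
  using assms iso_arrow_Ar [OF assms(1)] inv_cancel(1) [OF assms(1,2)] by simp

end

context is_functor
begin

lemma FO_Ob [simp]: "x \<in> Ob C \<Longrightarrow> FO F x \<in> Ob D"
  and FA_Ar [simp]: "f \<in> Ar C \<Longrightarrow> FA F f \<in> Ar D"
  using FO_in FA_in by auto

declare FA_src [simp] FA_tgt [simp] FA_ide [simp]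

lemma FA_comp [simp]: "\<lbrakk>f \<in> Ar C; g \<in> Ar C; src C g = tgt C f\<rbrakk>
    \<Longrightarrow> FA F (cmp C g f) = cmp D (FA F g) (FA F f)"
  using FA_cmp by (simp add: in_arrows)

lemma FO_ext: "FO F \<in> extensional (Ob C)"
  and FA_ext: "FA F \<in> extensional (Ar C)"
  using FO_in FA_in by (auto simp: PiE_def)

lemma FA_iso [simp]: "iso_arrow C f \<Longrightarrow> iso_arrow D (FA F f)"
  using iso_arrow_Ar [of C f]
  by (intro iso_arrowI [where g = "FA F (arr_inv C f)"]) (simp_all flip: FA_comp)

end

lemma is_functorI:
  assumes "category C" "category D"
    and "FO F \<in> extensional (Ob C)" "FA F \<in> extensional (Ar C)"
    and "\<And>x. x \<in> Ob C \<Longrightarrow> FO F x \<in> Ob D"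
    and "\<And>f. f \<in> Ar C \<Longrightarrow> FA F f \<in> Ar D \<and> src D (FA F f) = FO F (src C f) \<and> tgt D (FA F f) = FO F (tgt C f)"
    and "\<And>x. x \<in> Ob C \<Longrightarrow> FA F (ide C x) = ide D (FO F x)"
    and "\<And>f g. \<lbrakk>f \<in> Ar C; g \<in> Ar C; src C g = tgt C f\<rbrakk> \<Longrightarrow> FA F (cmp C g f) = cmp D (FA F g) (FA F f)"
  shows "is_functor C D F"
  using assms by (intro is_functor.intro is_functor_axioms.intro) (auto simp: in_arrows PiE_def)

lemma fctr_eqI:
  assumes "is_functor C D F" "is_functor C D G"
    and "\<And>x. x \<in> Ob C \<Longrightarrow> FO F x = FO G x" "\<And>f. f \<in> Ar C \<Longrightarrow> FA F f = FA G f"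
  shows "F = G"
proof -
  interpret F: is_functor C D F by fact
  interpret G: is_functor C D G by fact
  have "FO F = FO G" "FA F = FA G"
    using assms(3,4) F.FO_ext G.FO_ext F.FA_ext G.FA_ext by (auto intro: extensionalityI)
  then show ?thesis by simp
qed

lemma fun_comp_FO [simp]: "x \<in> Ob C \<Longrightarrow> FO (fun_comp C G F) x = FO G (FO F x)"
  and fun_comp_FA [simp]: "f \<in> Ar C \<Longrightarrow> FA (fun_comp C G F) f = FA G (FA F f)"
  by (simp_all add: fun_comp_def)

lemma fun_id_FO [simp]: "x \<in> Ob C \<Longrightarrow> FO (fun_id C) x = x"
  and fun_id_FA [simp]: "f \<in> Ar C \<Longrightarrow> FA (fun_id C) f = f"
  by (simp_all add: fun_id_def)

lemma is_functor_comp [intro]: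
  assumes "is_functor C D F" "is_functor D E G"
  shows "is_functor C E (fun_comp C G F)"
proof -
  interpret F: is_functor C D F by fact
  interpret G: is_functor D E G by fact
  show ?thesis
    by (rule is_functorI) (use F.C.category_axioms G.D.category_axioms in \<open>auto simp: fun_comp_def\<close>)
qed

lemma is_functor_id [intro]: "category C \<Longrightarrow> is_functor C C (fun_id C)"
proof -
  assume "category C"
  then interpret category C .
  show ?thesis by (rule is_functorI) (use category_axioms in \<open>auto simp: fun_id_def\<close>)
qed

text \<open>The inner restriction to \<open>D\<close> made by \<open>fun_comp D H G\<close>
  disappears because \<open>F\<close> lands in \<open>D\<close>; both sides are then the same
  function restricted to \<open>C\<close>.\<close>

lemma fun_comp_assoc:
  assumes "is_functor C D F"
  shows "fun_comp C H (fun_comp C G F) = fun_comp C (fun_comp D H G) F"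
proof -
  interpret F: is_functor C D F by fact
  show ?thesis by (simp add: fun_comp_def cong: restrict_cong)
qed

lemma fun_comp_id [simp]:
  assumes "is_functor C D F"
  shows "fun_comp C F (fun_id C) = F" "fun_comp C (fun_id D) F = F"
proof -
  interpret F: is_functor C D F by fact
  show "fun_comp C F (fun_id C) = F"
    by (rule fctr_eqI [of C D]) (use F.is_functor_axioms F.C.category_axioms in auto)
  show "fun_comp C (fun_id D) F = F"
    by (rule fctr_eqI [of C D]) (use F.is_functor_axioms F.D.category_axioms in auto)
qed

abbreviation dat :: "'x \<times> 'm \<times> 'y \<Rightarrow> 'm" where
  "dat m \<equiv> fst (snd m)"

abbreviation cod :: "'x \<times> 'm \<times> 'y \<Rightarrow> 'y" where
  "cod m \<equiv> snd (snd m)"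

text \<open>Stated with projections instead of patterns, so that simplification does not wait for a
  tagged arrow to be split into a triple.\<close>

lemma tagged_cat_simps [simp]:
  "Ob (tagged_cat X M i c) = X"
  "m \<in> Ar (tagged_cat X M i c) \<longleftrightarrow> fst m \<in> X \<and> cod m \<in> X \<and> dat m \<in> M (fst m) (cod m)"
  "src (tagged_cat X M i c) m = fst m"
  "tgt (tagged_cat X M i c) m = cod m"
  "ide (tagged_cat X M i c) x = (x, i x, x)"
  "cmp (tagged_cat X M i c) n m = (fst m, c (dat n) (dat m), cod n)"
  by (auto simp: tagged_cat_def split: prod.splits)

section \<open>Functor categories\<close>

lemma functor_cat_simps [simp]:
  "Ob (functor_cat C D) = {F. is_functor C D F}"
  "src (functor_cat C D) m = fst m"
  "tgt (functor_cat C D) m = cod m"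
  "ide (functor_cat C D) F = (F, \<lambda>x\<in>Ob C. ide D (FO F x), F)"
  "cmp (functor_cat C D) n m = (fst m, \<lambda>x\<in>Ob C. cmp D (dat n x) (dat m x), cod n)"
  by (auto simp: functor_cat_def)

lemma functor_cat_Ar: "m \<in> Ar (functor_cat C D) \<longleftrightarrow>
    is_functor C D (fst m) \<and> is_functor C D (cod m) \<and> dat m \<in> nat_transfs C D (fst m) (cod m)"
  by (auto simp: functor_cat_def)

lemma nat_transfsI:
  assumes "\<eta> \<in> extensional (Ob C)"
    and "\<And>x. x \<in> Ob C \<Longrightarrow> \<eta> x \<in> Ar D \<and> src D (\<eta> x) = FO F x \<and> tgt D (\<eta> x) = FO G x"
    and "\<And>f. f \<in> Ar C \<Longrightarrow> cmp D (\<eta> (tgt C f)) (FA F f) = cmp D (FA G f) (\<eta> (src C f))"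
  shows "\<eta> \<in> nat_transfs C D F G"
  using assms by (simp add: nat_transfs_def in_arrows)

lemma functor_cat_ArI:
  assumes "is_functor C D F" "is_functor C D G" "\<eta> \<in> extensional (Ob C)"
    and "\<And>x. x \<in> Ob C \<Longrightarrow> \<eta> x \<in> Ar D \<and> src D (\<eta> x) = FO F x \<and> tgt D (\<eta> x) = FO G x"
    and "\<And>f. f \<in> Ar C \<Longrightarrow> cmp D (\<eta> (tgt C f)) (FA F f) = cmp D (FA G f) (\<eta> (src C f))"
  shows "(F, \<eta>, G) \<in> Ar (functor_cat C D)"
  using assms by (auto simp: functor_cat_Ar intro: nat_transfsI)

lemma nt_eqI:
  assumes "m \<in> Ar (functor_cat C D)" "n \<in> Ar (functor_cat C D)"
    and "fst m = fst n" "cod m = cod n" "\<And>x. x \<in> Ob C \<Longrightarrow> dat m x = dat n x"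
  shows "m = n"
  using assms by (auto simp: prod_eq_iff functor_cat_Ar nat_transfs_def intro: extensionalityI)

locale nat_arrow =
  fixes C :: "('o, 'a) cat" and D :: "('p, 'b) cat" and m :: "('o, 'a, 'p, 'b) nt"
  assumes Ar: "m \<in> Ar (functor_cat C D)"
begin

sublocale dom: is_functor C D "fst m"
  using Ar by (auto simp: functor_cat_Ar)

sublocale cod: is_functor C D "cod m"
  using Ar by (auto simp: functor_cat_Ar)

lemma ext: "dat m \<in> extensional (Ob C)"
  and in_Ar [simp]: "x \<in> Ob C \<Longrightarrow> dat m x \<in> Ar D"
  and src [simp]: "x \<in> Ob C \<Longrightarrow> src D (dat m x) = FO (fst m) x"
  and tgt [simp]: "x \<in> Ob C \<Longrightarrow> tgt D (dat m x) = FO (cod m) x"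
  and nat: "f \<in> Ar C \<Longrightarrow> cmp D (dat m (tgt C f)) (FA (fst m) f) = cmp D (FA (cod m) f) (dat m (src C f))"
  using Ar by (auto simp: functor_cat_Ar nat_transfs_def in_arrows)

text \<open>Bracketing to the right hides the left-hand side of \<open>nat\<close> inside longer
  composites; this form, with a tail \<open>h\<close>, still matches.\<close>

lemma nat': "\<lbrakk>f \<in> Ar C; h \<in> Ar D; tgt D h = FO (fst m) (src C f)\<rbrakk> \<Longrightarrow>
    cmp D (dat m (tgt C f)) (cmp D (FA (fst m) f) h) = cmp D (FA (cod m) f) (cmp D (dat m (src C f)) h)"
  by (simp add: nat flip: dom.D.assoc)

end

lemma category_functor_cat:
  assumes "category C" "category D"
  shows "category (functor_cat C D)"
proof -
  let ?C = "functor_cat C D"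
  interpret C: category C by fact
  interpret D: category D by fact
  have comp: "cmp ?C n m \<in> Ar ?C"
    if mn: "m \<in> Ar ?C" "n \<in> Ar ?C" "fst n = cod m" for m n
  proof -
    interpret m: nat_arrow C D m by unfold_locales fact
    interpret n: nat_arrow C D n by unfold_locales fact
    show ?thesis unfolding functor_cat_simps
    proof (rule functor_cat_ArI, goal_cases)
      case (5 f)
      then show ?case using n.nat' [of f "dat m (src C f)"] mn(3) by (simp add: m.nat)
    qed (use mn m.dom.is_functor_axioms n.cod.is_functor_axioms in auto)
  qed
  have ident: "ide ?C F \<in> Ar ?C" if "is_functor C D F" for F
  proof -
    interpret F: is_functor C D F by fact
    show ?thesis unfolding functor_cat_simps by (rule functor_cat_ArI) (use that in auto)
  qed
  show ?thesis
  proof (unfold_locales, goal_cases)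
    case (4 f x y g z)
    then show ?case using comp [of f g] by (simp add: in_arrows)
  next
    case (7 f w x g y h z)
    interpret f: nat_arrow C D f using 7 by unfold_locales (auto simp: in_arrows)
    interpret g: nat_arrow C D g using 7 by unfold_locales (auto simp: in_arrows)
    interpret h: nat_arrow C D h using 7 by unfold_locales (auto simp: in_arrows)
    show ?case using 7 by (auto simp: in_arrows intro!: restrict_ext)
  next
    case (5 f x y)
    then interpret f: nat_arrow C D f by unfold_locales (auto simp: in_arrows)
    show ?case
      by (rule nt_eqI) (use 5 comp [of "ide ?C x" f] ident [of x] f.Ar f.dom.is_functor_axioms in
        \<open>auto simp: in_arrows\<close>)
  next
    case (6 f x y)
    then interpret f: nat_arrow C D f by unfold_locales (auto simp: in_arrows)
    show ?case
      by (rule nt_eqI) (use 6 comp [of f "ide ?C y"] ident [of y] f.Ar f.cod.is_functor_axioms in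
        \<open>auto simp: in_arrows\<close>)
  qed (use ident in \<open>auto simp: in_arrows functor_cat_Ar\<close>)
qed

text \<open>Pointwise inverses form a natural family: after composition on the left with the
  invertible component at the target, the square to be proved becomes the square of
  \<open>m\<close>.\<close>

lemma iso_functor_cat:
  assumes "m \<in> Ar (functor_cat C D)"
  shows "iso_arrow (functor_cat C D) m \<longleftrightarrow> (\<forall>x\<in>Ob C. iso_arrow D (dat m x))"
proof
  interpret m: nat_arrow C D m by unfold_locales fact
  assume iso: "iso_arrow (functor_cat C D) m"
  let ?n = "arr_inv (functor_cat C D) m"
  interpret n: nat_arrow C D ?n using arr_inv(1) [OF iso] by unfold_locales
  have n: "fst ?n = cod m" "cod ?n = fst m"
    using arr_inv(2-3) [OF iso] by auto
  have eqs: "(\<lambda>x\<in>Ob C. cmp D (dat ?n x) (dat m x)) = (\<lambda>x\<in>Ob C. ide D (FO (fst m) x))"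
    "(\<lambda>x\<in>Ob C. cmp D (dat m x) (dat ?n x)) = (\<lambda>x\<in>Ob C. ide D (FO (cod m) x))"
    using arr_inv(4-5) [OF iso] by auto
  show "\<forall>x\<in>Ob C. iso_arrow D (dat m x)"
  proof
    fix x assume x: "x \<in> Ob C"
    then show "iso_arrow D (dat m x)"
      using fun_cong [OF eqs(1), of x] fun_cong [OF eqs(2), of x] n
      by (intro iso_arrowI [where g = "dat ?n x"]) simp_all
  qed
next
  interpret m: nat_arrow C D m by unfold_locales fact
  assume iso: "\<forall>x\<in>Ob C. iso_arrow D (dat m x)"
  define n where "n = (cod m, \<lambda>x\<in>Ob C. arr_inv D (dat m x), fst m)"
  have n: "n \<in> Ar (functor_cat C D)" unfolding n_def
  proof (rule functor_cat_ArI, goal_cases)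
    case f: (5 f)
    let ?x = "src C f" and ?y = "tgt C f"
    have "cmp D (dat m ?y) (cmp D (arr_inv D (dat m ?y)) (FA (cod m) f))
      = cmp D (dat m ?y) (cmp D (FA (fst m) f) (arr_inv D (dat m ?x)))"
      using f iso by (simp add: m.nat')
    then have "cmp D (arr_inv D (dat m ?y)) (FA (cod m) f) = cmp D (FA (fst m) f) (arr_inv D (dat m ?x))"
      by (rule m.dom.D.iso_cancel_left [rotated -1]) (use f iso in auto)
    then show ?case using f by simp
  qed (use iso m.dom.is_functor_axioms m.cod.is_functor_axioms in auto)
  show "iso_arrow (functor_cat C D) m"
    by (rule iso_arrowI [where g = n]) (use iso n m.Ar in \<open>auto simp: n_def intro!: restrict_ext\<close>)
qed


section \<open>2-categories and 2-functors\<close>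

declare whisk_l_def [simp] whisk_r_def [simp]

text \<open>Whiskerings are kept as instances of \<open>cmp2\<close>, so that the laws of horizontal
  composition apply to them without unfolding.\<close>

abbreviation lwhisk where
  "lwhisk A a b c g \<alpha> \<equiv> cmp2 A a b c (ide (Hom A b c) g) \<alpha>"

abbreviation rwhisk where
  "rwhisk A a b c \<beta> f \<equiv> cmp2 A a b c \<beta> (ide (Hom A a b) f)"

context two_category
begin

declare Hom_category [simp] one_in [simp] cmp1_in [simp] cmp1_one [simp] one_cmp1 [simp]
  cmp2_ide [simp] cmp2_one [simp] one_cmp2 [simp]

lemmas hom_simps [simp] =
  category.src_in [OF Hom_category] category.tgt_in [OF Hom_category]
  category.ide_Ar [OF Hom_category] category.src_ide [OF Hom_category] category.tgt_ide [OF Hom_category]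
  category.cmp_Ar [OF Hom_category] category.src_cmp [OF Hom_category] category.tgt_cmp [OF Hom_category]
  category.cmp_ide_right [OF Hom_category] category.cmp_ide_left [OF Hom_category]
  category.assoc [OF Hom_category] category.inv_cancel [OF Hom_category]
  category.iso_ide [OF Hom_category] category.iso_inv [OF Hom_category] category.iso_cmp [OF Hom_category]

lemma cmp1_assoc' [simp]: "\<lbrakk>a \<in> Obj A; b \<in> Obj A; c \<in> Obj A; d \<in> Obj A;
    f \<in> Ob (Hom A a b); g \<in> Ob (Hom A b c); h \<in> Ob (Hom A c d)\<rbrakk>
    \<Longrightarrow> cmp1 A a b d (cmp1 A b c d h g) f = cmp1 A a c d h (cmp1 A a b c g f)"
  and cmp2_assoc' [simp]: "\<lbrakk>a \<in> Obj A; b \<in> Obj A; c \<in> Obj A; d \<in> Obj A;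
    \<alpha> \<in> Ar (Hom A a b); \<beta> \<in> Ar (Hom A b c); \<gamma> \<in> Ar (Hom A c d)\<rbrakk>
    \<Longrightarrow> cmp2 A a b d (cmp2 A b c d \<gamma> \<beta>) \<alpha> = cmp2 A a c d \<gamma> (cmp2 A a b c \<beta> \<alpha>)"
  using cmp1_assoc cmp2_assoc by auto

lemma
  assumes "a \<in> Obj A" "b \<in> Obj A" "c \<in> Obj A" "\<alpha> \<in> Ar (Hom A a b)" "\<beta> \<in> Ar (Hom A b c)"
  shows cmp2_Ar [simp]: "cmp2 A a b c \<beta> \<alpha> \<in> Ar (Hom A a c)"
    and src_cmp2 [simp]: "src (Hom A a c) (cmp2 A a b c \<beta> \<alpha>)
      = cmp1 A a b c (src (Hom A b c) \<beta>) (src (Hom A a b) \<alpha>)"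
    and tgt_cmp2 [simp]: "tgt (Hom A a c) (cmp2 A a b c \<beta> \<alpha>)
      = cmp1 A a b c (tgt (Hom A b c) \<beta>) (tgt (Hom A a b) \<alpha>)"
  using cmp2_in [of a b c \<alpha> _ _ \<beta>] assms by (auto simp: in_arrows)

lemma cmp2_cmp:
  assumes "a \<in> Obj A" "b \<in> Obj A" "c \<in> Obj A" "\<alpha> \<in> Ar (Hom A a b)" "\<alpha>' \<in> Ar (Hom A a b)"
    "\<beta> \<in> Ar (Hom A b c)" "\<beta>' \<in> Ar (Hom A b c)"
    "src (Hom A a b) \<alpha>' = tgt (Hom A a b) \<alpha>" "src (Hom A b c) \<beta>' = tgt (Hom A b c) \<beta>"
  shows "cmp2 A a b c (cmp (Hom A b c) \<beta>' \<beta>) (cmp (Hom A a b) \<alpha>' \<alpha>)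
    = cmp (Hom A a c) (cmp2 A a b c \<beta>' \<alpha>') (cmp2 A a b c \<beta> \<alpha>)"
  using assms by (intro interchange) (auto simp: in_arrows)

lemma ide_cmp2_cmp [simp]:
  assumes "a \<in> Obj A" "b \<in> Obj A" "c \<in> Obj A" "\<alpha> \<in> Ar (Hom A a b)" "\<alpha>' \<in> Ar (Hom A a b)"
    "g \<in> Ob (Hom A b c)" "src (Hom A a b) \<alpha>' = tgt (Hom A a b) \<alpha>"
  shows "lwhisk A a b c g (cmp (Hom A a b) \<alpha>' \<alpha>)
    = cmp (Hom A a c) (lwhisk A a b c g \<alpha>') (lwhisk A a b c g \<alpha>)"
  using assms cmp2_cmp [of a b c \<alpha> \<alpha>' "ide (Hom A b c) g" "ide (Hom A b c) g"] by simp

lemma cmp_cmp2_ide [simp]: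
  assumes "a \<in> Obj A" "b \<in> Obj A" "c \<in> Obj A" "f \<in> Ob (Hom A a b)"
    "\<beta> \<in> Ar (Hom A b c)" "\<beta>' \<in> Ar (Hom A b c)" "src (Hom A b c) \<beta>' = tgt (Hom A b c) \<beta>"
  shows "rwhisk A a b c (cmp (Hom A b c) \<beta>' \<beta>) f
    = cmp (Hom A a c) (rwhisk A a b c \<beta>' f) (rwhisk A a b c \<beta> f)"
  using assms cmp2_cmp [of a b c "ide (Hom A a b) f" "ide (Hom A a b) f" \<beta> \<beta>'] by simp

text \<open>This runs against the orientation of \<open>cmp2_assoc'\<close>: successive left
  whiskerings are merged into one by a composite 1-cell, which gives every iterated left whiskering
  a normal form.\<close>

lemma ide_ide_cmp2 [simp]:
  assumes "a \<in> Obj A" "b \<in> Obj A" "c \<in> Obj A" "d \<in> Obj A" "\<alpha> \<in> Ar (Hom A a b)"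
    "g \<in> Ob (Hom A b c)" "h \<in> Ob (Hom A c d)"
  shows "lwhisk A a c d h (lwhisk A a b c g \<alpha>)
    = lwhisk A a b d (cmp1 A b c d h g) \<alpha>"
  using assms by (simp del: cmp2_assoc' add: cmp2_assoc)

lemma
  assumes "a \<in> Obj A" "b \<in> Obj A" "c \<in> Obj A" "\<alpha> \<in> Ar (Hom A a b)" "\<beta> \<in> Ar (Hom A b c)"
  shows cmp2_via_tgt: "cmp (Hom A a c) (rwhisk A a b c \<beta> (tgt (Hom A a b) \<alpha>))
      (lwhisk A a b c (src (Hom A b c) \<beta>) \<alpha>) = cmp2 A a b c \<beta> \<alpha>"
    and cmp2_via_src: "cmp (Hom A a c) (lwhisk A a b c (tgt (Hom A b c) \<beta>) \<alpha>)
      (rwhisk A a b c \<beta> (src (Hom A a b) \<alpha>)) = cmp2 A a b c \<beta> \<alpha>"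
  using assms by (simp_all flip: cmp2_cmp)

text \<open>Both sides are the horizontal composite of \<beta> and \<alpha>, decomposed through its
  two corners. The primed version below has a tail \<chi>, for use inside composites bracketed to
  the right.\<close>

lemma exchange:
  assumes "a \<in> Obj A" "b \<in> Obj A" "c \<in> Obj A" "\<alpha> \<in> Ar (Hom A a b)" "\<beta> \<in> Ar (Hom A b c)"
    and "src (Hom A a b) \<alpha> = f" "tgt (Hom A a b) \<alpha> = f'" "src (Hom A b c) \<beta> = g" "tgt (Hom A b c) \<beta> = g'"
  shows "cmp (Hom A a c) (rwhisk A a b c \<beta> f') (lwhisk A a b c g \<alpha>)
    = cmp (Hom A a c) (lwhisk A a b c g' \<alpha>) (rwhisk A a b c \<beta> f)"
  using assms cmp2_via_tgt [of a b c \<alpha> \<beta>] cmp2_via_src [of a b c \<alpha> \<beta>] by simp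

lemma exchange':
  assumes "a \<in> Obj A" "b \<in> Obj A" "c \<in> Obj A" "\<alpha> \<in> Ar (Hom A a b)" "\<beta> \<in> Ar (Hom A b c)"
    and "src (Hom A a b) \<alpha> = f" "tgt (Hom A a b) \<alpha> = f'" "src (Hom A b c) \<beta> = g" "tgt (Hom A b c) \<beta> = g'"
    and "\<chi> \<in> Ar (Hom A a c)" "tgt (Hom A a c) \<chi> = cmp1 A a b c g f"
  shows "cmp (Hom A a c) (rwhisk A a b c \<beta> f')
      (cmp (Hom A a c) (lwhisk A a b c g \<alpha>) \<chi>)
    = cmp (Hom A a c) (lwhisk A a b c g' \<alpha>)
      (cmp (Hom A a c) (rwhisk A a b c \<beta> f) \<chi>)"
proof -
  interpret ac: category "Hom A a c" using assms by simp
  have "f \<in> Ob (Hom A a b)" "f' \<in> Ob (Hom A a b)" "g \<in> Ob (Hom A b c)" "g' \<in> Ob (Hom A b c)"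
    by (simp_all add: assms(1-5) flip: assms(6-9))
  then have "cmp (Hom A a c) (cmp (Hom A a c) (rwhisk A a b c \<beta> f') (lwhisk A a b c g \<alpha>)) \<chi>
    = cmp (Hom A a c) (cmp (Hom A a c) (lwhisk A a b c g' \<alpha>) (rwhisk A a b c \<beta> f)) \<chi>"
    "f \<in> Ob (Hom A a b)" "f' \<in> Ob (Hom A a b)" "g \<in> Ob (Hom A b c)" "g' \<in> Ob (Hom A b c)"
    using exchange [OF assms(1-9)] by simp_all
  then show ?thesis
    using assms by simp
qed

lemma iso_cmp2 [simp]:
  assumes "a \<in> Obj A" "b \<in> Obj A" "c \<in> Obj A"
    and iso: "iso_arrow (Hom A a b) \<alpha>" "iso_arrow (Hom A b c) \<beta>"
  shows "iso_arrow (Hom A a c) (cmp2 A a b c \<beta> \<alpha>)"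
  using assms iso_arrow_Ar [OF iso(1)] iso_arrow_Ar [OF iso(2)]
  by (intro iso_arrowI [where g = "cmp2 A a b c (arr_inv (Hom A b c) \<beta>) (arr_inv (Hom A a b) \<alpha>)"])
    (simp_all flip: cmp2_cmp)

lemma two_category_op2: "two_category (op2 A)"
  by (rule two_category.intro) (auto simp: op2_def in_arrows intro!: cmp2_cmp)

end

lemma op2_simps [simp]:
  "Obj (op2 A) = Obj A" "Hom (op2 A) a b = Hom A b a" "one (op2 A) = one A"
  "cmp1 (op2 A) a b c g f = cmp1 A c b a f g" "cmp2 (op2 A) a b c \<beta> \<alpha> = cmp2 A c b a \<alpha> \<beta>"
  by (simp_all add: op2_def)

lemma two_functorI:
  assumes "two_category A" "two_category B"
    and "\<And>a. a \<in> Obj A \<Longrightarrow> F0 F a \<in> Obj B"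
    and "\<And>a b. a \<in> Obj A \<Longrightarrow> b \<in> Obj A \<Longrightarrow> is_functor (Hom A a b) (Hom B (F0 F a) (F0 F b)) (FH F a b)"
    and "\<And>a. a \<in> Obj A \<Longrightarrow> F1 F a a (one A a) = one B (F0 F a)"
    and "\<And>a b c f g. \<lbrakk>a \<in> Obj A; b \<in> Obj A; c \<in> Obj A; f \<in> Ob (Hom A a b); g \<in> Ob (Hom A b c)\<rbrakk>
      \<Longrightarrow> F1 F a c (cmp1 A a b c g f) = cmp1 B (F0 F a) (F0 F b) (F0 F c) (F1 F b c g) (F1 F a b f)"
    and "\<And>a b c \<alpha> \<beta>. \<lbrakk>a \<in> Obj A; b \<in> Obj A; c \<in> Obj A; \<alpha> \<in> Ar (Hom A a b); \<beta> \<in> Ar (Hom A b c)\<rbrakk>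
      \<Longrightarrow> F2 F a c (cmp2 A a b c \<beta> \<alpha>) = cmp2 B (F0 F a) (F0 F b) (F0 F c) (F2 F b c \<beta>) (F2 F a b \<alpha>)"
  shows "two_functor A B F"
  using assms by (simp add: two_functor_def two_functor_axioms_def)

context two_functor
begin

declare F0_in [simp] F1_one [simp] F1_cmp1 [simp] F2_cmp2 [simp]

lemma FH_simps [simp]:
  assumes "a \<in> Obj A" "b \<in> Obj A"
  shows F1_in: "f \<in> Ob (Hom A a b) \<Longrightarrow> F1 F a b f \<in> Ob (Hom B (F0 F a) (F0 F b))"
    and F2_in: "\<alpha> \<in> Ar (Hom A a b) \<Longrightarrow> F2 F a b \<alpha> \<in> Ar (Hom B (F0 F a) (F0 F b))"
    and src_F2: "\<alpha> \<in> Ar (Hom A a b) \<Longrightarrow> src (Hom B (F0 F a) (F0 F b)) (F2 F a b \<alpha>) = F1 F a b (src (Hom A a b) \<alpha>)"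
    and tgt_F2: "\<alpha> \<in> Ar (Hom A a b) \<Longrightarrow> tgt (Hom B (F0 F a) (F0 F b)) (F2 F a b \<alpha>) = F1 F a b (tgt (Hom A a b) \<alpha>)"
    and F2_ide: "f \<in> Ob (Hom A a b) \<Longrightarrow> F2 F a b (ide (Hom A a b) f) = ide (Hom B (F0 F a) (F0 F b)) (F1 F a b f)"
    and F2_cmp: "\<lbrakk>\<alpha> \<in> Ar (Hom A a b); \<beta> \<in> Ar (Hom A a b); src (Hom A a b) \<beta> = tgt (Hom A a b) \<alpha>\<rbrakk> \<Longrightarrow>
        F2 F a b (cmp (Hom A a b) \<beta> \<alpha>) = cmp (Hom B (F0 F a) (F0 F b)) (F2 F a b \<beta>) (F2 F a b \<alpha>)"
  using FH_functor [OF assms]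
  by (simp_all add: F1_def F2_def is_functor.FO_Ob is_functor.FA_Ar is_functor.FA_src is_functor.FA_tgt
      is_functor.FA_ide is_functor.FA_comp)

lemma two_functor_op: "two_functor (op2 A) (op2 B) (twofun_op F)"
proof (rule two_functorI, goal_cases)
  case (4 a b)
  then show ?case using FH_functor [of b a] by (simp add: twofun_op_def)
next
  case (6 a b c f g)
  then show ?case using F1_cmp1 [of c b a g f] by (simp add: twofun_op_def F1_def)
next
  case (7 a b c \<alpha> \<beta>)
  then show ?case using F2_cmp2 [of c b a \<beta> \<alpha>] by (simp add: twofun_op_def F2_def)
qed (use F1_one in \<open>auto simp: twofun_op_def F1_def intro: A.two_category_op2 B.two_category_op2\<close>)

end

lemma twofun_op_simps [simp]:
  "F0 (twofun_op F) a = F0 F a" "F1 (twofun_op F) a b f = F1 F b a f" "F2 (twofun_op F) a b \<alpha> = F2 F b a \<alpha>"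
  by (simp_all add: twofun_op_def F1_def F2_def)

lemma twofun_comp_simps [simp]:
  "F0 (twofun_comp A G F) a = F0 G (F0 F a)"
  "f \<in> Ob (Hom A a b) \<Longrightarrow> F1 (twofun_comp A G F) a b f = F1 G (F0 F a) (F0 F b) (F1 F a b f)"
  "\<alpha> \<in> Ar (Hom A a b) \<Longrightarrow> F2 (twofun_comp A G F) a b \<alpha> = F2 G (F0 F a) (F0 F b) (F2 F a b \<alpha>)"
  by (simp_all add: twofun_comp_def F1_def F2_def)

lemma two_functor_comp:
  assumes "two_functor A B F" "two_functor B C G"
  shows "two_functor A C (twofun_comp A G F)"
proof -
  interpret F: two_functor A B F by fact
  interpret G: two_functor B C G by fact
  show ?thesis
  proof (rule two_functorI, goal_cases)
    case (4 a b)
    then show ?case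
      using F.FH_functor G.FH_functor [of "F0 F a" "F0 F b"] by (auto simp: twofun_comp_def)
  qed (auto intro: F.A.two_category_axioms G.B.two_category_axioms)
qed

lemma const2_simps [simp]:
  "F0 (const2 A B E) a = E"
  "f \<in> Ob (Hom A a b) \<Longrightarrow> F1 (const2 A B E) a b f = one B E"
  "\<alpha> \<in> Ar (Hom A a b) \<Longrightarrow> F2 (const2 A B E) a b \<alpha> = ide (Hom B E E) (one B E)"
  by (simp_all add: const2_def F1_def F2_def)

lemma two_functor_const2:
  assumes "two_category A" "two_category B" "E \<in> Obj B"
  shows "two_functor A B (const2 A B E)"
proof -
  interpret A: two_category A by fact
  interpret B: two_category B by fact
  show ?thesis
  proof (rule two_functorI, goal_cases)
    case (4 a b)
    then show ?case using assms by (intro is_functorI) (auto simp: const2_def)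
  qed (use assms in auto)
qed


section \<open>The 2-category of categories\<close>

lemma CAT_simps:
  "Hom (CAT r) = functor_cat" "one (CAT r) = fun_id" "cmp1 (CAT r) C D E G F = fun_comp C G F"
  "cmp2 (CAT r) C D E n m = (fun_comp C (fst n) (fst m),
     \<lambda>x\<in>Ob C. cmp E (dat n (FO (cod m) x)) (FA (fst n) (dat m x)), fun_comp C (cod n) (cod m))"
  by (auto simp: CAT_def split: prod.splits)

lemma CAT_category: "C \<in> Obj (CAT r) \<Longrightarrow> category C"
  by (simp add: CAT_def)

lemma two_category_CAT:
  fixes r :: "'u rel"
  shows "two_category (CAT r)"
proof -
  have in_Ar: "cmp2 (CAT r) C D E n m \<in> Ar (functor_cat C E)"
    if "m \<in> Ar (functor_cat C D)" "n \<in> Ar (functor_cat D E)" for C D E and n m :: "('u, 'u, 'u, 'u) nt"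
  proof -
    interpret m: nat_arrow C D m by unfold_locales fact
    interpret n: nat_arrow D E n by unfold_locales fact
    show ?thesis unfolding CAT_simps
    proof (rule functor_cat_ArI, goal_cases)
      case (5 f)
      let ?x = "src C f" and ?y = "tgt C f"
      \<comment> \<open>Naturality of the horizontal composite splits into the square of
        \<open>m\<close>, carried over by the functor \<open>fst n\<close>, and the square of
        \<open>n\<close> at \<open>FA (cod m) f\<close>.\<close>
      have "cmp E (FA (fst n) (dat m ?y)) (FA (fst n) (FA (fst m) f))
        = cmp E (FA (fst n) (FA (cod m) f)) (FA (fst n) (dat m ?x))"
        using 5 by (simp add: m.nat flip: n.dom.FA_comp)
      then show ?case
        using 5 n.nat' [of "FA (cod m) f" "FA (fst n) (dat m ?x)"] by simp
    qed (auto intro!: is_functor_comp m.dom.is_functor_axioms n.dom.is_functor_axioms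
        m.cod.is_functor_axioms n.cod.is_functor_axioms)
  qed
  show ?thesis
  proof (rule two_category.intro, goal_cases)
    case (1 a b)
    then show ?case by (auto simp: CAT_simps intro!: category_functor_cat CAT_category)
  next
    case (2 a)
    then show ?case by (auto simp: CAT_simps CAT_category)
  next
    case (3 a b c f g)
    then show ?case by (auto simp: CAT_simps)
  next
    case (4 a b c \<alpha> f f' \<beta> g g')
    then show ?case using in_Ar [of \<alpha> a b \<beta> c] by (simp add: in_arrows CAT_simps)
  next
    case (5 a b c f g)
    then interpret f: is_functor a b f by (simp add: CAT_simps)
    from 5 interpret g: is_functor b c g by (simp add: CAT_simps)
    show ?case by (auto simp: CAT_simps intro!: restrict_ext)
  next
    case (6 a b c \<alpha> f f' \<alpha>' f'' \<beta> g g' \<beta>' g'')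
    interpret \<alpha>: nat_arrow a b \<alpha> using 6 by unfold_locales (auto simp: in_arrows CAT_simps)
    interpret \<beta>: nat_arrow b c \<beta> using 6 by unfold_locales (auto simp: in_arrows CAT_simps)
    interpret \<alpha>': nat_arrow a b \<alpha>' using 6 by unfold_locales (auto simp: in_arrows CAT_simps)
    interpret \<beta>': nat_arrow b c \<beta>' using 6 by unfold_locales (auto simp: in_arrows CAT_simps)
    have [simp]: "f = fst \<alpha>" "f' = cod \<alpha>" "fst \<alpha>' = cod \<alpha>" "f'' = cod \<alpha>'"
      "g = fst \<beta>" "g' = cod \<beta>" "fst \<beta>' = cod \<beta>" "g'' = cod \<beta>'"
      using 6 by (auto simp: in_arrows CAT_simps)
    \<comment> \<open>Interchange in \<open>CAT\<close> amounts to naturality of \<beta> at the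
      components of \<open>\<alpha>'\<close>.\<close>
    have "cmp c (dat \<beta> (FO f'' x)) (cmp c (FA g (dat \<alpha>' x)) (FA g (dat \<alpha> x)))
      = cmp c (FA g' (dat \<alpha>' x)) (cmp c (dat \<beta> (FO f' x)) (FA g (dat \<alpha> x)))" if "x \<in> Ob a" for x
      using that \<beta>.nat' [of "dat \<alpha>' x" "FA g (dat \<alpha> x)"] by simp
    then show ?case by (auto simp: in_arrows CAT_simps intro!: restrict_ext)
  next
    case (7 a b f)
    then interpret f: is_functor a b f by (simp add: CAT_simps)
    show ?case using f.is_functor_axioms by (simp add: CAT_simps)
  next
    case (8 a b f)
    then interpret f: is_functor a b f by (simp add: CAT_simps)
    show ?case using f.is_functor_axioms by (simp add: CAT_simps)
  next
    case (9 a b \<alpha>)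
    then interpret \<alpha>: nat_arrow a b \<alpha> by unfold_locales (simp add: CAT_simps)
    show ?case using \<alpha>.dom.is_functor_axioms \<alpha>.cod.is_functor_axioms \<alpha>.ext
      by (auto simp: CAT_simps prod_eq_iff extensional_def)
  next
    case (10 a b \<alpha>)
    then interpret \<alpha>: nat_arrow a b \<alpha> by unfold_locales (simp add: CAT_simps)
    show ?case using \<alpha>.dom.is_functor_axioms \<alpha>.cod.is_functor_axioms \<alpha>.ext
      by (auto simp: CAT_simps prod_eq_iff extensional_def)
  next
    case (11 a b c d f g h)
    then interpret f: is_functor a b f by (simp add: CAT_simps)
    show ?case using f.is_functor_axioms by (simp add: CAT_simps fun_comp_assoc)
  next
    case (12 a b c d \<alpha> \<beta> \<gamma>)
    then interpret \<alpha>: nat_arrow a b \<alpha> by unfold_locales (simp add: CAT_simps)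
    from 12 interpret \<beta>: nat_arrow b c \<beta> by unfold_locales (simp add: CAT_simps)
    from 12 interpret \<gamma>: nat_arrow c d \<gamma> by unfold_locales (simp add: CAT_simps)
    show ?case
      using \<alpha>.dom.is_functor_axioms \<alpha>.cod.is_functor_axioms
      by (auto simp: CAT_simps fun_comp_assoc intro!: restrict_ext)
  qed
qed


section \<open>Transformations and modifications\<close>

lemma oplax_natI:
  assumes "two_functor A B F" "two_functor A B G"
    and "T0 \<theta> \<in> extensional (Obj A)" "T1 \<theta> \<in> extensional (cells1 A)"
    and "\<And>a. a \<in> Obj A \<Longrightarrow> T0 \<theta> a \<in> Ob (Hom B (F0 F a) (F0 G a))"
    and "\<And>a b f. \<lbrakk>a \<in> Obj A; b \<in> Obj A; f \<in> Ob (Hom A a b)\<rbrakk> \<Longrightarrow>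
      T1 \<theta> (a, b, f) \<in> Ar (Hom B (F0 F a) (F0 G b)) \<and>
      src (Hom B (F0 F a) (F0 G b)) (T1 \<theta> (a, b, f)) = cmp1 B (F0 F a) (F0 F b) (F0 G b) (T0 \<theta> b) (F1 F a b f) \<and>
      tgt (Hom B (F0 F a) (F0 G b)) (T1 \<theta> (a, b, f)) = cmp1 B (F0 F a) (F0 G a) (F0 G b) (F1 G a b f) (T0 \<theta> a)"
    and "\<And>a. a \<in> Obj A \<Longrightarrow> T1 \<theta> (a, a, one A a) = ide (Hom B (F0 F a) (F0 G a)) (T0 \<theta> a)"
    and "\<And>a b c f g. \<lbrakk>a \<in> Obj A; b \<in> Obj A; c \<in> Obj A; f \<in> Ob (Hom A a b); g \<in> Ob (Hom A b c)\<rbrakk>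
      \<Longrightarrow> T1 \<theta> (a, c, cmp1 A a b c g f) = cmp (Hom B (F0 F a) (F0 G c))
            (lwhisk B (F0 F a) (F0 G b) (F0 G c) (F1 G b c g) (T1 \<theta> (a, b, f)))
            (rwhisk B (F0 F a) (F0 F b) (F0 G c) (T1 \<theta> (b, c, g)) (F1 F a b f))"
    and "\<And>a b \<gamma>. \<lbrakk>a \<in> Obj A; b \<in> Obj A; \<gamma> \<in> Ar (Hom A a b)\<rbrakk>
      \<Longrightarrow> cmp (Hom B (F0 F a) (F0 G b)) (T1 \<theta> (a, b, tgt (Hom A a b) \<gamma>))
            (lwhisk B (F0 F a) (F0 F b) (F0 G b) (T0 \<theta> b) (F2 F a b \<gamma>))
          = cmp (Hom B (F0 F a) (F0 G b))
            (rwhisk B (F0 F a) (F0 G a) (F0 G b) (F2 G a b \<gamma>) (T0 \<theta> a))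
            (T1 \<theta> (a, b, src (Hom A a b) \<gamma>))"
  shows "oplax_nat A B F G \<theta>"
  using assms by (auto simp: oplax_nat_def oplax_nat_axioms_def in_arrows)

context oplax_nat
begin

declare T0_in [simp]

lemma T1_simps [simp]:
  assumes "a \<in> Obj A" "b \<in> Obj A" "f \<in> Ob (Hom A a b)"
  shows T1_Ar: "T1 \<theta> (a, b, f) \<in> Ar (Hom B (F0 F a) (F0 G b))"
    and src_T1: "src (Hom B (F0 F a) (F0 G b)) (T1 \<theta> (a, b, f))
      = cmp1 B (F0 F a) (F0 F b) (F0 G b) (T0 \<theta> b) (F1 F a b f)"
    and tgt_T1: "tgt (Hom B (F0 F a) (F0 G b)) (T1 \<theta> (a, b, f))
      = cmp1 B (F0 F a) (F0 G a) (F0 G b) (F1 G a b f) (T0 \<theta> a)"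
  using T1_in [OF assms] by (auto simp: in_arrows)

lemmas T1_comp = T1_cmp1 [unfolded whisk_l_def whisk_r_def]

lemma T1_natural:
  assumes "a \<in> Obj A" "b \<in> Obj A" "\<gamma> \<in> Ar (Hom A a b)"
  shows "cmp (Hom B (F0 F a) (F0 G b)) (T1 \<theta> (a, b, tgt (Hom A a b) \<gamma>))
      (lwhisk B (F0 F a) (F0 F b) (F0 G b) (T0 \<theta> b) (F2 F a b \<gamma>))
    = cmp (Hom B (F0 F a) (F0 G b))
      (rwhisk B (F0 F a) (F0 G a) (F0 G b) (F2 G a b \<gamma>) (T0 \<theta> a))
      (T1 \<theta> (a, b, src (Hom A a b) \<gamma>))"
  using T1_nat [of a b \<gamma>] assms by (simp add: in_arrows)

end

lemma transf_eqI:
  assumes "oplax_nat A B F G \<theta>" "oplax_nat A B F G \<theta>'"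
    and "\<And>a. a \<in> Obj A \<Longrightarrow> T0 \<theta> a = T0 \<theta>' a"
    and "\<And>a b f. \<lbrakk>a \<in> Obj A; b \<in> Obj A; f \<in> Ob (Hom A a b)\<rbrakk> \<Longrightarrow> T1 \<theta> (a, b, f) = T1 \<theta>' (a, b, f)"
  shows "\<theta> = \<theta>'"
proof -
  interpret \<theta>: oplax_nat A B F G \<theta> by fact
  interpret \<theta>': oplax_nat A B F G \<theta>' by fact
  have "T0 \<theta> = T0 \<theta>'"
    using \<theta>.T0_ext \<theta>'.T0_ext assms(3) by (rule extensionalityI)
  moreover have "T1 \<theta> = T1 \<theta>'"
    using \<theta>.T1_ext \<theta>'.T1_ext by (rule extensionalityI) (auto simp: cells1_def assms(4))
  ultimately show ?thesis by simp
qed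

lemma sigma_nat_cat_simps [simp]:
  "Ob (sigma_nat_cat A B S F G) = {\<theta>. sigma_nat A B S F G \<theta>}"
  "src (sigma_nat_cat A B S F G) m = fst m"
  "tgt (sigma_nat_cat A B S F G) m = cod m"
  "ide (sigma_nat_cat A B S F G) \<theta> = (\<theta>, \<lambda>a\<in>Obj A. ide (Hom B (F0 F a) (F0 G a)) (T0 \<theta> a), \<theta>)"
  "cmp (sigma_nat_cat A B S F G) n m =
    (fst m, \<lambda>a\<in>Obj A. cmp (Hom B (F0 F a) (F0 G a)) (dat n a) (dat m a), cod n)"
  by (simp_all add: sigma_nat_cat_def)

lemma sigma_nat_cat_Ar: "m \<in> Ar (sigma_nat_cat A B S F G) \<longleftrightarrow>
    sigma_nat A B S F G (fst m) \<and> sigma_nat A B S F G (cod m) \<and> dat m \<in> modifications A B F G (fst m) (cod m)"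
  by (simp add: sigma_nat_cat_def)

lemma sigma_nat_cat_ArI:
  assumes "sigma_nat A B S F G \<theta>" "sigma_nat A B S F G \<theta>'" "\<rho> \<in> extensional (Obj A)"
    and "\<And>a. a \<in> Obj A \<Longrightarrow> \<rho> a \<in> Ar (Hom B (F0 F a) (F0 G a)) \<and>
      src (Hom B (F0 F a) (F0 G a)) (\<rho> a) = T0 \<theta> a \<and> tgt (Hom B (F0 F a) (F0 G a)) (\<rho> a) = T0 \<theta>' a"
    and "\<And>a b f. \<lbrakk>a \<in> Obj A; b \<in> Obj A; f \<in> Ob (Hom A a b)\<rbrakk> \<Longrightarrow>
      cmp (Hom B (F0 F a) (F0 G b))
          (lwhisk B (F0 F a) (F0 G a) (F0 G b) (F1 G a b f) (\<rho> a)) (T1 \<theta> (a, b, f))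
        = cmp (Hom B (F0 F a) (F0 G b)) (T1 \<theta>' (a, b, f))
          (rwhisk B (F0 F a) (F0 F b) (F0 G b) (\<rho> b) (F1 F a b f))"
  shows "(\<theta>, \<rho>, \<theta>') \<in> Ar (sigma_nat_cat A B S F G)"
  using assms by (auto simp: sigma_nat_cat_Ar modifications_def in_arrows)

locale modif_arrow =
  fixes A :: "('o, 'a, 'c) twocat" and B :: "('p, 'b, 'd) twocat"
    and S and F G :: "('o, 'a, 'c, 'p, 'b, 'd) twofun" and m :: "('o, 'a, 'b, 'd) modif"
  assumes Ar: "m \<in> Ar (sigma_nat_cat A B S F G)"
begin

lemma dom_nat: "sigma_nat A B S F G (fst m)" and cod_nat: "sigma_nat A B S F G (cod m)"
  using Ar by (auto simp: sigma_nat_cat_Ar)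

sublocale dom: oplax_nat A B F G "fst m"
  using dom_nat by (simp add: sigma_nat_def)

sublocale cod: oplax_nat A B F G "cod m"
  using cod_nat by (simp add: sigma_nat_def)

lemma ext: "dat m \<in> extensional (Obj A)"
  using Ar by (auto simp: sigma_nat_cat_Ar modifications_def)

lemma dat_simps [simp]:
  assumes "a \<in> Obj A"
  shows in_Ar: "dat m a \<in> Ar (Hom B (F0 F a) (F0 G a))"
    and src: "src (Hom B (F0 F a) (F0 G a)) (dat m a) = T0 (fst m) a"
    and tgt: "tgt (Hom B (F0 F a) (F0 G a)) (dat m a) = T0 (cod m) a"
  using Ar assms by (auto simp: sigma_nat_cat_Ar modifications_def in_arrows)

lemma modif:
  assumes "a \<in> Obj A" "b \<in> Obj A" "f \<in> Ob (Hom A a b)"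
  shows "cmp (Hom B (F0 F a) (F0 G b))
      (lwhisk B (F0 F a) (F0 G a) (F0 G b) (F1 G a b f) (dat m a)) (T1 (fst m) (a, b, f))
    = cmp (Hom B (F0 F a) (F0 G b)) (T1 (cod m) (a, b, f))
      (rwhisk B (F0 F a) (F0 F b) (F0 G b) (dat m b) (F1 F a b f))"
  using Ar assms by (auto simp: sigma_nat_cat_Ar modifications_def)

lemma modif':
  assumes "a \<in> Obj A" "b \<in> Obj A" "f \<in> Ob (Hom A a b)" "\<chi> \<in> Ar (Hom B (F0 F a) (F0 G b))"
    "tgt (Hom B (F0 F a) (F0 G b)) \<chi> = cmp1 B (F0 F a) (F0 F b) (F0 G b) (T0 (fst m) b) (F1 F a b f)"
  shows "cmp (Hom B (F0 F a) (F0 G b))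
      (lwhisk B (F0 F a) (F0 G a) (F0 G b) (F1 G a b f) (dat m a))
      (cmp (Hom B (F0 F a) (F0 G b)) (T1 (fst m) (a, b, f)) \<chi>)
    = cmp (Hom B (F0 F a) (F0 G b)) (T1 (cod m) (a, b, f))
      (cmp (Hom B (F0 F a) (F0 G b))
        (rwhisk B (F0 F a) (F0 F b) (F0 G b) (dat m b) (F1 F a b f)) \<chi>)"
proof -
  interpret H: category "Hom B (F0 F a) (F0 G b)" using assms by simp
  show ?thesis
    using assms arg_cong [OF modif [OF assms(1-3)], of "\<lambda>x. cmp (Hom B (F0 F a) (F0 G b)) x \<chi>"] by simp
qed

end

lemma modif_eqI:
  assumes "m \<in> Ar (sigma_nat_cat A B S F G)" "n \<in> Ar (sigma_nat_cat A B S' F G)"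
    and "fst m = fst n" "cod m = cod n" "\<And>a. a \<in> Obj A \<Longrightarrow> dat m a = dat n a"
  shows "m = n"
  using assms
  by (auto simp: prod_eq_iff sigma_nat_cat_Ar modifications_def intro: extensionalityI)

lemma category_sigma_nat_cat: "category (sigma_nat_cat A B S F G)"
proof -
  let ?C = "sigma_nat_cat A B S F G"
  have comp: "cmp ?C n m \<in> Ar ?C"
    if mn: "m \<in> Ar ?C" "n \<in> Ar ?C" "fst n = cod m" for m n
  proof -
    interpret m: modif_arrow A B S F G m by unfold_locales fact
    interpret n: modif_arrow A B S F G n by unfold_locales fact
    show ?thesis unfolding sigma_nat_cat_simps
    proof (rule sigma_nat_cat_ArI, goal_cases)
      case (5 a b f)
      then show ?case using n.modif' [OF 5] mn(3) by (simp add: m.modif)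
    qed (use mn in \<open>auto intro: m.dom_nat n.cod_nat\<close>)
  qed
  have ident: "ide ?C \<theta> \<in> Ar ?C" if "sigma_nat A B S F G \<theta>" for \<theta>
  proof -
    interpret \<theta>: oplax_nat A B F G \<theta> using that by (simp add: sigma_nat_def)
    show ?thesis unfolding sigma_nat_cat_simps using that by (intro sigma_nat_cat_ArI) auto
  qed
  show ?thesis
  proof (unfold_locales, goal_cases)
    case (4 f x y g z)
    then show ?case using comp [of f g] by (simp add: in_arrows)
  next
    case (7 f w x g y h z)
    interpret f: modif_arrow A B S F G f using 7 by unfold_locales (auto simp: in_arrows)
    interpret g: modif_arrow A B S F G g using 7 by unfold_locales (auto simp: in_arrows)
    interpret h: modif_arrow A B S F G h using 7 by unfold_locales (auto simp: in_arrows)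
    show ?case using 7 by (auto simp: in_arrows intro!: restrict_ext)
  next
    case (5 f x y)
    then interpret f: modif_arrow A B S F G f by unfold_locales (auto simp: in_arrows)
    show ?case
      by (rule modif_eqI) (use 5 comp [of "ide ?C x" f] ident [of x] f.Ar f.dom_nat in
        \<open>auto simp: in_arrows\<close>)
  next
    case (6 f x y)
    then interpret f: modif_arrow A B S F G f by unfold_locales (auto simp: in_arrows)
    show ?case
      by (rule modif_eqI) (use 6 comp [of f "ide ?C y"] ident [of y] f.Ar f.cod_nat in
        \<open>auto simp: in_arrows\<close>)
  qed (use ident in \<open>auto simp: in_arrows sigma_nat_cat_Ar\<close>)
qed

lemma transf_comp_simps [simp]:
  "a \<in> Obj A \<Longrightarrow> T0 (transf_comp A B F G H \<tau> \<theta>) a = cmp1 B (F0 F a) (F0 G a) (F0 H a) (T0 \<tau> a) (T0 \<theta> a)"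
  "\<lbrakk>a \<in> Obj A; b \<in> Obj A; f \<in> Ob (Hom A a b)\<rbrakk> \<Longrightarrow>
    T1 (transf_comp A B F G H \<tau> \<theta>) (a, b, f) = cmp (Hom B (F0 F a) (F0 H b))
        (rwhisk B (F0 F a) (F0 G a) (F0 H b) (T1 \<tau> (a, b, f)) (T0 \<theta> a))
        (lwhisk B (F0 F a) (F0 G b) (F0 H b) (T0 \<tau> b) (T1 \<theta> (a, b, f)))"
  by (simp_all add: transf_comp_def cells1_def)

lemma transf_id_simps [simp]:
  "a \<in> Obj A \<Longrightarrow> T0 (transf_id A B F) a = one B (F0 F a)"
  "\<lbrakk>a \<in> Obj A; b \<in> Obj A; f \<in> Ob (Hom A a b)\<rbrakk> \<Longrightarrow>
    T1 (transf_id A B F) (a, b, f) = ide (Hom B (F0 F a) (F0 F b)) (F1 F a b f)"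
  by (simp_all add: transf_id_def cells1_def)

lemma oplax_nat_transf_id:
  assumes "two_functor A B F"
  shows "oplax_nat A B F F (transf_id A B F)"
proof -
  interpret F: two_functor A B F by fact
  show ?thesis
  proof (rule oplax_natI)
    show "T0 (transf_id A B F) \<in> extensional (Obj A)" "T1 (transf_id A B F) \<in> extensional (cells1 A)"
      by (simp_all add: transf_id_def)
  qed (use assms in auto)
qed

lemma oplax_nat_transf_comp:
  assumes "oplax_nat A B F G \<theta>" "oplax_nat A B G H \<tau>"
  shows "oplax_nat A B F H (transf_comp A B F G H \<tau> \<theta>)"
proof -
  interpret \<theta>: oplax_nat A B F G \<theta> by fact
  interpret \<tau>: oplax_nat A B G H \<tau> by fact
  show ?thesis
  proof (rule oplax_natI, goal_cases)
    case (8 a b c f g)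
    let ?C = "Hom B (F0 F a) (F0 H c)"
    \<comment> \<open>In the composite the cells of \<tau> and \<theta> alternate, and the cell of
      \<theta> at f has to pass the cell of \<tau> at g. The exchange law does this; then the two
      composition axioms fit together.\<close>
    have "cmp ?C (rwhisk B (F0 F a) (F0 G b) (F0 H c) (T1 \<tau> (b, c, g))
        (cmp1 B (F0 F a) (F0 G a) (F0 G b) (F1 G a b f) (T0 \<theta> a)))
      (cmp ?C (lwhisk B (F0 F a) (F0 G b) (F0 H c) (cmp1 B (F0 G b) (F0 G c) (F0 H c) (T0 \<tau> c) (F1 G b c g)) (T1 \<theta> (a, b, f))) \<chi>)
     = cmp ?C (lwhisk B (F0 F a) (F0 G b) (F0 H c) (cmp1 B (F0 G b) (F0 H b) (F0 H c) (F1 H b c g) (T0 \<tau> b)) (T1 \<theta> (a, b, f)))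
      (cmp ?C (rwhisk B (F0 F a) (F0 G b) (F0 H c) (T1 \<tau> (b, c, g))
        (cmp1 B (F0 F a) (F0 F b) (F0 G b) (T0 \<theta> b) (F1 F a b f))) \<chi>)"
      if "\<chi> \<in> Ar ?C" "tgt ?C \<chi> = cmp1 B (F0 F a) (F0 G b) (F0 H c)
       (cmp1 B (F0 G b) (F0 G c) (F0 H c) (T0 \<tau> c) (F1 G b c g)) (cmp1 B (F0 F a) (F0 F b) (F0 G b) (T0 \<theta> b) (F1 F a b f))" for \<chi>
      using 8 that by (intro \<theta>.F.B.exchange') auto
    then show ?case using 8 by (simp add: \<theta>.T1_comp \<tau>.T1_comp)
  next
    case (9 a b \<gamma>)
    interpret C: category "Hom B (F0 F a) (F0 H b)" using 9 by simp
    \<comment> \<open>The square of \<theta> is whiskered by \<open>T0 \<tau> b\<close>, that of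
      \<tau> by \<open>T0 \<theta> a\<close>; pasted together they are the square of the
      composite.\<close>
    show ?case
      using 9 arg_cong [OF \<theta>.T1_natural [OF 9], of "lwhisk B (F0 F a) (F0 G b) (F0 H b) (T0 \<tau> b)"]
        arg_cong [OF \<tau>.T1_natural [OF 9], of "\<lambda>x. cmp (Hom B (F0 F a) (F0 H b)) (rwhisk B (F0 F a) (F0 G a) (F0 H b) x (T0 \<theta> a))
          (lwhisk B (F0 F a) (F0 G b) (F0 H b) (T0 \<tau> b) (T1 \<theta> (a, b, src (Hom A a b) \<gamma>)))"]
      by simp
  qed (auto simp: transf_comp_def cells1_def \<theta>.T1_one \<tau>.T1_one intro: \<theta>.F.two_functor_axioms \<tau>.G.two_functor_axioms)
qed


section \<open>The 2-category of 2-functors and pseudonatural transformations\<close>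

abbreviation all1 where
  "all1 A \<equiv> \<lambda>a b. Ob (Hom A a b)"

lemma Hom_p_simps [simp]:
  "Obj (Hom_p A B) = {F. two_functor A B F}"
  "Hom (Hom_p A B) = sigma_nat_cat A B (all1 A)"
  "one (Hom_p A B) = transf_id A B"
  "cmp1 (Hom_p A B) = transf_comp A B"
  "cmp2 (Hom_p A B) F G H n m = (transf_comp A B F G H (fst n) (fst m),
     \<lambda>a\<in>Obj A. cmp2 B (F0 F a) (F0 G a) (F0 H a) (dat n a) (dat m a),
     transf_comp A B F G H (cod n) (cod m))"
  by (auto simp: Hom_p_def split: prod.splits)

abbreviation pseudo_nat where
  "pseudo_nat A B \<equiv> sigma_nat A B (all1 A)"

lemma pseudo_nat_id: "two_functor A B F \<Longrightarrow> pseudo_nat A B F F (transf_id A B F)"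
  unfolding sigma_nat_def
proof (safe, goal_cases)
  case 1
  then show ?case by (rule oplax_nat_transf_id)
next
  case (2 a b f)
  then interpret F: two_functor A B F by simp
  show ?case using 2 by simp
qed

lemma pseudo_nat_comp:
  assumes "pseudo_nat A B F G \<theta>" "pseudo_nat A B G H \<tau>"
  shows "pseudo_nat A B F H (transf_comp A B F G H \<tau> \<theta>)"
  unfolding sigma_nat_def
proof (safe, goal_cases)
  case 1
  show ?case using assms by (auto simp: sigma_nat_def intro: oplax_nat_transf_comp)
next
  case (2 a b f)
  interpret \<theta>: oplax_nat A B F G \<theta> using assms by (simp add: sigma_nat_def)
  interpret \<tau>: oplax_nat A B G H \<tau> using assms by (simp add: sigma_nat_def)
  show ?case using assms 2 by (simp add: sigma_nat_def)
qed

text \<open>Strict because \<open>B\<close> is strict: components compose as 1-cells of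
  \<open>B\<close>, and the structure cells agree once whiskering has been distributed over vertical
  composition.\<close>

lemma transf_comp_assoc:
  assumes "oplax_nat A B F G \<theta>" "oplax_nat A B G H \<tau>" "oplax_nat A B H K \<sigma>"
  shows "transf_comp A B F H K \<sigma> (transf_comp A B F G H \<tau> \<theta>)
    = transf_comp A B F G K (transf_comp A B G H K \<sigma> \<tau>) \<theta>"
proof -
  interpret \<theta>: oplax_nat A B F G \<theta> by fact
  interpret \<tau>: oplax_nat A B G H \<tau> by fact
  interpret \<sigma>: oplax_nat A B H K \<sigma> by fact
  show ?thesis
    by (rule transf_eqI [where F = F and G = K]) (auto intro!: oplax_nat_transf_comp assms)
qed

lemma transf_comp_id:
  assumes "oplax_nat A B F G \<theta>"
  shows "transf_comp A B F F G \<theta> (transf_id A B F) = \<theta>" "transf_comp A B F G G (transf_id A B G) \<theta> = \<theta>"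
proof -
  interpret \<theta>: oplax_nat A B F G \<theta> by fact
  show "transf_comp A B F F G \<theta> (transf_id A B F) = \<theta>"
    by (rule transf_eqI [where F = F and G = G])
     (auto intro!: oplax_nat_transf_comp oplax_nat_transf_id assms \<theta>.F.two_functor_axioms)
  show "transf_comp A B F G G (transf_id A B G) \<theta> = \<theta>"
    by (rule transf_eqI [where F = F and G = G])
     (auto intro!: oplax_nat_transf_comp oplax_nat_transf_id assms \<theta>.G.two_functor_axioms)
qed

text \<open>The modification axiom of \<open>m\<close> is whiskered by \<open>T0 \<tau> b\<close>,
  and the exchange law moves the cell of \<tau> at f past \<open>dat m a\<close>.\<close>

lemma modif_whisk:
  assumes "m \<in> Ar (Hom (Hom_p A B) F G)" "pseudo_nat A B G H \<tau>"
  shows "lwhisk (Hom_p A B) F G H \<tau> m \<in> Ar (Hom (Hom_p A B) F H)"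
proof -
  let ?S = "all1 A"
  interpret m: modif_arrow A B ?S F G m using assms by unfold_locales simp
  interpret \<tau>: oplax_nat A B G H \<tau> using assms by (simp add: sigma_nat_def)
  show ?thesis unfolding Hom_p_simps
  proof (rule sigma_nat_cat_ArI, goal_cases)
    case (5 a b f)
    note 1 = arg_cong [OF m.modif [OF 5], of "lwhisk B (F0 F a) (F0 G b) (F0 H b) (T0 \<tau> b)"]
    let ?C = "Hom B (F0 F a) (F0 H b)"
    have 2: "cmp ?C (rwhisk B (F0 F a) (F0 G a) (F0 H b) (T1 \<tau> (a, b, f)) (T0 (cod m) a))
      (cmp ?C (lwhisk B (F0 F a) (F0 G a) (F0 H b) (cmp1 B (F0 G a) (F0 G b) (F0 H b) (T0 \<tau> b) (F1 G a b f)) (dat m a)) \<chi>)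
      = cmp ?C (lwhisk B (F0 F a) (F0 G a) (F0 H b) (cmp1 B (F0 G a) (F0 H a) (F0 H b) (F1 H a b f) (T0 \<tau> a)) (dat m a))
      (cmp ?C (rwhisk B (F0 F a) (F0 G a) (F0 H b) (T1 \<tau> (a, b, f)) (T0 (fst m) a)) \<chi>)"
      if "\<chi> \<in> Ar ?C" "tgt ?C \<chi> = cmp1 B (F0 F a) (F0 G a) (F0 H b)
       (cmp1 B (F0 G a) (F0 G b) (F0 H b) (T0 \<tau> b) (F1 G a b f)) (T0 (fst m) a)" for \<chi>
      using 5 that by (intro m.dom.F.B.exchange') auto
    show ?case using 5 1 by (simp flip: 2)
  qed (use assms m.dom_nat m.cod_nat in \<open>auto simp: pseudo_nat_comp\<close>)
qed

text \<open>Here the axiom of \<open>n\<close> is whiskered by \<open>T0 \<theta> a\<close>, and it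
  is the cell of \<theta> at f that is moved past \<open>dat n b\<close>.\<close>

lemma modif_whisk':
  assumes "n \<in> Ar (Hom (Hom_p A B) G H)" "pseudo_nat A B F G \<theta>"
  shows "rwhisk (Hom_p A B) F G H n \<theta> \<in> Ar (Hom (Hom_p A B) F H)"
proof -
  let ?S = "all1 A"
  interpret n: modif_arrow A B ?S G H n using assms by unfold_locales simp
  interpret \<theta>: oplax_nat A B F G \<theta> using assms by (simp add: sigma_nat_def)
  show ?thesis unfolding Hom_p_simps
  proof (rule sigma_nat_cat_ArI, goal_cases)
    case (5 a b f)
    let ?C = "Hom B (F0 F a) (F0 H b)"
    interpret C: category ?C using 5 by simp
    note 1 = arg_cong [OF n.modif [OF 5], of "\<lambda>x. cmp ?C (rwhisk B (F0 F a) (F0 G a) (F0 H b) x (T0 \<theta> a))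
      (lwhisk B (F0 F a) (F0 G b) (F0 H b) (T0 (fst n) b) (T1 \<theta> (a, b, f)))"]
    have 2: "cmp ?C (rwhisk B (F0 F a) (F0 G b) (F0 H b) (dat n b)
        (cmp1 B (F0 F a) (F0 G a) (F0 G b) (F1 G a b f) (T0 \<theta> a)))
      (lwhisk B (F0 F a) (F0 G b) (F0 H b) (T0 (fst n) b) (T1 \<theta> (a, b, f)))
     = cmp ?C (lwhisk B (F0 F a) (F0 G b) (F0 H b) (T0 (cod n) b) (T1 \<theta> (a, b, f)))
      (rwhisk B (F0 F a) (F0 G b) (F0 H b) (dat n b)
        (cmp1 B (F0 F a) (F0 F b) (F0 G b) (T0 \<theta> b) (F1 F a b f)))"
      using 5 by (intro n.dom.F.B.exchange) auto
    show ?case using 5 1 2 by simp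
  qed (use assms n.dom_nat n.cod_nat in \<open>auto simp: pseudo_nat_comp\<close>)
qed

lemma two_category_Hom_p:
  assumes "two_category A" "two_category B"
  shows "two_category (Hom_p A B)"
proof -
  let ?S = "all1 A"
  interpret A: two_category A by fact
  interpret B: two_category B by fact
  have in_Ar: "cmp2 (Hom_p A B) F G H n m \<in> Ar (sigma_nat_cat A B ?S F H)"
    if m: "m \<in> Ar (sigma_nat_cat A B ?S F G)" and n: "n \<in> Ar (sigma_nat_cat A B ?S G H)" for F G H m n
  proof -
    interpret m: modif_arrow A B ?S F G m by unfold_locales fact
    interpret n: modif_arrow A B ?S G H n by unfold_locales fact
    interpret C: category "sigma_nat_cat A B ?S F H" by (rule category_sigma_nat_cat)
    \<comment> \<open>A horizontal composite of modifications is a vertical composite of two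
      whiskerings, so closure follows from the two whiskering lemmas.\<close>
    have "cmp (sigma_nat_cat A B ?S F H)
       (rwhisk (Hom_p A B) F G H n (cod m))
       (lwhisk (Hom_p A B) F G H (fst n) m) \<in> Ar (sigma_nat_cat A B ?S F H)"
      using modif_whisk [of m A B F G H "fst n"] modif_whisk' [of n A B G H F "cod m"] m n m.cod_nat n.dom_nat
      by (intro C.cmp_Ar) auto
    also have "cmp (sigma_nat_cat A B ?S F H)
       (rwhisk (Hom_p A B) F G H n (cod m))
       (lwhisk (Hom_p A B) F G H (fst n) m) = cmp2 (Hom_p A B) F G H n m"
    proof -
      have "cmp (Hom B (F0 F a) (F0 H a)) (rwhisk B (F0 F a) (F0 G a) (F0 H a) (dat n a)
          (T0 (cod m) a))
        (lwhisk B (F0 F a) (F0 G a) (F0 H a) (T0 (fst n) a) (dat m a))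
        = cmp2 B (F0 F a) (F0 G a) (F0 H a) (dat n a) (dat m a)" if "a \<in> Obj A" for a
        using that B.cmp2_via_tgt [of "F0 F a" "F0 G a" "F0 H a" "dat m a" "dat n a"] by simp
      then show ?thesis by (auto intro!: restrict_ext)
    qed
    finally show ?thesis .
  qed
  show ?thesis
  proof (rule two_category.intro, goal_cases)
    case (1 a b)
    then show ?case by (simp add: category_sigma_nat_cat)
  next
    case (2 a)
    then show ?case by (simp add: pseudo_nat_id)
  next
    case (3 a b c f g)
    then show ?case by (auto intro: pseudo_nat_comp)
  next
    case (4 a b c \<alpha> f f' \<beta> g g')
    then show ?case using in_Ar [of \<alpha> a b \<beta> c] by (simp add: in_arrows)
  next
    case (5 a b c f g)
    interpret f: oplax_nat A B a b f using 5 by (simp add: sigma_nat_def)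
    interpret g: oplax_nat A B b c g using 5 by (simp add: sigma_nat_def)
    show ?case by (auto intro!: restrict_ext)
  next
    case (6 a b c \<alpha> f f' \<alpha>' f'' \<beta> g g' \<beta>' g'')
    interpret \<alpha>: modif_arrow A B ?S a b \<alpha> using 6 by unfold_locales (auto simp: in_arrows)
    interpret \<beta>: modif_arrow A B ?S b c \<beta> using 6 by unfold_locales (auto simp: in_arrows)
    interpret \<alpha>': modif_arrow A B ?S a b \<alpha>' using 6 by unfold_locales (auto simp: in_arrows)
    interpret \<beta>': modif_arrow A B ?S b c \<beta>' using 6 by unfold_locales (auto simp: in_arrows)
    have "fst \<alpha>' = cod \<alpha>" "fst \<beta>' = cod \<beta>" using 6 by (auto simp: in_arrows)
    then show ?case by (auto intro!: restrict_ext B.cmp2_cmp)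
  next
    case (7 a b f)
    then show ?case by (simp add: transf_comp_id sigma_nat_def)
  next
    case (8 a b f)
    then show ?case by (simp add: transf_comp_id sigma_nat_def)
  next
    case (9 a b \<alpha>)
    interpret \<alpha>: modif_arrow A B ?S a b \<alpha> using 9 by unfold_locales auto
    show ?case using \<alpha>.ext 9
      by (auto simp: prod_eq_iff extensional_def transf_comp_id \<alpha>.dom.oplax_nat_axioms \<alpha>.cod.oplax_nat_axioms)
  next
    case (10 a b \<alpha>)
    interpret \<alpha>: modif_arrow A B ?S a b \<alpha> using 10 by unfold_locales auto
    show ?case using \<alpha>.ext 10
      by (auto simp: prod_eq_iff extensional_def transf_comp_id \<alpha>.dom.oplax_nat_axioms \<alpha>.cod.oplax_nat_axioms)
  next
    case (11 a b c d f g h)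
    then show ?case by (simp add: transf_comp_assoc sigma_nat_def)
  next
    case (12 a b c d \<alpha> \<beta> \<gamma>)
    interpret \<alpha>: modif_arrow A B ?S a b \<alpha> using 12 by unfold_locales auto
    interpret \<beta>: modif_arrow A B ?S b c \<beta> using 12 by unfold_locales auto
    interpret \<gamma>: modif_arrow A B ?S c d \<gamma> using 12 by unfold_locales auto
    show ?case
      using transf_comp_assoc [OF \<alpha>.dom.oplax_nat_axioms \<beta>.dom.oplax_nat_axioms \<gamma>.dom.oplax_nat_axioms]
        transf_comp_assoc [OF \<alpha>.cod.oplax_nat_axioms \<beta>.cod.oplax_nat_axioms \<gamma>.cod.oplax_nat_axioms]
      by (auto intro!: restrict_ext)
  qed
qed


section \<open>Transformations between category-valued 2-functors\<close>

declare CAT_simps [simp]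

lemma CAT_Obj: "C \<in> Obj (CAT r) \<longleftrightarrow> category C \<and> |Ob C| <o r \<and> |Ar C| <o r"
  by (simp add: CAT_def)

text \<open>Brings the axioms of a category-valued 2-functor down to equations at single objects and
  arrows of the categories \<open>F0 F a\<close>; extensionality lifts these back to equalities of
  functors and transformations.\<close>

lemma two_functor_CATI:
  assumes "two_category A" "\<And>a. a \<in> Obj A \<Longrightarrow> F0 F a \<in> Obj (CAT r)"
    and "\<And>a b. a \<in> Obj A \<Longrightarrow> b \<in> Obj A \<Longrightarrow>
      FO (FH F a b) \<in> extensional (Ob (Hom A a b)) \<and> FA (FH F a b) \<in> extensional (Ar (Hom A a b))"
    and fctr: "\<And>a b f. \<lbrakk>a \<in> Obj A; b \<in> Obj A; f \<in> Ob (Hom A a b)\<rbrakk>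
      \<Longrightarrow> is_functor (F0 F a) (F0 F b) (F1 F a b f)"
    and nt: "\<And>a b \<alpha>. \<lbrakk>a \<in> Obj A; b \<in> Obj A; \<alpha> \<in> Ar (Hom A a b)\<rbrakk>
      \<Longrightarrow> F2 F a b \<alpha> \<in> Ar (functor_cat (F0 F a) (F0 F b)) \<and>
        fst (F2 F a b \<alpha>) = F1 F a b (src (Hom A a b) \<alpha>) \<and> cod (F2 F a b \<alpha>) = F1 F a b (tgt (Hom A a b) \<alpha>)"
    and ide: "\<And>a b f x. \<lbrakk>a \<in> Obj A; b \<in> Obj A; f \<in> Ob (Hom A a b); x \<in> Ob (F0 F a)\<rbrakk>
      \<Longrightarrow> dat (F2 F a b (ide (Hom A a b) f)) x = ide (F0 F b) (FO (F1 F a b f) x)"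
    and cmp: "\<And>a b \<alpha> \<beta> x. \<lbrakk>a \<in> Obj A; b \<in> Obj A; \<alpha> \<in> Ar (Hom A a b); \<beta> \<in> Ar (Hom A a b);
      src (Hom A a b) \<beta> = tgt (Hom A a b) \<alpha>; x \<in> Ob (F0 F a)\<rbrakk>
      \<Longrightarrow> dat (F2 F a b (cmp (Hom A a b) \<beta> \<alpha>)) x = cmp (F0 F b) (dat (F2 F a b \<beta>) x) (dat (F2 F a b \<alpha>) x)"
    and one: "\<And>a x. a \<in> Obj A \<Longrightarrow> x \<in> Ob (F0 F a) \<Longrightarrow> FO (F1 F a a (one A a)) x = x"
      "\<And>a m. a \<in> Obj A \<Longrightarrow> m \<in> Ar (F0 F a) \<Longrightarrow> FA (F1 F a a (one A a)) m = m"
    and cmp1: "\<And>a b c f g x. \<lbrakk>a \<in> Obj A; b \<in> Obj A; c \<in> Obj A; f \<in> Ob (Hom A a b);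
      g \<in> Ob (Hom A b c); x \<in> Ob (F0 F a)\<rbrakk>
      \<Longrightarrow> FO (F1 F a c (cmp1 A a b c g f)) x = FO (F1 F b c g) (FO (F1 F a b f) x)"
      "\<And>a b c f g m. \<lbrakk>a \<in> Obj A; b \<in> Obj A; c \<in> Obj A; f \<in> Ob (Hom A a b);
      g \<in> Ob (Hom A b c); m \<in> Ar (F0 F a)\<rbrakk>
      \<Longrightarrow> FA (F1 F a c (cmp1 A a b c g f)) m = FA (F1 F b c g) (FA (F1 F a b f) m)"
    and cmp2: "\<And>a b c \<alpha> \<beta> x. \<lbrakk>a \<in> Obj A; b \<in> Obj A; c \<in> Obj A; \<alpha> \<in> Ar (Hom A a b);
      \<beta> \<in> Ar (Hom A b c); x \<in> Ob (F0 F a)\<rbrakk>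
      \<Longrightarrow> dat (F2 F a c (cmp2 A a b c \<beta> \<alpha>)) x = cmp (F0 F c)
        (dat (F2 F b c \<beta>) (FO (F1 F a b (tgt (Hom A a b) \<alpha>)) x))
        (FA (F1 F b c (src (Hom A b c) \<beta>)) (dat (F2 F a b \<alpha>) x))"
  shows "two_functor A (CAT r) F"
proof (rule two_functorI, goal_cases)
  interpret A: two_category A by fact
  have cat: "category (F0 F a)" if "a \<in> Obj A" for a
    using assms(2) that by (auto simp: CAT_Obj)
  have one_fun: "F1 F a a (one A a) = fun_id (F0 F a)" if "a \<in> Obj A" for a
    by (rule fctr_eqI) (use that in \<open>auto simp: one intro!: fctr cat\<close>)
  have cmp1_fun: "F1 F a c (cmp1 A a b c g f) = fun_comp (F0 F a) (F1 F b c g) (F1 F a b f)"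
    if "a \<in> Obj A" "b \<in> Obj A" "c \<in> Obj A" "f \<in> Ob (Hom A a b)" "g \<in> Ob (Hom A b c)" for a b c f g
    by (rule fctr_eqI [OF fctr is_functor_comp [OF fctr fctr]]) (use that in \<open>auto simp: cmp1\<close>)
  {
    case (4 a b)
    interpret ab: category "functor_cat (F0 F a) (F0 F b)" using 4 by (simp add: category_functor_cat cat)
    show ?case
    proof (rule is_functorI, goal_cases)
      case (7 f)
      have "F2 F a b (ide (Hom A a b) f) = ide (functor_cat (F0 F a) (F0 F b)) (F1 F a b f)"
        by (rule nt_eqI) (use 4 7 nt [of a b "ide (Hom A a b) f"] fctr [of a b f] ide in
          \<open>auto simp del: functor_cat_simps(4) intro!: ab.ide_Ar, auto\<close>)
      then show ?case by (simp add: F1_def F2_def)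
    next
      case (8 f g)
      have "F2 F a b (cmp (Hom A a b) g f) = cmp (functor_cat (F0 F a) (F0 F b)) (F2 F a b g) (F2 F a b f)"
      proof (rule nt_eqI)
        show "cmp (functor_cat (F0 F a) (F0 F b)) (F2 F a b g) (F2 F a b f) \<in> Ar (functor_cat (F0 F a) (F0 F b))"
          by (rule ab.cmp_Ar) (use 4 8 nt in auto)
      qed (use 4 8 nt cmp in auto)
      then show ?case by (simp add: F2_def)
    qed (use 4 A.Hom_category assms(3) fctr nt in \<open>auto simp: category_functor_cat cat F1_def F2_def\<close>)
  next
    case (5 a)
    then show ?case by (simp add: one_fun)
  next
    case (6 a b c f g)
    then show ?case by (simp add: cmp1_fun)
  next
    case (7 a b c \<alpha> \<beta>)
    interpret C: two_category "CAT r" by (rule two_category_CAT)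
    have "F2 F a c (cmp2 A a b c \<beta> \<alpha>) = cmp2 (CAT r) (F0 F a) (F0 F b) (F0 F c) (F2 F b c \<beta>) (F2 F a b \<alpha>)"
    proof (rule nt_eqI)
      show "F2 F a c (cmp2 A a b c \<beta> \<alpha>) \<in> Ar (functor_cat (F0 F a) (F0 F c))"
        using 7 nt [of a c "cmp2 A a b c \<beta> \<alpha>"] by simp
      show "cmp2 (CAT r) (F0 F a) (F0 F b) (F0 F c) (F2 F b c \<beta>) (F2 F a b \<alpha>) \<in> Ar (functor_cat (F0 F a) (F0 F c))"
        using C.cmp2_Ar [of "F0 F a" "F0 F b" "F0 F c" "F2 F a b \<alpha>" "F2 F b c \<beta>"] 7 nt assms(2)
        by (simp del: CAT_simps(4))
    qed (use 7 nt [of a c "cmp2 A a b c \<beta> \<alpha>"] nt [of a b \<alpha>] nt [of b c \<beta>] in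
        \<open>simp_all add: cmp2 cmp1_fun\<close>)
    then show ?case .
  }
qed (use assms two_category_CAT in auto)

locale cat_valued = two_functor A "CAT r" F
  for A :: "('o, 'a, 'c) twocat" and r :: "'u rel"
    and F :: "('o, 'a, 'c, ('u, 'u) cat, ('u, 'u, 'u, 'u) fctr, ('u, 'u, 'u, 'u) nt) twofun"
begin

lemma cat [simp]: "a \<in> Obj A \<Longrightarrow> category (F0 F a)"
  using F0_in CAT_category by blast

lemma F1_functor: "\<lbrakk>a \<in> Obj A; b \<in> Obj A; f \<in> Ob (Hom A a b)\<rbrakk> \<Longrightarrow> is_functor (F0 F a) (F0 F b) (F1 F a b f)"
  using F1_in by simp

lemma F2_nat: "\<lbrakk>a \<in> Obj A; b \<in> Obj A; \<alpha> \<in> Ar (Hom A a b)\<rbrakk> \<Longrightarrow> nat_arrow (F0 F a) (F0 F b) (F2 F a b \<alpha>)"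
  using F2_in by unfold_locales simp

lemma F2_dom_cod [simp]:
  assumes "a \<in> Obj A" "b \<in> Obj A" "\<alpha> \<in> Ar (Hom A a b)"
  shows "fst (F2 F a b \<alpha>) = F1 F a b (src (Hom A a b) \<alpha>)" "cod (F2 F a b \<alpha>) = F1 F a b (tgt (Hom A a b) \<alpha>)"
  using src_F2 [OF assms] tgt_F2 [OF assms] by simp_all

lemmas cat_simps [simp] =
  category.src_in [OF cat] category.tgt_in [OF cat] category.ide_Ar [OF cat] category.src_ide [OF cat]
  category.tgt_ide [OF cat] category.cmp_Ar [OF cat] category.src_cmp [OF cat] category.tgt_cmp [OF cat]
  category.cmp_ide_right [OF cat] category.cmp_ide_left [OF cat] category.assoc [OF cat]
  category.inv_cancel [OF cat] category.iso_ide [OF cat] category.iso_inv [OF cat] category.iso_cmp [OF cat]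

lemmas F1_simps [simp] =
  is_functor.FO_Ob [OF F1_functor] is_functor.FA_Ar [OF F1_functor] is_functor.FA_src [OF F1_functor]
  is_functor.FA_tgt [OF F1_functor] is_functor.FA_ide [OF F1_functor] is_functor.FA_comp [OF F1_functor]
  is_functor.FA_iso [OF F1_functor]

lemma F2_simps [simp]:
  assumes "a \<in> Obj A" "b \<in> Obj A" "\<alpha> \<in> Ar (Hom A a b)" "x \<in> Ob (F0 F a)"
  shows "dat (F2 F a b \<alpha>) x \<in> Ar (F0 F b)"
    "src (F0 F b) (dat (F2 F a b \<alpha>) x) = FO (F1 F a b (src (Hom A a b) \<alpha>)) x"
    "tgt (F0 F b) (dat (F2 F a b \<alpha>) x) = FO (F1 F a b (tgt (Hom A a b) \<alpha>)) x"
  using nat_arrow.in_Ar [OF F2_nat] nat_arrow.src [OF F2_nat] nat_arrow.tgt [OF F2_nat] assms by simp_all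

lemma F2_natural:
  assumes "a \<in> Obj A" "b \<in> Obj A" "\<alpha> \<in> Ar (Hom A a b)" "m \<in> Ar (F0 F a)"
  shows "cmp (F0 F b) (dat (F2 F a b \<alpha>) (tgt (F0 F a) m)) (FA (F1 F a b (src (Hom A a b) \<alpha>)) m)
    = cmp (F0 F b) (FA (F1 F a b (tgt (Hom A a b) \<alpha>)) m) (dat (F2 F a b \<alpha>) (src (F0 F a) m))"
  using nat_arrow.nat [OF F2_nat] assms by simp

end

text \<open>Counterpart of \<open>two_functor_CATI\<close> for transformations. The premise
  \<open>shape\<close> supplies the ends and the extensionality by which equations between
  components become equalities of 2-cells of \<open>CAT r\<close>.\<close>

lemma oplax_nat_CATI:
  assumes "two_functor A (CAT r) F" "two_functor A (CAT r) G"
    and "T0 \<theta> \<in> extensional (Obj A)" "T1 \<theta> \<in> extensional (cells1 A)"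
    and fctr: "\<And>a. a \<in> Obj A \<Longrightarrow> is_functor (F0 F a) (F0 G a) (T0 \<theta> a)"
    and shape: "\<And>a b f. \<lbrakk>a \<in> Obj A; b \<in> Obj A; f \<in> Ob (Hom A a b)\<rbrakk> \<Longrightarrow>
      fst (T1 \<theta> (a, b, f)) = fun_comp (F0 F a) (T0 \<theta> b) (F1 F a b f) \<and>
      cod (T1 \<theta> (a, b, f)) = fun_comp (F0 F a) (F1 G a b f) (T0 \<theta> a) \<and>
      dat (T1 \<theta> (a, b, f)) \<in> extensional (Ob (F0 F a))"
    and comp: "\<And>a b f x. \<lbrakk>a \<in> Obj A; b \<in> Obj A; f \<in> Ob (Hom A a b); x \<in> Ob (F0 F a)\<rbrakk> \<Longrightarrow>
      dat (T1 \<theta> (a, b, f)) x \<in> Ar (F0 G b) \<and>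
      src (F0 G b) (dat (T1 \<theta> (a, b, f)) x) = FO (T0 \<theta> b) (FO (F1 F a b f) x) \<and>
      tgt (F0 G b) (dat (T1 \<theta> (a, b, f)) x) = FO (F1 G a b f) (FO (T0 \<theta> a) x)"
    and nat: "\<And>a b f m. \<lbrakk>a \<in> Obj A; b \<in> Obj A; f \<in> Ob (Hom A a b); m \<in> Ar (F0 F a)\<rbrakk> \<Longrightarrow>
      cmp (F0 G b) (dat (T1 \<theta> (a, b, f)) (tgt (F0 F a) m)) (FA (T0 \<theta> b) (FA (F1 F a b f) m))
      = cmp (F0 G b) (FA (F1 G a b f) (FA (T0 \<theta> a) m)) (dat (T1 \<theta> (a, b, f)) (src (F0 F a) m))"
    and one: "\<And>a x. a \<in> Obj A \<Longrightarrow> x \<in> Ob (F0 F a) \<Longrightarrow>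
      dat (T1 \<theta> (a, a, one A a)) x = ide (F0 G a) (FO (T0 \<theta> a) x)"
    and cmp1: "\<And>a b c f g x. \<lbrakk>a \<in> Obj A; b \<in> Obj A; c \<in> Obj A; f \<in> Ob (Hom A a b);
      g \<in> Ob (Hom A b c); x \<in> Ob (F0 F a)\<rbrakk> \<Longrightarrow> dat (T1 \<theta> (a, c, cmp1 A a b c g f)) x
        = cmp (F0 G c) (FA (F1 G b c g) (dat (T1 \<theta> (a, b, f)) x)) (dat (T1 \<theta> (b, c, g)) (FO (F1 F a b f) x))"
    and nat2: "\<And>a b \<gamma> x. \<lbrakk>a \<in> Obj A; b \<in> Obj A; \<gamma> \<in> Ar (Hom A a b); x \<in> Ob (F0 F a)\<rbrakk> \<Longrightarrow>
      cmp (F0 G b) (dat (T1 \<theta> (a, b, tgt (Hom A a b) \<gamma>)) x) (FA (T0 \<theta> b) (dat (F2 F a b \<gamma>) x))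
      = cmp (F0 G b) (dat (F2 G a b \<gamma>) (FO (T0 \<theta> a) x)) (dat (T1 \<theta> (a, b, src (Hom A a b) \<gamma>)) x)"
  shows "oplax_nat A (CAT r) F G \<theta>"
proof -
  interpret F: cat_valued A r F using assms(1) by (simp add: cat_valued_def)
  interpret G: cat_valued A r G using assms(2) by (simp add: cat_valued_def)
  note [simp] = is_functor.FO_Ob [OF fctr] is_functor.FA_Ar [OF fctr] is_functor.FA_src [OF fctr]
    is_functor.FA_tgt [OF fctr] is_functor.FA_ide [OF fctr] is_functor.FA_comp [OF fctr] comp
  have T1: "T1 \<theta> (a, b, f) = (fun_comp (F0 F a) (T0 \<theta> b) (F1 F a b f),
      \<lambda>x\<in>Ob (F0 F a). dat (T1 \<theta> (a, b, f)) x, fun_comp (F0 F a) (F1 G a b f) (T0 \<theta> a))"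
    if "a \<in> Obj A" "b \<in> Obj A" "f \<in> Ob (Hom A a b)" for a b f
    using shape [OF that] by (simp add: prod_eq_iff extensional_restrict)
  note fun_comps = is_functor_comp [OF F.F1_functor fctr] is_functor_comp [OF fctr G.F1_functor]
  have Ar: "T1 \<theta> (a, b, f) \<in> Ar (functor_cat (F0 F a) (F0 G b))"
    if "a \<in> Obj A" "b \<in> Obj A" "f \<in> Ob (Hom A a b)" for a b f
    by (subst T1 [OF that], rule functor_cat_ArI) (use that in \<open>auto simp: nat intro: fun_comps\<close>)
  show ?thesis
  proof (rule oplax_natI, goal_cases)
    case (6 a b f)
    then show ?case using Ar shape by simp
  next
    case (7 a)
    have "T1 \<theta> (a, a, one A a) = ide (functor_cat (F0 F a) (F0 G a)) (T0 \<theta> a)"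
      by (subst T1) (use 7 fctr [of a] in \<open>auto simp: one intro!: restrict_ext\<close>)
    then show ?case by simp
  next
    case (8 a b c f g)
    have "fun_comp (F0 F a) (T0 \<theta> c) (fun_comp (F0 F a) (F1 F b c g) (F1 F a b f))
      = fun_comp (F0 F a) (fun_comp (F0 F b) (T0 \<theta> c) (F1 F b c g)) (F1 F a b f)"
      "fun_comp (F0 F a) (fun_comp (F0 G a) (F1 G b c g) (F1 G a b f)) (T0 \<theta> a)
      = fun_comp (F0 F a) (F1 G b c g) (fun_comp (F0 F a) (F1 G a b f) (T0 \<theta> a))"
      using 8 by (simp_all add: fun_comp_assoc [OF F.F1_functor [of a b f]] fun_comp_assoc [OF fctr [of a]])
    then show ?case
      by (subst T1) (use 8 shape [of a b f] shape [of b c g] in \<open>auto simp: cmp1 intro!: restrict_ext\<close>)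
  next
    case (9 a b \<gamma>)
    then show ?case using shape [of a b "src (Hom A a b) \<gamma>"] shape [of a b "tgt (Hom A a b) \<gamma>"]
      by (auto simp: nat2 intro!: restrict_ext)
  qed (use assms in auto)
qed

locale cat_transf = oplax_nat A "CAT r" F G \<theta>
  for A :: "('o, 'a, 'c) twocat" and r :: "'u rel" and F G and \<theta>
begin

sublocale F: cat_valued A r F ..
sublocale G: cat_valued A r G ..

lemma T0_functor: "a \<in> Obj A \<Longrightarrow> is_functor (F0 F a) (F0 G a) (T0 \<theta> a)"
  using T0_in by simp

lemmas T0_simps [simp] =
  is_functor.FO_Ob [OF T0_functor] is_functor.FA_Ar [OF T0_functor] is_functor.FA_src [OF T0_functor]
  is_functor.FA_tgt [OF T0_functor] is_functor.FA_ide [OF T0_functor] is_functor.FA_comp [OF T0_functor]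
  is_functor.FA_iso [OF T0_functor]

lemma T1_nat_arrow: "\<lbrakk>a \<in> Obj A; b \<in> Obj A; f \<in> Ob (Hom A a b)\<rbrakk> \<Longrightarrow> nat_arrow (F0 F a) (F0 G b) (T1 \<theta> (a, b, f))"
  using T1_Ar by unfold_locales simp

lemma T1_dom_cod [simp]:
  assumes "a \<in> Obj A" "b \<in> Obj A" "f \<in> Ob (Hom A a b)"
  shows "fst (T1 \<theta> (a, b, f)) = fun_comp (F0 F a) (T0 \<theta> b) (F1 F a b f)"
    "cod (T1 \<theta> (a, b, f)) = fun_comp (F0 F a) (F1 G a b f) (T0 \<theta> a)"
  using src_T1 [OF assms] tgt_T1 [OF assms] by simp_all

lemma T1_component [simp]:
  assumes "a \<in> Obj A" "b \<in> Obj A" "f \<in> Ob (Hom A a b)" "x \<in> Ob (F0 F a)"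
  shows "dat (T1 \<theta> (a, b, f)) x \<in> Ar (F0 G b)"
    "src (F0 G b) (dat (T1 \<theta> (a, b, f)) x) = FO (T0 \<theta> b) (FO (F1 F a b f) x)"
    "tgt (F0 G b) (dat (T1 \<theta> (a, b, f)) x) = FO (F1 G a b f) (FO (T0 \<theta> a) x)"
  using assms nat_arrow.in_Ar [OF T1_nat_arrow] nat_arrow.src [OF T1_nat_arrow] nat_arrow.tgt [OF T1_nat_arrow] by auto

lemma T1_component_one:
  assumes "a \<in> Obj A" "x \<in> Ob (F0 F a)"
  shows "dat (T1 \<theta> (a, a, one A a)) x = ide (F0 G a) (FO (T0 \<theta> a) x)"
  using assms by (simp add: T1_one)

lemma T1_component_cmp1:
  assumes "a \<in> Obj A" "b \<in> Obj A" "c \<in> Obj A" "f \<in> Ob (Hom A a b)" "g \<in> Ob (Hom A b c)" "x \<in> Ob (F0 F a)"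
  shows "dat (T1 \<theta> (a, c, cmp1 A a b c g f)) x
    = cmp (F0 G c) (FA (F1 G b c g) (dat (T1 \<theta> (a, b, f)) x)) (dat (T1 \<theta> (b, c, g)) (FO (F1 F a b f) x))"
  using assms by (simp add: T1_comp)

lemma T1_component_nat2:
  assumes "a \<in> Obj A" "b \<in> Obj A" "\<gamma> \<in> Ar (Hom A a b)" "x \<in> Ob (F0 F a)"
  shows "cmp (F0 G b) (dat (T1 \<theta> (a, b, tgt (Hom A a b) \<gamma>)) x) (FA (T0 \<theta> b) (dat (F2 F a b \<gamma>) x))
      = cmp (F0 G b) (dat (F2 G a b \<gamma>) (FO (T0 \<theta> a) x)) (dat (T1 \<theta> (a, b, src (Hom A a b) \<gamma>)) x)"
  using assms arg_cong [OF T1_natural [OF assms(1-3)], of "\<lambda>m. dat m x"] by simp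

end

lemma cat_transf_eqI:
  assumes "oplax_nat A (CAT r) F G \<theta>" "oplax_nat A (CAT r) F G \<theta>'"
    and "\<And>a x. a \<in> Obj A \<Longrightarrow> x \<in> Ob (F0 F a) \<Longrightarrow> FO (T0 \<theta> a) x = FO (T0 \<theta>' a) x"
    and "\<And>a m. a \<in> Obj A \<Longrightarrow> m \<in> Ar (F0 F a) \<Longrightarrow> FA (T0 \<theta> a) m = FA (T0 \<theta>' a) m"
    and "\<And>a b f x. \<lbrakk>a \<in> Obj A; b \<in> Obj A; f \<in> Ob (Hom A a b); x \<in> Ob (F0 F a)\<rbrakk>
      \<Longrightarrow> dat (T1 \<theta> (a, b, f)) x = dat (T1 \<theta>' (a, b, f)) x"
  shows "\<theta> = \<theta>'"
proof (rule transf_eqI [OF assms(1,2)])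
  interpret \<theta>: cat_transf A r F G \<theta> using assms(1) by (simp add: cat_transf_def)
  interpret \<theta>': cat_transf A r F G \<theta>' using assms(2) by (simp add: cat_transf_def)
  show T0: "T0 \<theta> a = T0 \<theta>' a" if "a \<in> Obj A" for a
    by (rule fctr_eqI [OF \<theta>.T0_functor \<theta>'.T0_functor]) (use that assms in auto)
  show "T1 \<theta> (a, b, f) = T1 \<theta>' (a, b, f)" if "a \<in> Obj A" "b \<in> Obj A" "f \<in> Ob (Hom A a b)" for a b f
    by (rule nt_eqI [OF nat_arrow.Ar [OF \<theta>.T1_nat_arrow] nat_arrow.Ar [OF \<theta>'.T1_nat_arrow]])
      (use that assms(5) in \<open>auto simp: T0\<close>)
qed

lemma pseudo_nat_CAT:
  assumes "oplax_nat A (CAT r) F G \<theta>"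
  shows "pseudo_nat A (CAT r) F G \<theta> \<longleftrightarrow> (\<forall>a\<in>Obj A. \<forall>b\<in>Obj A. \<forall>f\<in>Ob (Hom A a b). \<forall>x\<in>Ob (F0 F a).
    iso_arrow (F0 G b) (dat (T1 \<theta> (a, b, f)) x))"
proof -
  interpret \<theta>: cat_transf A r F G \<theta> using assms(1) by (simp add: cat_transf_def)
  show ?thesis
    using iso_functor_cat [OF nat_arrow.Ar [OF \<theta>.T1_nat_arrow]] assms by (simp add: sigma_nat_def)
qed

lemma cat_modif_ArI:
  assumes "sigma_nat A (CAT r) S F G \<theta>" "sigma_nat A (CAT r) S F G \<theta>'" "\<rho> \<in> extensional (Obj A)"
    and shape: "\<And>a. a \<in> Obj A \<Longrightarrow> \<rho> a \<in> Ar (functor_cat (F0 F a) (F0 G a)) \<and>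
      fst (\<rho> a) = T0 \<theta> a \<and> cod (\<rho> a) = T0 \<theta>' a"
    and modif: "\<And>a b f x. \<lbrakk>a \<in> Obj A; b \<in> Obj A; f \<in> Ob (Hom A a b); x \<in> Ob (F0 F a)\<rbrakk> \<Longrightarrow>
      cmp (F0 G b) (FA (F1 G a b f) (dat (\<rho> a) x)) (dat (T1 \<theta> (a, b, f)) x)
      = cmp (F0 G b) (dat (T1 \<theta>' (a, b, f)) x) (dat (\<rho> b) (FO (F1 F a b f) x))"
  shows "(\<theta>, \<rho>, \<theta>') \<in> Ar (sigma_nat_cat A (CAT r) S F G)"
proof (rule sigma_nat_cat_ArI [OF assms(1-3)], goal_cases)
  interpret \<theta>: cat_transf A r F G \<theta> using assms(1) by (simp add: cat_transf_def sigma_nat_def)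
  interpret \<theta>': cat_transf A r F G \<theta>' using assms(2) by (simp add: cat_transf_def sigma_nat_def)
  case H: (2 a b f)
  note nat_arrow.in_Ar [simp] nat_arrow.src [simp] nat_arrow.tgt [simp]
  have "nat_arrow (F0 F a) (F0 G a) (\<rho> a)" "nat_arrow (F0 F b) (F0 G b) (\<rho> b)"
    using shape H by unfold_locales auto
  then show ?case
    using H shape [of a] shape [of b] by (auto simp: modif intro!: restrict_ext)
qed (use shape in auto)

locale cat_modif = modif_arrow A "CAT r" S F G m
  for A :: "('o, 'a, 'c) twocat" and r :: "'u rel" and S F G and m
begin

sublocale dom: cat_transf A r F G "fst m" ..
sublocale cod: cat_transf A r F G "cod m" ..

lemma nat_arrow: "a \<in> Obj A \<Longrightarrow> nat_arrow (F0 F a) (F0 G a) (dat m a)"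
  using in_Ar by unfold_locales simp

lemma dom_cod [simp]:
  assumes "a \<in> Obj A"
  shows "fst (dat m a) = T0 (fst m) a" "cod (dat m a) = T0 (cod m) a"
  using src [OF assms] tgt [OF assms] by auto

lemma component [simp]:
  assumes "a \<in> Obj A" "x \<in> Ob (F0 F a)"
  shows "dat (dat m a) x \<in> Ar (F0 G a)"
    "src (F0 G a) (dat (dat m a) x) = FO (T0 (fst m) a) x"
    "tgt (F0 G a) (dat (dat m a) x) = FO (T0 (cod m) a) x"
  using assms nat_arrow.in_Ar [OF nat_arrow] nat_arrow.src [OF nat_arrow] nat_arrow.tgt [OF nat_arrow] by auto

lemma component_modif:
  assumes "a \<in> Obj A" "b \<in> Obj A" "f \<in> Ob (Hom A a b)" "x \<in> Ob (F0 F a)"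
  shows "cmp (F0 G b) (FA (F1 G a b f) (dat (dat m a) x)) (dat (T1 (fst m) (a, b, f)) x)
      = cmp (F0 G b) (dat (T1 (cod m) (a, b, f)) x) (dat (dat m b) (FO (F1 F a b f) x))"
  using assms arg_cong [OF modif [OF assms(1-3)], of "\<lambda>m. dat m x"] by simp

end

lemma cat_modif_eqI:
  assumes m: "m \<in> Ar (sigma_nat_cat A (CAT r) S F G)" and n: "n \<in> Ar (sigma_nat_cat A (CAT r) S' F G)"
    and "fst m = fst n" "cod m = cod n"
    and "\<And>a x. a \<in> Obj A \<Longrightarrow> x \<in> Ob (F0 F a) \<Longrightarrow> dat (dat m a) x = dat (dat n a) x"
  shows "m = n"
proof (rule modif_eqI [OF m n assms(3,4)])
  interpret m: modif_arrow A "CAT r" S F G m by unfold_locales fact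
  interpret m: cat_modif A r S F G m ..
  interpret n: modif_arrow A "CAT r" S' F G n by unfold_locales fact
  interpret n: cat_modif A r S' F G n ..
  show "dat m a = dat n a" if "a \<in> Obj A" for a
    by (rule nt_eqI [OF nat_arrow.Ar [OF m.nat_arrow] nat_arrow.Ar [OF n.nat_arrow]])
      (use that assms in auto)
qed

text \<open>The inverses of the components satisfy the modification axiom: composed on the left with
  the invertible whiskered component \<open>?x\<close>, it turns into the axiom of
  \<open>m\<close>.\<close>

lemma modif_iso:
  assumes m: "m \<in> Ar (sigma_nat_cat A B S F G)"
    and iso: "\<And>a. a \<in> Obj A \<Longrightarrow> iso_arrow (Hom B (F0 F a) (F0 G a)) (dat m a)"
  shows "iso_arrow (sigma_nat_cat A B S F G) m"
proof -
  interpret m: modif_arrow A B S F G m by unfold_locales fact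
  define n where "n = (cod m, \<lambda>a\<in>Obj A. arr_inv (Hom B (F0 F a) (F0 G a)) (dat m a), fst m)"
  have "n \<in> Ar (sigma_nat_cat A B S F G)" unfolding n_def
  proof (rule sigma_nat_cat_ArI, goal_cases)
    case H: (5 a b f)
    let ?C = "Hom B (F0 F a) (F0 G b)" and ?inv = "\<lambda>a. arr_inv (Hom B (F0 F a) (F0 G a)) (dat m a)"
    interpret C: category ?C using H by simp
    let ?x = "lwhisk B (F0 F a) (F0 G a) (F0 G b) (F1 G a b f) (dat m a)"
      and ?y = "rwhisk B (F0 F a) (F0 F b) (F0 G b) (dat m b) (F1 F a b f)"
    let ?x' = "lwhisk B (F0 F a) (F0 G a) (F0 G b) (F1 G a b f) (?inv a)"
      and ?y' = "rwhisk B (F0 F a) (F0 F b) (F0 G b) (?inv b) (F1 F a b f)"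
    have inv: "cmp ?C ?x ?x' = ide ?C (tgt ?C ?x)" "cmp ?C ?y ?y' = ide ?C (tgt ?C ?y)"
      using H iso [of a] iso [of b] by (simp_all flip: m.dom.F.B.ide_cmp2_cmp m.dom.F.B.cmp_cmp2_ide)
    have "cmp ?C ?x (cmp ?C ?x' (T1 (cod m) (a, b, f))) = cmp ?C ?x (cmp ?C (T1 (fst m) (a, b, f)) ?y')"
      (is "?l = ?r")
    proof -
      have "?r = cmp ?C (cmp ?C ?x (T1 (fst m) (a, b, f))) ?y'"
        using H iso [of b] by simp
      also have "\<dots> = cmp ?C (T1 (cod m) (a, b, f)) (cmp ?C ?y ?y')"
        using H iso [of b] by (subst m.modif) simp_all
      also have "\<dots> = T1 (cod m) (a, b, f)" using H by (simp add: inv)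
      also have "\<dots> = cmp ?C (cmp ?C ?x ?x') (T1 (cod m) (a, b, f))" using H by (simp add: inv)
      also have "\<dots> = ?l" using H iso [of a] by simp
      finally show ?thesis by simp
    qed
    then have "cmp ?C ?x' (T1 (cod m) (a, b, f)) = cmp ?C (T1 (fst m) (a, b, f)) ?y'"
      by (rule C.iso_cancel_left [rotated -1]) (use H iso in simp_all)
    then show ?case using H by simp
  qed (use iso m.dom_nat m.cod_nat in auto)
  then show ?thesis
    by (intro iso_arrowI [where g = n]) (use iso m in \<open>auto simp: n_def intro!: restrict_ext\<close>)
qed


section \<open>Representable 2-functors and the Yoneda embedding\<close>

lemma postcomp_simps [simp]:
  "g \<in> Ob (Hom A X b) \<Longrightarrow> FO (postcomp A X b b' f) g = cmp1 A X b b' f g"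
  "\<alpha> \<in> Ar (Hom A X b) \<Longrightarrow> FA (postcomp A X b b' f) \<alpha> = lwhisk A X b b' f \<alpha>"
  by (simp_all add: postcomp_def)

lemma precomp_simps [simp]:
  "g \<in> Ob (Hom A X b) \<Longrightarrow> FO (precomp A Y X b u) g = cmp1 A Y X b g u"
  "\<alpha> \<in> Ar (Hom A X b) \<Longrightarrow> FA (precomp A Y X b u) \<alpha> = rwhisk A Y X b \<alpha> u"
  by (simp_all add: precomp_def)

lemma representable_simps [simp]:
  "F0 (representable A X) = Hom A X"
  "f \<in> Ob (Hom A b b') \<Longrightarrow> F1 (representable A X) b b' f = postcomp A X b b' f"
  "\<gamma> \<in> Ar (Hom A b b') \<Longrightarrow> F2 (representable A X) b b' \<gamma> = (postcomp A X b b' (src (Hom A b b') \<gamma>),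
     \<lambda>g\<in>Ob (Hom A X b). rwhisk A X b b' \<gamma> g, postcomp A X b b' (tgt (Hom A b b') \<gamma>))"
  by (simp_all add: representable_def F1_def F2_def)

lemma representable_transf_simps [simp]:
  "T0 (representable_transf A Y X u) \<in> extensional (Obj A)"
  "T1 (representable_transf A Y X u) \<in> extensional (cells1 A)"
  "b \<in> Obj A \<Longrightarrow> T0 (representable_transf A Y X u) b = precomp A Y X b u"
  "\<lbrakk>b \<in> Obj A; b' \<in> Obj A; f \<in> Ob (Hom A b b')\<rbrakk> \<Longrightarrow>
    T1 (representable_transf A Y X u) (b, b', f) = ide (functor_cat (Hom A X b) (Hom A Y b'))
        (fun_comp (Hom A X b) (precomp A Y X b' u) (postcomp A X b b' f))"
  by (simp_all add: representable_transf_def cells1_def)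

context two_category
begin

lemma postcomp_functor [simp]:
  assumes "X \<in> Obj A" "b \<in> Obj A" "b' \<in> Obj A" "f \<in> Ob (Hom A b b')"
  shows "is_functor (Hom A X b) (Hom A X b') (postcomp A X b b' f)"
  by (rule is_functorI) (use assms in auto, auto simp: postcomp_def)

lemma precomp_functor [simp]:
  assumes "X \<in> Obj A" "Y \<in> Obj A" "b \<in> Obj A" "u \<in> Ob (Hom A Y X)"
  shows "is_functor (Hom A X b) (Hom A Y b) (precomp A Y X b u)"
  by (rule is_functorI) (use assms in auto, auto simp: precomp_def)

text \<open>Associativity of composition in \<open>A\<close>. It makes precomposition strictly
  natural, which is why \<open>representable_transf\<close> may take identities as structure
  cells.\<close>

lemma precomp_postcomp:
  assumes "X \<in> Obj A" "Y \<in> Obj A" "b \<in> Obj A" "b' \<in> Obj A" "u \<in> Ob (Hom A Y X)" "f \<in> Ob (Hom A b b')"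
  shows "fun_comp (Hom A X b) (precomp A Y X b' u) (postcomp A X b b' f)
    = fun_comp (Hom A X b) (postcomp A Y b b' f) (precomp A Y X b u)"
  by (rule fctr_eqI [OF is_functor_comp [OF postcomp_functor precomp_functor]
        is_functor_comp [OF precomp_functor postcomp_functor]]) (use assms in auto)

end

locale small_twocat =
  fixes r :: "'u rel" and A :: "('u, 'u, 'u) twocat"
  assumes small: "small_two_category r A"
begin

sublocale two_category A
  using small by (simp add: small_two_category_def)

lemma Hom_CAT: "a \<in> Obj A \<Longrightarrow> b \<in> Obj A \<Longrightarrow> Hom A a b \<in> Obj (CAT r)"
  using small by (simp add: small_two_category_def CAT_Obj)

lemma two_functor_representable:
  assumes X: "X \<in> Obj A"
  shows "two_functor A (CAT r) (representable A X)"
proof (rule two_functor_CATI, goal_cases)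
  case (5 a b \<alpha>)
  have "F2 (representable A X) a b \<alpha> \<in> Ar (functor_cat (Hom A X a) (Hom A X b))"
    unfolding representable_simps(3) [OF 5(3)]
    by (rule functor_cat_ArI) (use 5 X in \<open>auto intro!: exchange\<close>)
  then show ?case using 5 by simp
next
  case (3 a b)
  then show ?case by (simp add: representable_def)
next
  case (12 a b c \<alpha> \<beta> x)
  \<comment> \<open>The formula of \<open>CAT\<close> for a horizontal composite places the outer
    cell at the target of the inner one, hence this decomposition.\<close>
  then show ?case using X cmp2_via_tgt [of X b c "rwhisk A X a b \<alpha> x" \<beta>] by simp
qed (use X Hom_CAT two_category_axioms in auto)

lemma pseudo_nat_representable_transf:
  assumes X: "X \<in> Obj A" "Y \<in> Obj A" "u \<in> Ob (Hom A Y X)"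
  shows "pseudo_nat A (CAT r) (representable A X) (representable A Y) (representable_transf A Y X u)"
proof -
  have oplax: "oplax_nat A (CAT r) (representable A X) (representable A Y) (representable_transf A Y X u)"
  proof (rule oplax_nat_CATI, goal_cases)
    case (6 a b f)
    then show ?case using X by (simp add: precomp_postcomp)
  qed (use X in \<open>auto simp: two_functor_representable\<close>)
  then show ?thesis using X by (subst pseudo_nat_CAT) auto
qed

end

lemma yoneda_simps [simp]:
  "F0 (yoneda A) = representable A"
  "u \<in> Ob (Hom A Y X) \<Longrightarrow> F1 (yoneda A) X Y u = representable_transf A Y X u"
  "\<gamma> \<in> Ar (Hom A Y X) \<Longrightarrow> F2 (yoneda A) X Y \<gamma> = (representable_transf A Y X (src (Hom A Y X) \<gamma>),
     \<lambda>b\<in>Obj A. (precomp A Y X b (src (Hom A Y X) \<gamma>),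
        \<lambda>g\<in>Ob (Hom A X b). lwhisk A Y X b g \<gamma>, precomp A Y X b (tgt (Hom A Y X) \<gamma>)),
     representable_transf A Y X (tgt (Hom A Y X) \<gamma>))"
  by (simp_all add: yoneda_def F1_def F2_def)

context small_twocat
begin

lemma two_functor_yoneda: "two_functor (op2 A) (Hom_p A (CAT r)) (yoneda A)"
proof -
  interpret H: two_category "Hom_p A (CAT r)"
    by (rule two_category_Hom_p) (simp_all add: two_category_axioms two_category_CAT)
  let ?S = "all1 A"
  note rt = pseudo_nat_representable_transf
  have oplax: "oplax_nat A (CAT r) (representable A X) (representable A Y) (representable_transf A Y X u)"
    if "X \<in> Obj A" "Y \<in> Obj A" "u \<in> Ob (Hom A Y X)" for X Y u
    using rt [OF that] by (simp add: sigma_nat_def)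
  have Ar: "F2 (yoneda A) X Y \<gamma> \<in> Ar (sigma_nat_cat A (CAT r) ?S (representable A X) (representable A Y))"
    if H: "X \<in> Obj A" "Y \<in> Obj A" "\<gamma> \<in> Ar (Hom A Y X)" for X Y \<gamma>
    unfolding yoneda_simps(3) [OF that(3)]
  proof (rule cat_modif_ArI, goal_cases)
    case (4 b)
    have "(precomp A Y X b (src (Hom A Y X) \<gamma>), \<lambda>g\<in>Ob (Hom A X b). lwhisk A Y X b g \<gamma>,
        precomp A Y X b (tgt (Hom A Y X) \<gamma>)) \<in> Ar (functor_cat (Hom A X b) (Hom A Y b))"
      by (rule functor_cat_ArI) (use 4 H in \<open>auto intro!: exchange [symmetric]\<close>)
    then show ?case using 4 by simp
  qed (use H rt in auto)
  have comp: "representable_transf A Z X (cmp1 A Z Y X f g) = transf_comp A (CAT r) (representable A X) (representable A Y)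
      (representable A Z) (representable_transf A Z Y g) (representable_transf A Y X f)"
    if "X \<in> Obj A" "Y \<in> Obj A" "Z \<in> Obj A" "f \<in> Ob (Hom A Y X)" "g \<in> Ob (Hom A Z Y)" for X Y Z f g
    by (rule cat_transf_eqI [OF oplax oplax_nat_transf_comp [OF oplax oplax]]) (use that in auto)
  show ?thesis
  proof (rule two_functorI, goal_cases)
    case (4 X Y)
    show ?case
    proof (rule is_functorI, goal_cases)
      case (6 \<gamma>)
      then show ?case using 4 Ar [of X Y \<gamma>] by (simp add: F2_def [symmetric] F1_def [symmetric])
    next
      case (7 u)
      then show ?case using 4 by (auto simp: F2_def [symmetric] F1_def [symmetric] intro!: restrict_ext)
    next
      case (8 f g)
      then show ?case using 4 by (auto simp: F2_def [symmetric] F1_def [symmetric] intro!: restrict_ext)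
    qed (use 4 rt [of X Y] in \<open>auto simp: category_sigma_nat_cat F1_def [symmetric], auto simp: yoneda_def\<close>)
  next
    case (5 X)
    have "representable_transf A X X (one A X) = transf_id A (CAT r) (representable A X)"
      by (rule cat_transf_eqI [OF oplax oplax_nat_transf_id]) (use 5 two_functor_representable in auto)
    then show ?case using 5 by simp
  next
    case (6 X Y Z f g)
    then show ?case by (simp add: comp)
  next
    case (7 X Y Z \<alpha> \<beta>)
    let ?l = "F2 (yoneda A) X Z (cmp2 A Z Y X \<alpha> \<beta>)" and ?r = "cmp2 (Hom_p A (CAT r)) (representable A X)
      (representable A Y) (representable A Z) (F2 (yoneda A) Y Z \<beta>) (F2 (yoneda A) X Y \<alpha>)"
    have "?l = ?r"
    proof (rule cat_modif_eqI)
      show "?r \<in> Ar (sigma_nat_cat A (CAT r) ?S (representable A X) (representable A Z))"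
        using H.cmp2_Ar [of "representable A X" "representable A Y" "representable A Z" "F2 (yoneda A) X Y \<alpha>" "F2 (yoneda A) Y Z \<beta>"]
          7 Ar [of X Y \<alpha>] Ar [of Y Z \<beta>] two_functor_representable by (simp del: yoneda_simps Hom_p_simps(5))
      show "?l \<in> Ar (sigma_nat_cat A (CAT r) ?S (representable A X) (representable A Z))"
        using 7 by (intro Ar) auto
      show "fst ?l = fst ?r" "cod ?l = cod ?r"
        using 7 by (simp_all add: comp)
      fix a x assume "a \<in> Obj A" "x \<in> Ob (F0 (representable A X) a)"
      \<comment> \<open>Composition in \<open>op2 A\<close> reverses the factors, so the formula of
        \<open>CAT\<close> now becomes the decomposition of a horizontal composite of
        \<open>A\<close> through the source.\<close>
      moreover from this 7 cmp2_via_src [of Z Y a \<beta> "lwhisk A Y X a x \<alpha>"]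
        cmp2_via_tgt [of Z Y a \<beta> "lwhisk A Y X a x \<alpha>"]
      have "cmp (Hom A Z a) (lwhisk A Z Y a (cmp1 A Y X a x (tgt (Hom A Y X) \<alpha>)) \<beta>)
         (lwhisk A Z X a x (rwhisk A Z Y X \<alpha> (src (Hom A Z Y) \<beta>)))
        = lwhisk A Z X a x (cmp2 A Z Y X \<alpha> \<beta>)"
        by simp
      ultimately show "dat (dat ?l a) x = dat (dat ?r a) x"
        using 7 by simp
    qed
    then show ?case using 7 by simp
  qed (auto simp: two_category_op2 H.two_category_axioms two_functor_representable)
qed

end


section \<open>The 2-category of elements\<close>

lemma El_simps [simp]:
  "X \<in> Obj (El A P) \<longleftrightarrow> snd X \<in> Obj A \<and> fst X \<in> Ob (F0 P (snd X))"
  "u \<in> Ob (Hom (El A P) X Y) \<longleftrightarrow> fst u \<in> Ob (Hom A (snd X) (snd Y)) \<and> snd u \<in> Ar (F0 P (snd Y)) \<and>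
    src (F0 P (snd Y)) (snd u) = FO (F1 P (snd X) (snd Y) (fst u)) (fst X) \<and> tgt (F0 P (snd Y)) (snd u) = fst Y"
  "m \<in> Ar (Hom (El A P) X Y) \<longleftrightarrow> fst m \<in> Ob (Hom (El A P) X Y) \<and> cod m \<in> Ob (Hom (El A P) X Y) \<and>
    dat m \<in> Ar (Hom A (snd X) (snd Y)) \<and> src (Hom A (snd X) (snd Y)) (dat m) = fst (fst m) \<and>
    tgt (Hom A (snd X) (snd Y)) (dat m) = fst (cod m) \<and>
    cmp (F0 P (snd Y)) (snd (cod m)) (dat (F2 P (snd X) (snd Y) (dat m)) (fst X)) = snd (fst m)"
  "src (Hom (El A P) X Y) m = fst m"
  "tgt (Hom (El A P) X Y) m = cod m"
  "ide (Hom (El A P) X Y) u = (u, ide (Hom A (snd X) (snd Y)) (fst u), u)"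
  "cmp (Hom (El A P) X Y) n m = (fst m, cmp (Hom A (snd X) (snd Y)) (dat n) (dat m), cod n)"
  "one (El A P) X = (one A (snd X), ide (F0 P (snd X)) (fst X))"
  "cmp1 (El A P) X Y Z v u = (cmp1 A (snd X) (snd Y) (snd Z) (fst v) (fst u),
    cmp (F0 P (snd Z)) (snd v) (FA (F1 P (snd Y) (snd Z) (fst v)) (snd u)))"
  "cmp2 (El A P) X Y Z n m = (cmp1 (El A P) X Y Z (fst n) (fst m),
    cmp2 A (snd X) (snd Y) (snd Z) (dat n) (dat m), cmp1 (El A P) X Y Z (cod n) (cod m))"
  by (auto simp: El_def in_arrows split: prod.splits)

lemma two_category_El:
  assumes "two_functor A (CAT r) P"
  shows "two_category (El A P)"
proof -
  interpret P: cat_valued A r P using assms by (simp add: cat_valued_def)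
  have hom: "category (Hom (El A P) X Y)" if "X \<in> Obj (El A P)" "Y \<in> Obj (El A P)" for X Y
  proof (unfold_locales, goal_cases)
    case (4 m u v n w)
    \<comment> \<open>The rule \<open>P.cat_simps(11)\<close> is associativity in
      \<open>P b\<close>: it lets the defining equations of the two 2-cells be applied one after the
      other to the image of their vertical composite.\<close>
    then show ?case using that by (auto simp: in_arrows) (metis P.cat_simps(11) P.F2_simps)
  qed (use that in \<open>auto simp: in_arrows prod_eq_iff\<close>)
  show ?thesis
  proof (rule two_category.intro, goal_cases)
    case (4 a b c \<alpha> f f' \<beta> g g')
    let ?a = "snd a" and ?b = "snd b" and ?c = "snd c"
    let ?C = "F0 P ?c"
    let ?Pg = "F1 P ?b ?c (fst g)" and ?Pg' = "F1 P ?b ?c (fst g')"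
    have typing [simp]: "?a \<in> Obj A" "?b \<in> Obj A" "?c \<in> Obj A" "fst a \<in> Ob (F0 P ?a)" "fst b \<in> Ob (F0 P ?b)"
      "dat \<alpha> \<in> Ar (Hom A ?a ?b)" "dat \<beta> \<in> Ar (Hom A ?b ?c)"
      "src (Hom A ?a ?b) (dat \<alpha>) = fst f" "tgt (Hom A ?a ?b) (dat \<alpha>) = fst f'"
      "src (Hom A ?b ?c) (dat \<beta>) = fst g" "tgt (Hom A ?b ?c) (dat \<beta>) = fst g'"
      "fst f \<in> Ob (Hom A ?a ?b)" "fst f' \<in> Ob (Hom A ?a ?b)" "fst g \<in> Ob (Hom A ?b ?c)" "fst g' \<in> Ob (Hom A ?b ?c)"
      "snd f' \<in> Ar (F0 P ?b)" "src (F0 P ?b) (snd f') = FO (F1 P ?a ?b (fst f')) (fst a)" "tgt (F0 P ?b) (snd f') = fst b"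
      "snd g' \<in> Ar ?C" "src ?C (snd g') = FO (F1 P ?b ?c (fst g')) (fst b)" "tgt ?C (snd g') = fst c" "fst c \<in> Ob ?C"
      "snd f \<in> Ar (F0 P ?b)" "src (F0 P ?b) (snd f) = FO (F1 P ?a ?b (fst f)) (fst a)" "tgt (F0 P ?b) (snd f) = fst b"
      "snd g \<in> Ar ?C" "src ?C (snd g) = FO (F1 P ?b ?c (fst g)) (fst b)" "tgt ?C (snd g) = fst c"
      "fst \<alpha> = f" "cod \<alpha> = f'" "fst \<beta> = g" "cod \<beta> = g'"
      using 4 by (auto simp: in_arrows)
    have e: "cmp ?C (snd g') (dat (F2 P ?b ?c (dat \<beta>)) (fst b)) = snd g"
      "cmp (F0 P ?b) (snd f') (dat (F2 P ?a ?b (dat \<alpha>)) (fst a)) = snd f"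
      using 4 by (auto simp: in_arrows)
    \<comment> \<open>The component of P at the horizontal composite has two factors. Naturality of
      P \<beta> at \<open>snd f'\<close> separates them, so that the defining equations
      \<open>e\<close> of \<beta> and \<alpha> apply in turn.\<close>
    have "cmp ?C (snd g') (cmp ?C (FA ?Pg' (snd f')) (cmp ?C (dat (F2 P ?b ?c (dat \<beta>)) (FO (F1 P ?a ?b (fst f')) (fst a)))
        (FA ?Pg (dat (F2 P ?a ?b (dat \<alpha>)) (fst a)))))
      = cmp ?C (snd g') (cmp ?C (cmp ?C (FA ?Pg' (snd f')) (dat (F2 P ?b ?c (dat \<beta>)) (FO (F1 P ?a ?b (fst f')) (fst a))))
        (FA ?Pg (dat (F2 P ?a ?b (dat \<alpha>)) (fst a))))"
      by simp
    also have "\<dots> = cmp ?C (snd g') (cmp ?C (cmp ?C (dat (F2 P ?b ?c (dat \<beta>)) (fst b)) (FA ?Pg (snd f')))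
        (FA ?Pg (dat (F2 P ?a ?b (dat \<alpha>)) (fst a))))"
      using P.F2_natural [of ?b ?c "dat \<beta>" "snd f'"] by simp
    also have "\<dots> = cmp ?C (cmp ?C (snd g') (dat (F2 P ?b ?c (dat \<beta>)) (fst b)))
        (FA ?Pg (cmp (F0 P ?b) (snd f') (dat (F2 P ?a ?b (dat \<alpha>)) (fst a))))"
      by simp
    also have "\<dots> = cmp ?C (snd g) (FA ?Pg (snd f))"
      by (simp add: e)
    finally show ?case by (simp add: in_arrows)
  qed (use hom in \<open>auto simp: in_arrows prod_eq_iff intro!: P.A.cmp2_cmp\<close>)
qed

lemma El_proj_simps [simp]:
  "F0 (El_proj A P) X = snd X"
  "u \<in> Ob (Hom (El A P) X Y) \<Longrightarrow> F1 (El_proj A P) X Y u = fst u"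
  "m \<in> Ar (Hom (El A P) X Y) \<Longrightarrow> F2 (El_proj A P) X Y m = dat m"
  by (auto simp: El_proj_def F1_def F2_def split: prod.splits)

lemma two_functor_El_proj:
  assumes "two_functor A (CAT r) P"
  shows "two_functor (El A P) A (El_proj A P)"
proof -
  interpret P: cat_valued A r P using assms by (simp add: cat_valued_def)
  interpret E: two_category "El A P" using assms by (rule two_category_El)
  show ?thesis
  proof (rule two_functorI, goal_cases)
    case (4 X Y)
    note XY = 4
    show ?case
    proof (rule is_functorI, goal_cases)
      case 1
      then show ?case using XY by (rule E.Hom_category)
    next
      case 3
      then show ?case by (simp add: El_proj_def)
    next
      case 4
      then show ?case by (simp add: El_proj_def)
    next
      case 2
      then show ?case using XY by simp
    next
      case (5 u)
      then show ?case using XY by (simp flip: F1_def)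
    next
      case (6 m)
      then have "fst m \<in> Ob (Hom (El A P) X Y)" "cod m \<in> Ob (Hom (El A P) X Y)" by simp_all
      with 6 XY show ?case by (simp flip: F1_def F2_def)
    next
      case (7 u)
      then have "ide (Hom (El A P) X Y) u \<in> Ar (Hom (El A P) X Y)" using XY E.hom_simps(3) by blast
      with 7 show ?case by (simp flip: F1_def F2_def del: El_simps(2,3))
    next
      case (8 m n)
      then have "cmp (Hom (El A P) X Y) n m \<in> Ar (Hom (El A P) X Y)" using XY E.hom_simps(6) by blast
      with 8 show ?case by (simp flip: F1_def F2_def del: El_simps(2,3))
    qed
  next
    case (5 X)
    then show ?case using E.one_in [of X] by (simp del: El_simps(2))
  next
    case (6 X Y Z u v)
    then show ?case using E.cmp1_in [of X Y Z u v] by (simp del: El_simps(2))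
  next
    case (7 X Y Z m n)
    then show ?case using E.cmp2_Ar [of X Y Z m n] by (simp del: El_simps(2,3))
  qed (use E.two_category_axioms P.A.two_category_axioms in simp_all)
qed

text \<open>An arrow X \<rightarrow> Y of the indexing 2-category is an arrow of elements u : Y
  \<rightarrow> X; the diagram sends it to precomposition with the underlying 1-cell of u.\<close>

lemma El_diagram_simps [simp]:
  "F0 (El_diagram A P) X = representable A (snd X)"
  "u \<in> Ob (Hom (El A P) Y X) \<Longrightarrow> F1 (El_diagram A P) X Y u = representable_transf A (snd Y) (snd X) (fst u)"
  "m \<in> Ar (Hom (El A P) Y X) \<Longrightarrow> F2 (El_diagram A P) X Y m = F2 (yoneda A) (snd X) (snd Y) (dat m)"
  by (auto simp: El_diagram_def simp del: yoneda_simps(3))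

lemma (in small_twocat) two_functor_El_diagram:
  assumes "two_functor A (CAT r) P"
  shows "two_functor (op2 (El A P)) (Hom_p A (CAT r)) (El_diagram A P)"
  unfolding El_diagram_def
  using two_functor_comp [OF two_functor.two_functor_op [OF two_functor_El_proj [OF assms]] two_functor_yoneda] .


section \<open>Conical \<open>\<sigma>\<close>-colimits\<close>

text \<open>The inverse bijections form a functor: injectivity of \<open>F\<close> on objects
  reflects composability, so a composable pair in \<open>D\<close> comes from a composable pair in
  \<open>C\<close>.\<close>

lemma cat_isomorphismI:
  assumes F: "is_functor C D F" and FO: "bij_betw (FO F) (Ob C) (Ob D)" and FA: "bij_betw (FA F) (Ar C) (Ar D)"
  shows "cat_isomorphism C D F"
proof -
  interpret F: is_functor C D F by fact
  define G where "G = \<lparr>FO = (\<lambda>y\<in>Ob D. the_inv_into (Ob C) (FO F) y), FA = (\<lambda>g\<in>Ar D. the_inv_into (Ar C) (FA F) g)\<rparr>"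
  note inj = bij_betw_imp_inj_on [OF FO] bij_betw_imp_inj_on [OF FA]
  note surj = bij_betw_imp_surj_on [OF FO] bij_betw_imp_surj_on [OF FA]
  have GO: "FO G (FO F x) = x" if "x \<in> Ob C" for x
    using that inj(1) by (simp add: G_def the_inv_into_f_f)
  have GA: "FA G (FA F f) = f" if "f \<in> Ar C" for f
    using that inj(2) by (simp add: G_def the_inv_into_f_f)
  have ob: "\<exists>x\<in>Ob C. y = FO F x" if "y \<in> Ob D" for y using that surj(1) by blast
  have ar: "\<exists>f\<in>Ar C. g = FA F f" if "g \<in> Ar D" for g using that surj(2) by blast
  have G: "is_functor D C G"
  proof (rule is_functorI, goal_cases)
    case (5 y)
    then show ?case using ob [OF 5] by (auto simp: GO)
  next
    case (6 g)
    then show ?case using ar [OF 6] by (auto simp: GO GA)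
  next
    case (7 y)
    then obtain x where x: "x \<in> Ob C" "y = FO F x" using ob by blast
    then show ?case using GA [of "ide C x"] by (simp add: GO)
  next
    case (8 f g)
    then obtain f' g' where H: "f' \<in> Ar C" "f = FA F f'" "g' \<in> Ar C" "g = FA F g'" using ar by meson
    then have "FO F (src C g') = FO F (tgt C f')" using 8 by simp
    then have "src C g' = tgt C f'" using H by (metis GO F.C.src_in F.C.tgt_in)
    then show ?case using H GA [of "cmp C g' f'"] by (simp add: GA)
  qed (auto simp: G_def F.C.category_axioms F.D.category_axioms)
  moreover have "fun_comp C G F = fun_id C"
    by (rule fctr_eqI [OF is_functor_comp [OF F G] is_functor_id]) (simp_all add: GO GA F.C.category_axioms)
  moreover have "fun_comp D F G = fun_id D"
    by (rule fctr_eqI [OF is_functor_comp [OF G F] is_functor_id])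
      (auto simp: GO GA F.D.category_axioms dest!: ob ar)
  ultimately show ?thesis using F by (auto simp: cat_isomorphism_def)
qed

lemma cat_isomorphism_FO_bij:
  assumes "cat_isomorphism C D F"
  shows "bij_betw (FO F) (Ob C) (Ob D)"
proof -
  obtain G where G: "is_functor C D F" "is_functor D C G" "fun_comp C G F = fun_id C" "fun_comp D F G = fun_id D"
    using assms by (auto simp: cat_isomorphism_def)
  interpret F: is_functor C D F by fact
  interpret G: is_functor D C G by fact
  have "FO G (FO F x) = x" if "x \<in> Ob C" for x
    using that arg_cong [OF G(3), of "\<lambda>H. FO H x"] by simp
  moreover have "FO F (FO G y) = y" if "y \<in> Ob D" for y
    using that arg_cong [OF G(4), of "\<lambda>H. FO H y"] by simp
  ultimately show ?thesis by (intro bij_betw_byWitness [where f' = "FO G"]) auto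
qed

lemma cone_comp_simps [simp]:
  "T0 (cone_comp I B F L E l t) \<in> extensional (Obj I)"
  "T1 (cone_comp I B F L E l t) \<in> extensional (cells1 I)"
  "i \<in> Obj I \<Longrightarrow> T0 (cone_comp I B F L E l t) i = cmp1 B (F0 F i) L E t (T0 l i)"
  "\<lbrakk>i \<in> Obj I; j \<in> Obj I; u \<in> Ob (Hom I i j)\<rbrakk> \<Longrightarrow>
    T1 (cone_comp I B F L E l t) (i, j, u) = lwhisk B (F0 F i) L E t (T1 l (i, j, u))"
  by (simp_all add: cone_comp_def cells1_def)

text \<open>A cone without universality. It covers both the explicit cone, before its universal
  property is known, and the cones of arbitrary colimits.\<close>

locale sigma_cone =
  fixes I :: "('o, 'a, 'c) twocat" and B :: "('p, 'b, 'd) twocat" and S F L l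
  assumes cone: "sigma_nat I B S F (const2 I B L) l"
    and S: "wide_subcat I S" and L: "L \<in> Obj B"
begin

sublocale oplax_nat I B F "const2 I B L" l
  using cone by (simp add: sigma_nat_def)

lemma cone_comp_cone:
  assumes E: "E \<in> Obj B" "t \<in> Ob (Hom B L E)"
  shows "sigma_nat I B S F (const2 I B E) (cone_comp I B F L E l t)"
  unfolding sigma_nat_def
proof (safe, goal_cases)
  note [simp] = L E T0_in [unfolded const2_simps] T1_Ar [unfolded const2_simps]
    src_T1 [unfolded const2_simps] tgt_T1 [unfolded const2_simps]
  {
    case 1
    show ?case
    proof (rule oplax_natI, goal_cases)
      case 2
      then show ?case by (rule two_functor_const2) (simp_all add: F.A.two_category_axioms F.B.two_category_axioms)
    next
      case (7 i)
      then show ?case using T1_one by simp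
    next
      case (8 i j k u v)
      then show ?case using T1_comp [of i j k u v] by simp
    next
      case (9 i j \<gamma>)
      then show ?case
        using arg_cong [OF T1_natural [OF 9], of "cmp2 B (F0 F i) L E (ide (Hom B L E) t)"] by simp
    qed (auto simp: F.two_functor_axioms)
  next
    case (2 i j u)
    then have "u \<in> Ob (Hom I i j)" using S by (auto simp: wide_subcat_def)
    then show ?case using cone 2 by (simp add: sigma_nat_def)
  }
qed

text \<open>With \<open>cone_comp_one\<close> this makes 1-cells act on cones, so that comparison
  arrows between colimits can be composed within the universal property.\<close>

lemma cone_comp_comp:
  assumes E: "E \<in> Obj B" "t \<in> Ob (Hom B L E)" "K \<in> Obj B" "s \<in> Ob (Hom B E K)"
  shows "cone_comp I B F E K (cone_comp I B F L E l t) s = cone_comp I B F L K l (cmp1 B L E K s t)"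
proof -
  note [simp] = L E T0_in [unfolded const2_simps] T1_Ar [unfolded const2_simps]
  show ?thesis by (auto simp: cone_comp_def cells1_def intro!: restrict_ext)
qed

lemma cone_comp_one: "cone_comp I B F L L l (one B L) = l"
proof -
  note [simp] = L T0_in [unfolded const2_simps] T1_Ar [unfolded const2_simps]
    src_T1 [unfolded const2_simps] tgt_T1 [unfolded const2_simps]
  have "T0 (cone_comp I B F L L l (one B L)) = T0 l"
    by (rule extensionalityI [OF cone_comp_simps(1) T0_ext]) auto
  moreover have "T1 (cone_comp I B F L L l (one B L)) = T1 l"
    by (rule extensionalityI [OF cone_comp_simps(2) T1_ext]) (auto simp: cells1_def)
  ultimately show ?thesis by simp
qed

text \<open>That \<beta> whiskered by the components of the cone is a modification is the exchange
  law for \<beta> and the structure cells of \<open>l\<close>.\<close>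

lemma precomposition_functor:
  assumes E: "E \<in> Obj B"
  shows "is_functor (Hom B L E) (sigma_cones I B S F E) (precomposition I B F L E l)"
proof -
  note [simp] = L E T0_in [unfolded const2_simps] T1_Ar [unfolded const2_simps]
    src_T1 [unfolded const2_simps] tgt_T1 [unfolded const2_simps]
  have Ar: "(cone_comp I B F L E l (src (Hom B L E) \<beta>),
      \<lambda>i\<in>Obj I. rwhisk B (F0 F i) L E \<beta> (T0 l i),
      cone_comp I B F L E l (tgt (Hom B L E) \<beta>)) \<in> Ar (sigma_nat_cat I B S F (const2 I B E))"
    if "\<beta> \<in> Ar (Hom B L E)" for \<beta>
  proof (rule sigma_nat_cat_ArI, goal_cases)
    case (5 i j u)
    then show ?case using that
        F.B.exchange [of "F0 F i" L E "T1 l (i, j, u)" \<beta>, OF _ _ _ _ _ refl refl refl refl] by simp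
  qed (use that in \<open>auto intro!: cone_comp_cone\<close>)
  show ?thesis unfolding sigma_cones_def
  proof (rule is_functorI, goal_cases)
    case (6 \<beta>)
    then show ?case using Ar [OF 6] by (simp add: precomposition_def)
  qed (auto simp: precomposition_def category_sigma_nat_cat intro!: cone_comp_cone restrict_ext)
qed

end

section \<open>Uniqueness of \<sigma>-colimits and transport of equivalences\<close>

lemma sigma_colimit_cone:
  assumes "sigma_colimit I B S F L l"
  shows "sigma_cone I B S F L l"
  using assms by unfold_locales (auto simp: sigma_colimit_def sigma_cones_def)

text \<open>The one-dimensional universal property, from which uniqueness up to isomorphism is
  derived.\<close>

lemma sigma_colimit_bij:
  assumes "sigma_colimit I B S F L l" "E \<in> Obj B"
  shows "bij_betw (cone_comp I B F L E l) (Ob (Hom B L E)) {\<theta>. sigma_nat I B S F (const2 I B E) \<theta>}"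
proof -
  have "bij_betw (FO (precomposition I B F L E l)) (Ob (Hom B L E)) (Ob (sigma_cones I B S F E))"
    using assms by (intro cat_isomorphism_FO_bij) (simp add: sigma_colimit_def)
  then show ?thesis
    by (subst bij_betw_cong [where g = "FO (precomposition I B F L E l)"])
      (simp_all add: precomposition_def sigma_cones_def)
qed

text \<open>Each colimit cone factors through the other. Both composites of the comparison arrows
  fix a colimit cone, as do the identities, and factorisations are unique.\<close>

lemma sigma_colimit_unique:
  assumes colim: "sigma_colimit I B S F L l" "sigma_colimit I B S F L' l'"
  obtains t t' where "t \<in> Ob (Hom B L L')" "t' \<in> Ob (Hom B L' L)"
    "cmp1 B L L' L t' t = one B L" "cmp1 B L' L L' t t' = one B L'"
proof -
  interpret l: sigma_cone I B S F L l using colim by (simp add: sigma_colimit_cone)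
  interpret l': sigma_cone I B S F L' l' using colim by (simp add: sigma_colimit_cone)
  have "l' \<in> cone_comp I B F L L' l ` Ob (Hom B L L')" "l \<in> cone_comp I B F L' L l' ` Ob (Hom B L' L)"
    using bij_betw_imp_surj_on [OF sigma_colimit_bij [OF colim(1) l'.L]] l'.cone
      bij_betw_imp_surj_on [OF sigma_colimit_bij [OF colim(2) l.L]] l.cone by simp_all
  then obtain t t' where t: "t \<in> Ob (Hom B L L')" "l' = cone_comp I B F L L' l t"
    and t': "t' \<in> Ob (Hom B L' L)" "l = cone_comp I B F L' L l' t'" by (elim imageE)
  note tt' = t(2) [symmetric] t'(2) [symmetric]
  have "cone_comp I B F L L l (cmp1 B L L' L t' t) = cone_comp I B F L L l (one B L)"
    using t(1) t'(1) tt' l.cone_comp_comp [of L' t L t'] by (simp add: l.L l'.L l.cone_comp_one)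
  then have "cmp1 B L L' L t' t = one B L"
    by (rule inj_onD [OF bij_betw_imp_inj_on [OF sigma_colimit_bij [OF colim(1) l.L]]]) (simp_all add: t(1) t'(1) l.L l'.L)
  moreover have "cone_comp I B F L' L' l' (cmp1 B L' L L' t t') = cone_comp I B F L' L' l' (one B L')"
    using t(1) t'(1) tt' l'.cone_comp_comp [of L t' L' t] by (simp add: l.L l'.L l'.cone_comp_one)
  then have "cmp1 B L' L L' t t' = one B L'"
    by (rule inj_onD [OF bij_betw_imp_inj_on [OF sigma_colimit_bij [OF colim(2) l'.L]]]) (simp_all add: t(1) t'(1) l.L l'.L)
  ultimately show ?thesis using that t t' by blast
qed

text \<open>On the side of \<open>X\<close> the pair \<open>t\<close>, \<open>t'\<close> cancels and
  the composite stays equal to \<open>g f\<close>; on the other side the invertible cell \<alpha> is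
  whiskered by \<open>t\<close> and \<open>t'\<close> and then ends at
  \<open>t t' = 1\<close>.\<close>

lemma (in two_category) equivalent_in_iso:
  assumes "equivalent_in A X Y" "Y' \<in> Obj A" "t \<in> Ob (Hom A Y Y')" "t' \<in> Ob (Hom A Y' Y)"
    and t't: "cmp1 A Y Y' Y t' t = one A Y" and tt': "cmp1 A Y' Y Y' t t' = one A Y'"
  shows "equivalent_in A X Y'"
proof -
  obtain f g where f: "f \<in> Ob (Hom A X Y)" and g: "g \<in> Ob (Hom A Y X)" and XY: "X \<in> Obj A" "Y \<in> Obj A"
    and gf: "isomorphic (Hom A X X) (cmp1 A X Y X g f) (one A X)"
    and fg: "isomorphic (Hom A Y Y) (cmp1 A Y X Y f g) (one A Y)"
    using assms(1) by (auto simp: equivalent_in_def)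
  note [simp] = f g XY assms(2-4)
  have "cmp1 A X Y' X (cmp1 A Y' Y X g t') (cmp1 A X Y Y' t f) = cmp1 A X Y X g f"
  proof -
    have "cmp1 A X Y' X (cmp1 A Y' Y X g t') (cmp1 A X Y Y' t f) = cmp1 A X Y X g (cmp1 A X Y Y (cmp1 A Y Y' Y t' t) f)"
      by (simp del: t't)
    then show ?thesis by (simp add: t't)
  qed
  moreover have "isomorphic (Hom A Y' Y') (cmp1 A Y' X Y' (cmp1 A X Y Y' t f) (cmp1 A Y' Y X g t')) (one A Y')"
  proof -
    obtain \<alpha> where \<alpha>: "\<alpha> \<in> Ar (Hom A Y Y)" "src (Hom A Y Y) \<alpha> = cmp1 A Y X Y f g" "tgt (Hom A Y Y) \<alpha> = one A Y"
      "iso_arrow (Hom A Y Y) \<alpha>"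
      using fg by (auto simp: isomorphic_def in_arrows)
    then show ?thesis unfolding isomorphic_def
      by (intro bexI [of _ "lwhisk A Y' Y Y' t (rwhisk A Y' Y Y \<alpha> t')"])
        (simp_all add: in_arrows tt')
  qed
  ultimately show ?thesis using gf unfolding equivalent_in_def
    by (intro conjI bexI [of _ "cmp1 A X Y Y' t f"] bexI [of _ "cmp1 A Y' Y X g t'"]) simp_all
qed


section \<open>The explicit colimit\<close>

text \<open>The encoding \<open>e\<close> serves both for the objects \<open>(x, a, g)\<close>, with \<open>x \<in> P a\<close> and \<open>g : a \<rightarrow> b\<close>, and
  for the arrows \<open>(p, m, q)\<close>, with \<open>m : P g x \<rightarrow> P g' x'\<close>, of the value of the colimit at \<open>b\<close>.\<close>

locale elements = small_twocat r A + P: cat_valued A r P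
  for r :: "'u rel" and A :: "('u, 'u, 'u) twocat" and P :: "'u cat_valued" +
  fixes e :: "'u \<times> 'u \<times> 'u \<Rightarrow> 'u"
  assumes inj_e: "inj e" and card: "Cinfinite r" "regularCard r"
begin

abbreviation "El_P \<equiv> El A P"

abbreviation "Diag \<equiv> El_diagram A P"

abbreviation "Cart \<equiv> cart_arrows_op A P"

abbreviation rep where
  "rep X \<equiv> representable A (snd X)"

abbreviation rep_T where
  "rep_T X Y u \<equiv> representable_transf A (snd Y) (snd X) (fst u)"

abbreviation d :: "'u \<Rightarrow> 'u \<times> 'u \<times> 'u" where
  "d \<equiv> inv e"

lemma d_e [simp]: "d (e z) = z"
  using inj_e by (rule inv_f_f)

lemma e_eq [simp]: "e z = e z' \<longleftrightarrow> z = z'"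
  using inj_e by (auto dest: injD)

lemma e_d: "p \<in> range e \<Longrightarrow> e (d p) = p"
  by auto

section \<open>Nodes and the values of the colimit\<close>

abbreviation elt where
  "elt p \<equiv> fst (d p)"

abbreviation base where
  "base p \<equiv> dat (d p)"

abbreviation leg where
  "leg p \<equiv> cod (d p)"

text \<open>The restriction to \<open>range e\<close> guarantees \<open>e (d p) = p\<close>, so that
  a node is determined by its three projections; outside that range \<open>d\<close> is
  arbitrary.\<close>

definition nodes :: "'u \<Rightarrow> 'u set" where
  "nodes b = {p \<in> range e. base p \<in> Obj A \<and> elt p \<in> Ob (F0 P (base p)) \<and> leg p \<in> Ob (Hom A (base p) b)}"

definition pt :: "'u \<Rightarrow> 'u \<Rightarrow> 'u" where
  "pt b p = FO (F1 P (base p) b (leg p)) (elt p)"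

lemma e_nodes [simp]:
  "e (x, a, g) \<in> nodes b \<longleftrightarrow> a \<in> Obj A \<and> x \<in> Ob (F0 P a) \<and> g \<in> Ob (Hom A a b)"
  by (simp add: nodes_def)

lemma nodesD [simp]:
  assumes "p \<in> nodes b"
  shows "base p \<in> Obj A" "elt p \<in> Ob (F0 P (base p))" "leg p \<in> Ob (Hom A (base p) b)"
    "e (d p) = p"
  using assms by (simp_all add: nodes_def e_d)

lemma pt_Ob [simp]: "b \<in> Obj A \<Longrightarrow> p \<in> nodes b \<Longrightarrow> pt b p \<in> Ob (F0 P b)"
  by (simp add: pt_def)

lemma pt_e [simp]: "pt b (e (x, a, g)) = FO (F1 P a b g) x"
  by (simp add: pt_def)

text \<open>The full image of \<open>pt b\<close>: homs are borrowed from P b, which makes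
  \<open>pt b\<close> fully faithful by construction. Arrows carry their ends because one arrow of P
  b may join many pairs of nodes.\<close>

definition Lcat :: "'u \<Rightarrow> ('u, 'u) cat" where
  "Lcat b = \<lparr>Ob = nodes b,
     Ar = e ` {z. fst z \<in> nodes b \<and> cod z \<in> nodes b \<and> dat z \<in> arrows (F0 P b) (pt b (fst z)) (pt b (cod z))},
     src = (\<lambda>m. fst (d m)), tgt = (\<lambda>m. cod (d m)),
     ide = (\<lambda>p. e (p, ide (F0 P b) (pt b p), p)),
     cmp = (\<lambda>n m. e (fst (d m), cmp (F0 P b) (dat (d n)) (dat (d m)), cod (d n)))\<rparr>"

lemma Lcat_simps [simp]:
  "Ob (Lcat b) = nodes b" "src (Lcat b) m = fst (d m)" "tgt (Lcat b) m = cod (d m)"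
  "ide (Lcat b) p = e (p, ide (F0 P b) (pt b p), p)"
  "cmp (Lcat b) n m = e (fst (d m), cmp (F0 P b) (dat (d n)) (dat (d m)), cod (d n))"
  by (simp_all add: Lcat_def)

lemma e_Lcat_Ar [simp]: "e (p, m, q) \<in> Ar (Lcat b) \<longleftrightarrow> p \<in> nodes b \<and> q \<in> nodes b \<and> m \<in> Ar (F0 P b) \<and>
    src (F0 P b) m = pt b p \<and> tgt (F0 P b) m = pt b q"
  by (auto simp: Lcat_def in_arrows image_iff)

lemma Lcat_ArD [simp]:
  assumes "m \<in> Ar (Lcat b)"
  shows "fst (d m) \<in> nodes b" "cod (d m) \<in> nodes b" "dat (d m) \<in> Ar (F0 P b)"
    "src (F0 P b) (dat (d m)) = pt b (fst (d m))" "tgt (F0 P b) (dat (d m)) = pt b (cod (d m))"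
    "e (d m) = m"
  using assms by (auto simp: Lcat_def in_arrows)

lemma category_Lcat:
  assumes b: "b \<in> Obj A"
  shows "category (Lcat b)"
proof (rule category.intro, goal_cases)
  case (4 f x y g z)
  then show ?case using b by (auto simp: in_arrows)
qed (use b in \<open>auto simp: in_arrows\<close>)

lemma iso_Lcat:
  assumes b: "b \<in> Obj A" and m: "m \<in> Ar (Lcat b)" "iso_arrow (F0 P b) (dat (d m))"
  shows "iso_arrow (Lcat b) m"
  using assms
  by (intro iso_arrowI [where g = "e (cod (d m), arr_inv (F0 P b) (dat (d m)), fst (d m))"]) simp_all

text \<open>Regularity of \<open>r\<close> enters as stability: a sum of fewer than \<open>r\<close>
  sets, each of size less than \<open>r\<close>, has size less than \<open>r\<close>. The nodes are
  covered by such a sum over the objects of \<open>A\<close>, and the arrows by one over pairs of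
  nodes.\<close>

lemma Lcat_small:
  assumes b: "b \<in> Obj A"
  shows "Lcat b \<in> Obj (CAT r)"
proof -
  have st: "stable r"
    using card by (intro regularCard_stable) (auto simp: cinfinite_def)
  have sz: "|Obj A| <o r" "\<And>a. a \<in> Obj A \<Longrightarrow> |Ob (Hom A a b)| <o r"
    using small b by (auto simp: small_two_category_def)
  have P: "|Ob (F0 P a)| <o r" "|Ar (F0 P a)| <o r" if "a \<in> Obj A" for a
    using P.F0_in [OF that] by (auto simp: CAT_Obj)
  have ob: "|nodes b| <o r"
  proof -
    have "|SIGMA a:Obj A. SIGMA x:Ob (F0 P a). Ob (Hom A a b)| <o r"
      by (intro stable_elim [OF st] sz P) auto
    moreover have "nodes b \<subseteq> (\<lambda>(a, x, g). e (x, a, g)) ` (SIGMA a:Obj A. SIGMA x:Ob (F0 P a). Ob (Hom A a b))"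
    proof
      fix p assume "p \<in> nodes b"
      then show "p \<in> (\<lambda>(a, x, g). e (x, a, g)) ` (SIGMA a:Obj A. SIGMA x:Ob (F0 P a). Ob (Hom A a b))"
        by (intro image_eqI [where x = "(base p, elt p, leg p)"]) simp_all
    qed
    ultimately show ?thesis
      by (meson card_of_image card_of_mono1 ordLeq_ordLess_trans)
  qed
  have "|SIGMA p:nodes b. SIGMA m:Ar (F0 P b). nodes b| <o r"
    by (intro stable_elim [OF st] ob P b)
  moreover have "Ar (Lcat b) \<subseteq> e ` (SIGMA p:nodes b. SIGMA m:Ar (F0 P b). nodes b)"
    by (auto simp: Lcat_def in_arrows)
  ultimately have "|Ar (Lcat b)| <o r"
    by (meson card_of_image card_of_mono1 ordLeq_ordLess_trans)
  then show ?thesis using ob category_Lcat [OF b] by (simp add: CAT_Obj)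
qed

definition push :: "'u \<Rightarrow> 'u \<Rightarrow> 'u \<Rightarrow> 'u \<Rightarrow> 'u" where
  "push b b' f p = e (elt p, base p, cmp1 A (base p) b b' f (leg p))"

lemma push_nodes [simp]:
  "\<lbrakk>b \<in> Obj A; b' \<in> Obj A; f \<in> Ob (Hom A b b'); p \<in> nodes b\<rbrakk> \<Longrightarrow> push b b' f p \<in> nodes b'"
  by (simp add: push_def)

text \<open>Strict functoriality of P on 1-cells. It allows \<open>Lfun\<close> to act on arrows by
  P f, and it makes the comparison with \<open>P\<close> given by \<open>pt\<close> strictly
  natural.\<close>

lemma pt_push [simp]:
  "\<lbrakk>b \<in> Obj A; b' \<in> Obj A; f \<in> Ob (Hom A b b'); p \<in> nodes b\<rbrakk>
    \<Longrightarrow> pt b' (push b b' f p) = FO (F1 P b b' f) (pt b p)"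
  by (simp add: push_def pt_def)

lemma push_one [simp]: "b \<in> Obj A \<Longrightarrow> p \<in> nodes b \<Longrightarrow> push b b (one A b) p = p"
  by (simp add: push_def)

lemma push_cmp1 [simp]:
  "\<lbrakk>a \<in> Obj A; b \<in> Obj A; c \<in> Obj A; f \<in> Ob (Hom A a b); g \<in> Ob (Hom A b c); p \<in> nodes a\<rbrakk>
    \<Longrightarrow> push a c (cmp1 A a b c g f) p = push b c g (push a b f p)"
  by (simp add: push_def)

lemma push_e [simp]: "push b b' f (e (x, a, g)) = e (x, a, cmp1 A a b b' f g)"
  by (simp add: push_def)

definition Lfun :: "'u \<Rightarrow> 'u \<Rightarrow> 'u \<Rightarrow> ('u, 'u, 'u, 'u) fctr" where
  "Lfun b b' f = \<lparr>FO = (\<lambda>p\<in>nodes b. push b b' f p),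
     FA = (\<lambda>m\<in>Ar (Lcat b). e (push b b' f (fst (d m)), FA (F1 P b b' f) (dat (d m)), push b b' f (cod (d m))))\<rparr>"

lemma Lfun_simps [simp]:
  "p \<in> nodes b \<Longrightarrow> FO (Lfun b b' f) p = push b b' f p"
  "m \<in> Ar (Lcat b) \<Longrightarrow> FA (Lfun b b' f) m
    = e (push b b' f (fst (d m)), FA (F1 P b b' f) (dat (d m)), push b b' f (cod (d m)))"
  by (simp_all add: Lfun_def)

lemma Lfun_functor [simp]:
  assumes "b \<in> Obj A" "b' \<in> Obj A" "f \<in> Ob (Hom A b b')"
  shows "is_functor (Lcat b) (Lcat b') (Lfun b b' f)"
proof (rule is_functorI, goal_cases)
  case 3
  then show ?case by (simp add: Lfun_def)
next
  case 4
  then show ?case by (simp add: Lfun_def)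
qed (use assms in \<open>auto simp: category_Lcat\<close>)

definition L :: "'u cat_valued" where
  "L = \<lparr>F0 = Lcat,
     FH = (\<lambda>b b'.
       \<lparr>FO = (\<lambda>f\<in>Ob (Hom A b b'). Lfun b b' f),
        FA = (\<lambda>\<gamma>\<in>Ar (Hom A b b').
          (Lfun b b' (src (Hom A b b') \<gamma>),
           \<lambda>p\<in>nodes b. e (push b b' (src (Hom A b b') \<gamma>) p, dat (F2 P b b' \<gamma>) (pt b p), push b b' (tgt (Hom A b b') \<gamma>) p),
           Lfun b b' (tgt (Hom A b b') \<gamma>)))\<rparr>)\<rparr>"

lemma L_simps [simp]:
  "F0 L = Lcat"
  "f \<in> Ob (Hom A b b') \<Longrightarrow> F1 L b b' f = Lfun b b' f"
  "\<gamma> \<in> Ar (Hom A b b') \<Longrightarrow> F2 L b b' \<gamma> = (Lfun b b' (src (Hom A b b') \<gamma>),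
     \<lambda>p\<in>nodes b. e (push b b' (src (Hom A b b') \<gamma>) p, dat (F2 P b b' \<gamma>) (pt b p), push b b' (tgt (Hom A b b') \<gamma>) p),
     Lfun b b' (tgt (Hom A b b') \<gamma>))"
  by (simp_all add: L_def F1_def F2_def)

text \<open>On nodes the laws are the strict laws of composition in \<open>A\<close>, since only the
  leg moves; on arrows, by \<open>pt_push\<close>, they are the laws of P.\<close>

lemma two_functor_L: "two_functor A (CAT r) L"
proof (rule two_functor_CATI, goal_cases)
  case (3 a b)
  then show ?case by (simp add: L_def)
next
  case (5 a b \<alpha>)
  note ab = 5
  have "F2 L a b \<alpha> \<in> Ar (functor_cat (Lcat a) (Lcat b))"
    unfolding L_simps(3) [OF ab(3)]
  proof (rule functor_cat_ArI, goal_cases)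
    case (5 m)
    then show ?case using ab P.F2_natural [of a b \<alpha> "dat (d m)"] by simp
  qed (use ab in auto)
  then show ?case using ab by simp
qed (auto simp: two_category_axioms Lcat_small)


subsection \<open>The colimiting cone\<close>

text \<open>The coprojection at the element X = (x, a), evaluated at b. Every node is the label of
  exactly one g under exactly one X, which later allows data on nodes to be read off from data on
  representables.\<close>

definition inc :: "'u \<times> 'u \<Rightarrow> 'u \<Rightarrow> ('u, 'u, 'u, 'u) fctr" where
  "inc X b = \<lparr>FO = (\<lambda>g\<in>Ob (Hom A (snd X) b). e (fst X, snd X, g)),
     FA = (\<lambda>\<alpha>\<in>Ar (Hom A (snd X) b). e (e (fst X, snd X, src (Hom A (snd X) b) \<alpha>),
        dat (F2 P (snd X) b \<alpha>) (fst X), e (fst X, snd X, tgt (Hom A (snd X) b) \<alpha>)))\<rparr>"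

lemma inc_simps [simp]:
  "g \<in> Ob (Hom A (snd X) b) \<Longrightarrow> FO (inc X b) g = e (fst X, snd X, g)"
  "\<alpha> \<in> Ar (Hom A (snd X) b) \<Longrightarrow> FA (inc X b) \<alpha> = e (e (fst X, snd X, src (Hom A (snd X) b) \<alpha>),
        dat (F2 P (snd X) b \<alpha>) (fst X), e (fst X, snd X, tgt (Hom A (snd X) b) \<alpha>))"
  by (simp_all add: inc_def)

lemma inc_functor [simp]:
  assumes "X \<in> Obj El_P" "b \<in> Obj A"
  shows "is_functor (Hom A (snd X) b) (Lcat b) (inc X b)"
proof (rule is_functorI, goal_cases)
  case 3
  then show ?case by (simp add: inc_def)
next
  case 4
  then show ?case by (simp add: inc_def)
qed (use assms in \<open>auto simp: category_Lcat\<close>)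

definition incT :: "'u \<times> 'u \<Rightarrow> 'u cat_transf" where
  "incT X = \<lparr>T0 = (\<lambda>b\<in>Obj A. inc X b),
     T1 = (\<lambda>(b, b', f)\<in>cells1 A. ide (functor_cat (Hom A (snd X) b) (Lcat b'))
        (fun_comp (Hom A (snd X) b) (inc X b') (postcomp A (snd X) b b' f)))\<rparr>"

lemma incT_simps [simp]:
  "T0 (incT X) \<in> extensional (Obj A)"
  "T1 (incT X) \<in> extensional (cells1 A)"
  "b \<in> Obj A \<Longrightarrow> T0 (incT X) b = inc X b"
  "\<lbrakk>b \<in> Obj A; b' \<in> Obj A; f \<in> Ob (Hom A b b')\<rbrakk> \<Longrightarrow>
    T1 (incT X) (b, b', f) = ide (functor_cat (Hom A (snd X) b) (Lcat b'))
        (fun_comp (Hom A (snd X) b) (inc X b') (postcomp A (snd X) b b' f))"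
  by (simp_all add: incT_def cells1_def)

text \<open>Postcomposition changes the leg only, so the square commutes on the nose and identities
  are legitimate structure cells for \<open>incT\<close>.\<close>

lemma inc_postcomp:
  assumes "X \<in> Obj El_P" "b \<in> Obj A" "b' \<in> Obj A" "f \<in> Ob (Hom A b b')"
  shows "fun_comp (Hom A (snd X) b) (inc X b') (postcomp A (snd X) b b' f)
    = fun_comp (Hom A (snd X) b) (Lfun b b' f) (inc X b)"
  by (rule fctr_eqI [OF is_functor_comp [OF postcomp_functor inc_functor]
        is_functor_comp [OF inc_functor Lfun_functor]]) (use assms in auto)

lemma pseudo_nat_incT:
  assumes X: "X \<in> Obj El_P"
  shows "pseudo_nat A (CAT r) (rep X) L (incT X)"
proof -
  have oplax: "oplax_nat A (CAT r) (rep X) L (incT X)"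
  proof (rule oplax_nat_CATI, goal_cases)
    case (6 a b f)
    then show ?case using X by (simp add: inc_postcomp)
  qed (use X in \<open>auto simp: two_functor_representable two_functor_L\<close>)
  then show ?thesis using X by (subst pseudo_nat_CAT) (auto intro!: iso_Lcat)
qed

text \<open>A copy of the target 2-category that the simplifier does not unfold, so that the rules for
  abstract 2-categories apply to it.\<close>

definition H :: "('u cat_valued, 'u cat_transf, 'u cat_modif) twocat" where
  "H = Hom_p A (CAT r)"

abbreviation cone_to where
  "cone_to E \<equiv> sigma_nat (op2 El_P) H Cart Diag (const2 (op2 El_P) H E)"

sublocale H: two_category H
  unfolding H_def by (rule two_category_Hom_p) (simp_all add: two_category_axioms two_category_CAT)

sublocale El: two_category "El A P"
  using P.two_functor_axioms by (rule two_category_El)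

sublocale D: two_functor "op2 El_P" H Diag
  unfolding H_def using P.two_functor_axioms by (rule two_functor_El_diagram)

lemma L_Obj: "L \<in> Obj H"
  by (simp add: H_def two_functor_L)

lemma H_arrow:
  assumes "m \<in> Ar (Hom H F G)"
  shows "cat_modif A r (all1 A) F G m"
  using assms by (simp add: H_def cat_modif_def modif_arrow_def)

lemma H_eqI:
  assumes "m \<in> Ar (Hom H F G)" "n \<in> Ar (Hom H F G)"
    and "src (Hom H F G) m = src (Hom H F G) n" "tgt (Hom H F G) m = tgt (Hom H F G) n"
    and "\<And>a x. a \<in> Obj A \<Longrightarrow> x \<in> Ob (F0 F a) \<Longrightarrow> dat (dat m a) x = dat (dat n a) x"
  shows "m = n"
  using assms by (intro cat_modif_eqI) (simp_all add: H_def)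

abbreviation pull where
  "pull X Y u b g \<equiv> cmp1 A (snd Y) (snd X) b g (fst u)"

text \<open>The cell of the cone at an arrow of elements u = (f, \<phi>) : Y \<rightarrow> X, with Y
  = (y, c) and X = (x, a). At g : a \<rightarrow> b it is P g \<phi>, regarded as an arrow from the
  node (y, c, g f) to the node (x, a, g).\<close>

definition lU :: "'u \<times> 'u \<Rightarrow> 'u \<times> 'u \<Rightarrow> 'u \<times> 'u \<Rightarrow> 'u cat_modif" where
  "lU X Y u = (cmp1 H (rep X) (rep Y) L (incT Y)
        (rep_T X Y u),
     \<lambda>b\<in>Obj A. (fun_comp (Hom A (snd X) b) (inc Y b) (precomp A (snd Y) (snd X) b (fst u)),
       \<lambda>g\<in>Ob (Hom A (snd X) b). e (e (fst Y, snd Y, pull X Y u b g),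
          FA (F1 P (snd X) b g) (snd u), e (fst X, snd X, g)),
       inc X b),
     incT X)"

abbreviation cone_arr where
  "cone_arr X Y u b \<equiv> dat (dat (lU X Y u) b)"

lemma lU_component [simp]:
  "b \<in> Obj A \<Longrightarrow> g \<in> Ob (Hom A (snd X) b) \<Longrightarrow> cone_arr X Y u b g
    = e (e (fst Y, snd Y, pull X Y u b g), FA (F1 P (snd X) b g) (snd u), e (fst X, snd X, g))"
  by (simp add: lU_def)

lemma incT_H [simp]: "X \<in> Obj El_P \<Longrightarrow> incT X \<in> Ob (Hom H (rep X) L)"
  using pseudo_nat_incT by (simp add: H_def)

lemma representable_transf_H [simp]:
  "\<lbrakk>X \<in> Obj A; Y \<in> Obj A; u \<in> Ob (Hom A Y X)\<rbrakk> \<Longrightarrow>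
    representable_transf A Y X u \<in> Ob (Hom H (representable A X) (representable A Y))"
  using pseudo_nat_representable_transf by (simp add: H_def)

lemma representable_H [simp]: "X \<in> Obj A \<Longrightarrow> representable A X \<in> Obj H"
  by (simp add: H_def two_functor_representable)

declare L_Obj [simp]

lemma lU_H:
  assumes X: "X \<in> Obj El_P" "Y \<in> Obj El_P" "u \<in> Ob (Hom El_P Y X)"
  shows "lU X Y u \<in> Ar (Hom H (rep X) L)"
    "src (Hom H (rep X) L) (lU X Y u) = cmp1 H (rep X) (rep Y) L (incT Y)
        (rep_T X Y u)"
    "tgt (Hom H (rep X) L) (lU X Y u) = incT X"
proof -
  have "cmp1 H (rep X) (rep Y) L (incT Y)
        (rep_T X Y u) \<in> Ob (Hom H (rep X) L)"
    using X by (intro H.cmp1_in) (simp_all del: H.cmp1_in)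
  then show "lU X Y u \<in> Ar (Hom H (rep X) L)"
    unfolding lU_def H_def Hom_p_simps
  proof (intro cat_modif_ArI, goal_cases)
    case (4 b)
    have "(fun_comp (Hom A (snd X) b) (inc Y b) (precomp A (snd Y) (snd X) b (fst u)),
       \<lambda>g\<in>Ob (Hom A (snd X) b). e (e (fst Y, snd Y, pull X Y u b g),
          FA (F1 P (snd X) b g) (snd u), e (fst X, snd X, g)),
       inc X b) \<in> Ar (functor_cat (Hom A (snd X) b) (Lcat b))"
    proof (rule functor_cat_ArI, goal_cases)
      case 1
      then show ?case using X 4 by (intro is_functor_comp [OF precomp_functor inc_functor]) simp_all
    next
      case (5 \<alpha>)
      \<comment> \<open>Naturality in g is naturality of P \<alpha> at the arrow
        \<open>snd u\<close>.\<close>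
      then show ?case using X 4 P.F2_natural [of "snd X" b \<alpha> "snd u"] by simp
    qed (use X 4 in auto)
    then show ?case using 4 by simp
  qed (use X pseudo_nat_incT in auto)
qed (simp_all add: lU_def H_def)

definition lcone :: "('u \<times> 'u, 'u \<times> 'u, 'u cat_transf, 'u cat_modif) transf" where
  "lcone = \<lparr>T0 = (\<lambda>X\<in>Obj El_P. incT X),
     T1 = (\<lambda>(X, Y, u)\<in>cells1 (op2 El_P). lU X Y u)\<rparr>"

abbreviation restr where
  "restr E \<equiv> cone_comp (op2 El_P) H Diag L E lcone"

lemma lcone_simps [simp]:
  "X \<in> Obj El_P \<Longrightarrow> T0 lcone X = incT X"
  "\<lbrakk>X \<in> Obj El_P; Y \<in> Obj El_P; u \<in> Ob (Hom El_P Y X)\<rbrakk> \<Longrightarrow> T1 lcone (X, Y, u) = lU X Y u"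
  by (simp_all add: lcone_def cells1_def del: El_simps)

text \<open>Closure under composition holds because the functors P f preserve isomorphisms.\<close>

lemma wide_subcat_cart: "wide_subcat (op2 El_P) Cart"
  unfolding wide_subcat_def
proof (intro conjI ballI, goal_cases)
  case (3 X Y Z u v)
  then have "cmp1 El_P Z Y X u v \<in> Ob (Hom El_P Z X)"
    by (intro El.cmp1_in) (auto simp: cart_arrows_op_def cart_arrows_def)
  with 3 show ?case by (auto simp: cart_arrows_op_def cart_arrows_def)
qed (auto simp: cart_arrows_op_def cart_arrows_def)


section \<open>Elementwise rules for the 1-cells and 2-cells of \<open>H\<close>\<close>

lemma H_transf:
  assumes "t \<in> Ob (Hom H F G)"
  shows "cat_transf A r F G t"
  using assms by (simp add: H_def sigma_nat_def cat_transf_def)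

lemma H_components [simp]:
  assumes "a \<in> Obj A" "x \<in> Ob (F0 F a)"
  shows "dat (dat (ide (Hom H F G) t) a) x = ide (F0 G a) (FO (T0 t a) x)"
    "dat (dat (cmp (Hom H F G) n m) a) x = cmp (F0 G a) (dat (dat n a) x) (dat (dat m a) x)"
  using assms by (simp_all add: H_def)

lemma H_whisk [simp]:
  assumes "a \<in> Obj A" "x \<in> Ob (F0 F a)" "m \<in> Ar (Hom H F G)" "t \<in> Ob (Hom H G K)"
  shows "dat (dat (lwhisk H F G K t m) a) x = FA (T0 t a) (dat (dat m a) x)"
proof -
  interpret m: cat_modif A r "all1 A" F G m using assms(3) by (rule H_arrow)
  interpret t: cat_transf A r G K t using assms(4) by (rule H_transf)
  show ?thesis using assms(1,2) by (simp add: H_def)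
qed

lemma H_whisk' [simp]:
  assumes "a \<in> Obj A" "x \<in> Ob (F0 F a)" "n \<in> Ar (Hom H G K)" "t \<in> Ob (Hom H F G)"
  shows "dat (dat (rwhisk H F G K n t) a) x = dat (dat n a) (FO (T0 t a) x)"
proof -
  interpret n: cat_modif A r "all1 A" G K n using assms(3) by (rule H_arrow)
  interpret t: cat_transf A r F G t using assms(4) by (rule H_transf)
  show ?thesis using assms(1,2) by (simp add: H_def)
qed

lemma H_one_T0 [simp]: "a \<in> Obj A \<Longrightarrow> T0 (one H F) a = fun_id (F0 F a)"
  by (simp add: H_def)

lemma H_cmp1_T0 [simp]: "a \<in> Obj A \<Longrightarrow> T0 (cmp1 H F G K s t) a = fun_comp (F0 F a) (T0 s a) (T0 t a)"
  by (simp add: H_def)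

lemma H_cmp1_T1:
  assumes "s \<in> Ob (Hom H G K)" "t \<in> Ob (Hom H F G)" "a \<in> Obj A" "b \<in> Obj A" "f \<in> Ob (Hom A a b)" "x \<in> Ob (F0 F a)"
  shows "dat (T1 (cmp1 H F G K s t) (a, b, f)) x
    = cmp (F0 K b) (dat (T1 s (a, b, f)) (FO (T0 t a) x)) (FA (T0 s b) (dat (T1 t (a, b, f)) x))"
proof -
  interpret t: cat_transf A r F G t using assms(2) by (rule H_transf)
  interpret s: cat_transf A r G K s using assms(1) by (rule H_transf)
  show ?thesis using assms by (simp add: H_def)
qed

text \<open>Otherwise 2-cells of the diagram would be unfolded into tuples before
  \<open>diagram_component\<close> can match.\<close>

declare El_diagram_simps(3) [simp del]

lemma diagram_component [simp]:
  assumes "m \<in> Ar (Hom El_P Y X)" "b \<in> Obj A" "g \<in> Ob (Hom A (snd X) b)"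
  shows "dat (dat (F2 Diag X Y m) b) g = lwhisk A (snd Y) (snd X) b g (dat m)"
  using assms by (simp add: El_diagram_simps(3))

lemma representable_transf_one [simp]:
  "X \<in> Obj A \<Longrightarrow> representable_transf A X X (one A X) = one H (representable A X)"
  using two_functor.F1_one [OF two_functor_yoneda, of X] by (simp add: H_def)

text \<open>In components, the unit and composition axioms are functoriality of P and of P g, and
  the axiom for 2-cells is P g applied to the equation that defines a 2-cell of elements. The cell
  at a cartesian arrow is invertible because P g preserves isomorphisms.\<close>

lemma lcone_cone: "cone_to L lcone"
  unfolding sigma_nat_def
proof (intro conjI ballI)
  show "oplax_nat (op2 El_P) H Diag (const2 (op2 El_P) H L) lcone"
  proof (rule oplax_natI, goal_cases)
    case 1
    then show ?case by (rule D.two_functor_axioms)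
  next
    case 2
    then show ?case by (intro two_functor_const2 El.two_category_op2 H.two_category_axioms L_Obj)
  next
    case (6 X Y u)
    then have "X \<in> Obj El_P" "Y \<in> Obj El_P" "u \<in> Ob (Hom El_P Y X)" by simp_all
    with lU_H [OF this] show ?case by (simp del: El_simps(2,3))
  next
    case (7 X)
    then have X: "X \<in> Obj El_P" "one El_P X \<in> Ob (Hom El_P X X)" by simp_all
    have "lU X X (one El_P X) = ide (Hom H (rep X) L) (incT X)"
      by (rule H_eqI [OF lU_H(1) [OF X(1) X]]) (use X lU_H [OF X(1) X] in auto)
    then show ?case using X by (simp del: El_simps(2,3,8))
  next
    case (8 X Y Z u v)
    then have H: "X \<in> Obj El_P" "Y \<in> Obj El_P" "Z \<in> Obj El_P"
      "u \<in> Ob (Hom El_P Y X)" "v \<in> Ob (Hom El_P Z Y)" by simp_all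
    let ?C = "Hom H (rep X) L"
    have uv: "cmp1 El_P Z Y X u v \<in> Ob (Hom El_P Z X)"
      using H by (intro El.cmp1_in)
    note Ar = lU_H [OF H(1,2,4)] lU_H [OF H(2,3,5)] lU_H [OF H(1,3) uv]
    have typing: "snd X \<in> Obj A" "snd Y \<in> Obj A" "snd Z \<in> Obj A"
      "rep_T X Y u \<in> Ob (Hom H (rep X) (rep Y))"
      "incT X \<in> Ob ?C"
      "incT Y \<in> Ob (Hom H (rep Y) L)"
      "incT Z \<in> Ob (Hom H (rep Z) L)"
      "rep_T Y Z v \<in> Ob (Hom H (rep Y) (rep Z))"
      using H by simp_all
    let ?r = "cmp ?C
      (lwhisk H (rep X) L L (one H L) (lU X Y u))
      (rwhisk H (rep X) (rep Y) L (lU Y Z v) (rep_T X Y u))"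
    have r: "?r \<in> Ar ?C"
      using typing Ar by (simp del: El_simps)
    have "lU X Z (cmp1 El_P Z Y X u v) = ?r"
    proof (rule H_eqI [OF Ar(7) r])
      have "representable_transf A (snd Z) (snd X) (fst (cmp1 El_P Z Y X u v))
        = cmp1 H (rep X) (rep Y) (rep Z) (rep_T Y Z v) (rep_T X Y u)"
        using D.F1_cmp1 [of X Y Z u v] H by simp
      then show "src ?C (lU X Z (cmp1 El_P Z Y X u v))
          = src ?C ?r"
        using typing Ar by (simp del: El_simps)
      show "tgt ?C (lU X Z (cmp1 El_P Z Y X u v))
          = tgt ?C ?r"
        using typing Ar by (simp del: El_simps)
    next
      fix a g assume "a \<in> Obj A" "g \<in> Ob (F0 (rep X) a)"
      then show "dat (dat (lU X Z (cmp1 El_P Z Y X u v)) a) g = dat (dat ?r a) g"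
        using H typing Ar by simp
    qed
    then show ?case using H uv by (simp del: El_simps)
  next
    case (9 X Y \<gamma>)
    then have H: "X \<in> Obj El_P" "Y \<in> Obj El_P" "\<gamma> \<in> Ar (Hom El_P Y X)" by simp_all
    then have H': "fst \<gamma> \<in> Ob (Hom El_P Y X)" "cod \<gamma> \<in> Ob (Hom El_P Y X)" by simp_all
    let ?C = "Hom H (rep X) L"
    note Ar = lU_H [OF H(1,2) H'(1)] lU_H [OF H(1,2) H'(2)]
    have "F2 Diag X Y \<gamma> \<in> Ar (Hom H (F0 Diag X) (F0 Diag Y))"
      "src (Hom H (F0 Diag X) (F0 Diag Y)) (F2 Diag X Y \<gamma>)
        = F1 Diag X Y (src (Hom El_P Y X) \<gamma>)"
      "tgt (Hom H (F0 Diag X) (F0 Diag Y)) (F2 Diag X Y \<gamma>)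
        = F1 Diag X Y (tgt (Hom El_P Y X) \<gamma>)"
      using H D.F2_in [of X Y \<gamma>] D.src_F2 [of X Y \<gamma>] D.tgt_F2 [of X Y \<gamma>] by (simp_all del: El_simps(2,3))
    note F2 = this [unfolded El_diagram_simps]
    have typing: "snd X \<in> Obj A" "snd Y \<in> Obj A"
      "incT X \<in> Ob ?C"
      "incT Y \<in> Ob (Hom H (rep Y) L)"
      using H by simp_all
    let ?l = "cmp ?C (lU X Y (cod \<gamma>))
      (lwhisk H (rep X) (rep Y) L (incT Y) (F2 Diag X Y \<gamma>))"
    have typing2: "F1 Diag X Y (src (Hom El_P Y X) \<gamma>) = representable_transf A (snd Y) (snd X) (fst (fst \<gamma>))"
      "F1 Diag X Y (tgt (Hom El_P Y X) \<gamma>) = representable_transf A (snd Y) (snd X) (fst (cod \<gamma>))"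
      using H' by (simp_all del: El_simps(2))
    have l: "?l \<in> Ar ?C"
      using typing typing2 Ar F2 by (simp del: El_simps(1-3))
    have "?l = lU X Y (fst \<gamma>)"
    proof (rule H_eqI [OF l Ar(1)])
      show "src ?C ?l = src ?C (lU X Y (fst \<gamma>))"
        "tgt ?C ?l = tgt ?C (lU X Y (fst \<gamma>))"
        using typing typing2 Ar F2 by (simp_all del: El_simps(1-3))
    next
      fix a g assume ag: "a \<in> Obj A" "g \<in> Ob (F0 (rep X) a)"
      have "dat (dat (F2 Diag X Y \<gamma>) a) g = lwhisk A (snd Y) (snd X) a g (dat \<gamma>)"
        using ag H(3) by (simp del: El_simps)
      \<comment> \<open>P g is distributed over the composite that occurs in the defining equation
        of the 2-cell of elements \<gamma>.\<close>
      moreover have "FA (F1 P (snd X) a g) (cmp (F0 P (snd X)) (snd (cod \<gamma>)) (dat (F2 P (snd Y) (snd X) (dat \<gamma>)) (fst Y)))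
        = cmp (F0 P a) (FA (F1 P (snd X) a g) (snd (cod \<gamma>))) (FA (F1 P (snd X) a g) (dat (F2 P (snd Y) (snd X) (dat \<gamma>)) (fst Y)))"
        by (rule is_functor.FA_comp [OF P.F1_functor]) (use H ag in simp_all)
      ultimately show "dat (dat ?l a) g = dat (dat (lU X Y (fst \<gamma>)) a) g"
        using H ag typing typing2 Ar F2 by simp
    qed
    then show ?case using H H' typing Ar by (simp del: El_simps(1-3))
  qed (auto simp: lcone_def simp del: El_simps)
next
  fix X Y u assume "X \<in> Obj (op2 El_P)" "Y \<in> Obj (op2 El_P)" "u \<in> Cart X Y"
  then have H: "X \<in> Obj El_P" "Y \<in> Obj El_P" "u \<in> Ob (Hom El_P Y X)" "iso_arrow (F0 P (snd X)) (snd u)"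
    by (auto simp: cart_arrows_op_def cart_arrows_def)
  have "iso_arrow (Hom H (rep X) L) (lU X Y u)"
    unfolding H_def Hom_p_simps
  proof (rule modif_iso)
    show "lU X Y u \<in> Ar (sigma_nat_cat A (CAT r) (all1 A) (rep X) L)"
      using lU_H(1) [OF H(1-3)] by (simp add: H_def)
    interpret m: cat_modif A r "all1 A" "rep X" L "lU X Y u"
      by (rule H_arrow [OF lU_H(1) [OF H(1-3)]])
    fix a assume a: "a \<in> Obj A"
    show "iso_arrow (Hom (CAT r) (F0 (rep X) a) (F0 L a)) (dat (lU X Y u) a)"
      using nat_arrow.Ar [OF m.nat_arrow [OF a]] a H
      by (simp add: iso_functor_cat iso_Lcat)
  qed
  then show "iso_arrow (Hom H (F0 Diag X) (F0 (const2 (op2 El_P) H L) Y)) (T1 lcone (X, Y, u))"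
    using H by (simp del: El_simps)
qed

sublocale lcone: sigma_cone "op2 El_P" H Cart Diag L lcone
  by unfold_locales (rule lcone_cone wide_subcat_cart L_Obj)+

text \<open>The arrows \<open>P g \<phi>\<close> of \<open>Lcat b\<close> coming from the cone generate it: \<open>m : p \<rightarrow> q\<close> is the composite of
  the isomorphism \<open>p \<rightarrow> (pt b p, b, 1)\<close>, of \<open>m\<close> as an arrow of elements over \<open>1\<close>, and of the inverse of
  \<open>q \<rightarrow> (pt b q, b, 1)\<close>.\<close>

lemma Lcat_induct [consumes 2, case_names gen comp inv]:
  assumes b: "b \<in> Obj A" and m: "m \<in> Ar (Lcat b)"
    and gen: "\<And>X Y u g. \<lbrakk>X \<in> Obj El_P; Y \<in> Obj El_P; u \<in> Ob (Hom El_P Y X);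
      g \<in> Ob (Hom A (snd X) b)\<rbrakk> \<Longrightarrow> Q (cone_arr X Y u b g)"
    and comp: "\<And>m n. \<lbrakk>m \<in> Ar (Lcat b); n \<in> Ar (Lcat b); fst (d n) = cod (d m); Q m; Q n\<rbrakk>
      \<Longrightarrow> Q (cmp (Lcat b) n m)"
    and inv: "\<And>m. iso_arrow (Lcat b) m \<Longrightarrow> Q m \<Longrightarrow> Q (arr_inv (Lcat b) m)"
  shows "Q m"
proof -
  interpret C: category "Lcat b" using b by (rule category_Lcat)
  \<comment> \<open>\<open>J p\<close> is the cone cell at the cartesian arrow (leg p, 1) : (elt p,
    base p) \<rightarrow> (pt b p, b), taken at the identity of b; it lies over an identity of P b,
    hence is invertible.\<close>
  define J where "J p = e (p, ide (F0 P b) (pt b p), e (pt b p, b, one A b))" for p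
  have QJ: "Q (J p)" if "p \<in> nodes b" for p
    using gen [of "(pt b p, b)" "(elt p, base p)" "(leg p, ide (F0 P b) (pt b p))" "one A b"] that b
    by (simp add: J_def pt_def)
  have J: "J p \<in> Ar (Lcat b)" "iso_arrow (Lcat b) (J p)" if "p \<in> nodes b" for p
    using that b by (auto simp: J_def intro!: iso_Lcat)
  have J': "arr_inv (Lcat b) (J p) = e (e (pt b p, b, one A b), ide (F0 P b) (pt b p), p)" if "p \<in> nodes b" for p
    by (rule C.arr_inv_unique [OF J(2)]) (use that b in \<open>simp_all add: J_def\<close>)
  define K where "K = e (e (pt b (fst (d m)), b, one A b), dat (d m), e (pt b (cod (d m)), b, one A b))"
  have K: "K \<in> Ar (Lcat b)" using m b by (simp add: K_def)
  have QK: "Q K"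
    using gen [of "(pt b (cod (d m)), b)" "(pt b (fst (d m)), b)" "(one A b, dat (d m))" "one A b"] m b
    by (simp add: K_def)
  let ?q = "cod (d m)"
  have "Q (cmp (Lcat b) K (J (fst (d m))))"
    using m by (intro comp [OF J(1) K _ QJ QK]) (simp_all add: J_def K_def)
  moreover have "Q (e (e (pt b ?q, b, one A b), ide (F0 P b) (pt b ?q), ?q))"
    using inv [OF J(2) QJ, of ?q] m J' [of ?q] by simp
  ultimately have "Q (cmp (Lcat b) (e (e (pt b ?q, b, one A b), ide (F0 P b) (pt b ?q), ?q)) (cmp (Lcat b) K (J (fst (d m)))))"
    by (rule comp [rotated 3]) (use m b in \<open>simp_all add: J_def K_def\<close>)
  then show ?thesis using m b by (simp add: J_def K_def)
qed

text \<open>The arrows at which the square of \<eta> commutes are closed under composition and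
  inversion, so the generators suffice. With identities for \<eta> this also tests equality of
  functors.\<close>

lemma Lcat_natural:
  assumes b: "b \<in> Obj A" and F: "is_functor (Lcat b) C F" and G: "is_functor (Lcat b) C G"
    and \<eta>: "\<And>p. p \<in> nodes b \<Longrightarrow> \<eta> p \<in> Ar C \<and> src C (\<eta> p) = FO F p \<and> tgt C (\<eta> p) = FO G p"
    and gen: "\<And>X Y u g. \<lbrakk>X \<in> Obj El_P; Y \<in> Obj El_P; u \<in> Ob (Hom El_P Y X);
      g \<in> Ob (Hom A (snd X) b)\<rbrakk> \<Longrightarrow>
        cmp C (\<eta> (e (fst X, snd X, g))) (FA F (cone_arr X Y u b g))
        = cmp C (FA G (cone_arr X Y u b g)) (\<eta> (e (fst Y, snd Y, pull X Y u b g)))"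
    and m: "m \<in> Ar (Lcat b)"
  shows "cmp C (\<eta> (cod (d m))) (FA F m) = cmp C (FA G m) (\<eta> (fst (d m)))"
  using b m
proof (induction rule: Lcat_induct)
  case (gen X Y u g)
  then show ?case using assms(5) [OF gen] b by simp
next
  case (comp m n)
  interpret F: is_functor "Lcat b" C F by fact
  interpret G: is_functor "Lcat b" C G by fact
  have "cmp C (\<eta> (cod (d n))) (cmp C (FA F n) (FA F m)) = cmp C (cmp C (\<eta> (cod (d n))) (FA F n)) (FA F m)"
    using comp(1-3) \<eta> by simp
  also have "\<dots> = cmp C (cmp C (FA G n) (\<eta> (fst (d n)))) (FA F m)"
    by (simp only: comp(5))
  also have "\<dots> = cmp C (FA G n) (cmp C (\<eta> (cod (d m))) (FA F m))"
    using comp(1-3) \<eta> by simp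
  also have "\<dots> = cmp C (FA G n) (cmp C (FA G m) (\<eta> (fst (d m))))"
    by (simp only: comp(4))
  also have "\<dots> = cmp C (cmp C (FA G n) (FA G m)) (\<eta> (fst (d m)))"
    using comp(1-3) \<eta> by simp
  finally show ?case using comp(1-3) F.FA_comp [of m n] G.FA_comp [of m n] by simp
next
  case (inv m)
  interpret F: is_functor "Lcat b" C F by fact
  interpret G: is_functor "Lcat b" C G by fact
  note m = iso_arrow_Ar [OF inv(1)]
  let ?i = "arr_inv (Lcat b) m"
  have i: "?i \<in> Ar (Lcat b)" "fst (d ?i) = cod (d m)" "cod (d ?i) = fst (d m)"
    using arr_inv(1-3) [OF inv(1)] by auto
  have inv_F: "cmp C (FA F m) (FA F ?i) = ide C (FO F (cod (d m)))"
    using F.FA_comp [of ?i m] F.FA_ide [of "cod (d m)"] m i arr_inv(5) [OF inv(1)] by (simp del: Lcat_simps(4,5))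
  have inv_G: "cmp C (FA G ?i) (FA G m) = ide C (FO G (fst (d m)))"
    using G.FA_comp [of m ?i] G.FA_ide [of "fst (d m)"] m i arr_inv(4) [OF inv(1)] by (simp del: Lcat_simps(4,5))
  \<comment> \<open>The square for the inverse arises by inserting \<open>FA G ?i\<close> and
    \<open>FA G m\<close>, using the square for \<open>m\<close>, and cancelling
    \<open>FA F m\<close> against \<open>FA F ?i\<close>.\<close>
  have "cmp C (\<eta> (fst (d m))) (FA F ?i) = cmp C (cmp C (cmp C (FA G ?i) (FA G m)) (\<eta> (fst (d m)))) (FA F ?i)"
    using m i \<eta> by (simp only: inv_G) simp
  also have "\<dots> = cmp C (FA G ?i) (cmp C (cmp C (FA G m) (\<eta> (fst (d m)))) (FA F ?i))"
    using m i \<eta> by simp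
  also have "\<dots> = cmp C (FA G ?i) (cmp C (\<eta> (cod (d m))) (cmp C (FA F m) (FA F ?i)))"
    using m i \<eta> by (simp only: inv(2) [symmetric]) simp
  also have "\<dots> = cmp C (FA G ?i) (\<eta> (cod (d m)))"
    using m i \<eta> by (simp add: inv_F)
  finally show ?case using i by simp
qed

end


section \<open>The universal property\<close>

text \<open>An arbitrary cone, for which the factorisation \<open>T\<close> is constructed. Being a
  locale, it can be interpreted a second time for the restriction of \<open>T\<close>, which is then
  compared with \<theta>.\<close>

locale elements_cone = elements r A P e
  for r :: "'u rel" and A :: "('u, 'u, 'u) twocat" and P :: "'u cat_valued" and e +
  fixes E \<theta>
  assumes E: "E \<in> Obj H"
    and theta: "cone_to E \<theta>"
begin

sublocale \<theta>: oplax_nat "op2 El_P" H Diag "const2 (op2 El_P) H E" \<theta>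
  using theta by (simp add: sigma_nat_def)

sublocale E: cat_valued A r E
  using E by (simp add: H_def cat_valued_def)

lemma T0_H [simp]: "X \<in> Obj El_P \<Longrightarrow> T0 \<theta> X \<in> Ob (Hom H (rep X) E)"
  using \<theta>.T0_in [of X] by simp

lemma T0_pseudo: "X \<in> Obj El_P \<Longrightarrow> pseudo_nat A (CAT r) (rep X) E (T0 \<theta> X)"
  using T0_H [of X] by (simp add: H_def)

lemma T0_transf: "X \<in> Obj El_P \<Longrightarrow> cat_transf A r (rep X) E (T0 \<theta> X)"
  using T0_pseudo [of X] by (simp add: sigma_nat_def cat_transf_def)

lemma T1_H:
  assumes "X \<in> Obj El_P" "Y \<in> Obj El_P" "u \<in> Ob (Hom El_P Y X)"
  shows "T1 \<theta> (X, Y, u) \<in> Ar (Hom H (rep X) E)"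
    "src (Hom H (rep X) E) (T1 \<theta> (X, Y, u)) = cmp1 H (rep X) (rep Y) E (T0 \<theta> Y) (rep_T X Y u)"
    "tgt (Hom H (rep X) E) (T1 \<theta> (X, Y, u)) = T0 \<theta> X"
  using assms \<theta>.T1_simps [of X Y u] E by simp_all

lemma T1_modif:
  assumes "X \<in> Obj El_P" "Y \<in> Obj El_P" "u \<in> Ob (Hom El_P Y X)"
  shows "cat_modif A r (all1 A) (rep X) E (T1 \<theta> (X, Y, u))"
  using T1_H(1) [OF assms] by (rule H_arrow)

lemma T1_dom_cod:
  assumes "X \<in> Obj El_P" "Y \<in> Obj El_P" "u \<in> Ob (Hom El_P Y X)"
  shows "fst (T1 \<theta> (X, Y, u)) = cmp1 H (rep X) (rep Y) E (T0 \<theta> Y) (rep_T X Y u)"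
    "cod (T1 \<theta> (X, Y, u)) = T0 \<theta> X"
  using T1_H(2,3) [OF assms] by (simp_all add: H_def)

text \<open>Four layers of data of the cone: the functors of its legs on 1-cells (\<open>tO\<close>)
  and on 2-cells (\<open>tA\<close>), the pseudonaturality cells of the legs (\<open>tN\<close>),
  and the cone cells at arrows of elements (\<open>tU\<close>).\<close>

abbreviation tO where
  "tO X b \<equiv> FO (T0 (T0 \<theta> X) b)"

abbreviation tA where
  "tA X b \<equiv> FA (T0 (T0 \<theta> X) b)"

abbreviation tN where
  "tN X b b' f \<equiv> dat (T1 (T0 \<theta> X) (b, b', f))"

abbreviation tU where
  "tU X Y u b \<equiv> dat (dat (T1 \<theta> (X, Y, u)) b)"

lemmas tA_simps [simp] = cat_transf.T0_simps [OF T0_transf, unfolded representable_simps(1)]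

lemma tN_simps [simp]:
  assumes "X \<in> Obj El_P" "b \<in> Obj A" "b' \<in> Obj A" "f \<in> Ob (Hom A b b')" "g \<in> Ob (Hom A (snd X) b)"
  shows "tN X b b' f g \<in> Ar (F0 E b')" "src (F0 E b') (tN X b b' f g) = tO X b' (cmp1 A (snd X) b b' f g)"
    "tgt (F0 E b') (tN X b b' f g) = FO (F1 E b b' f) (tO X b g)" "iso_arrow (F0 E b') (tN X b b' f g)"
  using assms cat_transf.T1_component [OF T0_transf [OF assms(1)] assms(2-4), of g]
    pseudo_nat_CAT [OF cat_transf.axioms [OF T0_transf [OF assms(1)]]] T0_pseudo [OF assms(1)] by simp_all

lemma tN_one:
  assumes "X \<in> Obj El_P" "b \<in> Obj A" "g \<in> Ob (Hom A (snd X) b)"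
  shows "tN X b b (one A b) g = ide (F0 E b) (tO X b g)"
  using assms cat_transf.T1_component_one [OF T0_transf, of X b g] by simp

lemma tN_cmp1:
  assumes "X \<in> Obj El_P" "a \<in> Obj A" "b \<in> Obj A" "c \<in> Obj A" "f \<in> Ob (Hom A a b)" "f' \<in> Ob (Hom A b c)"
    "g \<in> Ob (Hom A (snd X) a)"
  shows "tN X a c (cmp1 A a b c f' f) g
    = cmp (F0 E c) (FA (F1 E b c f') (tN X a b f g)) (tN X b c f' (cmp1 A (snd X) a b f g))"
  using assms cat_transf.T1_component_cmp1 [OF T0_transf, of X a b c f f' g] by simp

lemma tN_nat2:
  assumes "X \<in> Obj El_P" "b \<in> Obj A" "b' \<in> Obj A" "\<gamma> \<in> Ar (Hom A b b')" "g \<in> Ob (Hom A (snd X) b)"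
  shows "cmp (F0 E b') (tN X b b' (tgt (Hom A b b') \<gamma>) g) (tA X b' (rwhisk A (snd X) b b' \<gamma> g))
      = cmp (F0 E b') (dat (F2 E b b' \<gamma>) (tO X b g)) (tN X b b' (src (Hom A b b') \<gamma>) g)"
  using assms cat_transf.T1_component_nat2 [OF T0_transf, of X b b' \<gamma> g] by simp

lemma tU_simps [simp]:
  assumes "X \<in> Obj El_P" "Y \<in> Obj El_P" "u \<in> Ob (Hom El_P Y X)" "b \<in> Obj A" "g \<in> Ob (Hom A (snd X) b)"
  shows "tU X Y u b g \<in> Ar (F0 E b)" "src (F0 E b) (tU X Y u b g) = tO Y b (pull X Y u b g)"
    "tgt (F0 E b) (tU X Y u b g) = tO X b g"
  using assms cat_modif.component [OF T1_modif [OF assms(1-3)], of b g] by (simp_all add: T1_dom_cod)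

lemma tU_modif:
  assumes "X \<in> Obj El_P" "Y \<in> Obj El_P" "u \<in> Ob (Hom El_P Y X)" "b \<in> Obj A" "b' \<in> Obj A"
    "h \<in> Ob (Hom A b b')" "g \<in> Ob (Hom A (snd X) b)"
  shows "cmp (F0 E b') (FA (F1 E b b' h) (tU X Y u b g)) (tN Y b b' h (pull X Y u b g))
    = cmp (F0 E b') (tN X b b' h g) (tU X Y u b' (cmp1 A (snd X) b b' h g))"
proof -
  interpret m: cat_modif A r "all1 A" "rep X" E "T1 \<theta> (X, Y, u)"
    by (rule T1_modif [OF assms(1-3)])
  have "dat (T1 (fst (T1 \<theta> (X, Y, u))) (b, b', h)) g = tN Y b b' h (pull X Y u b g)"
    using assms H_cmp1_T1 [of "T0 \<theta> Y" "rep Y" E "rep_T X Y u" "rep X" b b' h g]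
    by (simp add: T1_dom_cod)
  then show ?thesis
    using m.component_modif [of b b' h g] assms by (simp add: T1_dom_cod)
qed

text \<open>Here and in \<open>tU_cmp\<close> the arrow is a variable with an equation, so that
  explicit pairs, equal to it only after simplification, can be substituted.\<close>

lemma tU_one:
  assumes "X \<in> Obj El_P" "b \<in> Obj A" "g \<in> Ob (Hom A (snd X) b)" "u = one El_P X"
  shows "tU X X u b g = ide (F0 E b) (tO X b g)"
  using assms \<theta>.T1_one [of X] by simp

lemma tU_cmp:
  assumes "X \<in> Obj El_P" "Y \<in> Obj El_P" "Z \<in> Obj El_P" "u \<in> Ob (Hom El_P Y X)"
    "v \<in> Ob (Hom El_P Z Y)" "b \<in> Obj A" "g \<in> Ob (Hom A (snd X) b)" "w = cmp1 El_P Z Y X u v"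
  shows "tU X Z w b g = cmp (F0 E b) (tU X Y u b g) (tU Y Z v b (pull X Y u b g))"
proof -
  have "T1 \<theta> (X, Z, w) = cmp (Hom H (rep X) E) (T1 \<theta> (X, Y, u))
      (rwhisk H (rep X) (rep Y) E (T1 \<theta> (Y, Z, v)) (rep_T X Y u))"
    using assms \<theta>.T1_comp [of X Y Z u v] T1_H [of X Y u] E by simp
  then show ?thesis
    using assms T1_H(1) [of Y Z v] by simp
qed

text \<open>The cone has a constant target, which sends \<gamma> to an identity, so the naturality
  axiom has a single whiskering left.\<close>

lemma tU_two:
  assumes "X \<in> Obj El_P" "Y \<in> Obj El_P" "\<gamma> \<in> Ar (Hom El_P Y X)" "b \<in> Obj A" "g \<in> Ob (Hom A (snd X) b)"
  shows "cmp (F0 E b) (tU X Y (cod \<gamma>) b g) (tA Y b (lwhisk A (snd Y) (snd X) b g (dat \<gamma>)))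
    = tU X Y (fst \<gamma>) b g"
proof -
  have F2: "F2 Diag X Y \<gamma> \<in> Ar (Hom H (rep X) (rep Y))"
    using assms D.F2_in [of X Y \<gamma>] by (simp del: El_simps(2,3))
  have "cmp (Hom H (rep X) E) (T1 \<theta> (X, Y, cod \<gamma>))
      (lwhisk H (rep X) (rep Y) E (T0 \<theta> Y) (F2 Diag X Y \<gamma>))
    = T1 \<theta> (X, Y, fst \<gamma>)" (is "?l = _")
    using assms \<theta>.T1_natural [of X Y \<gamma>] T1_H [of X Y "fst \<gamma>"] E by simp
  moreover have "dat (dat ?l b) g = cmp (F0 E b) (tU X Y (cod \<gamma>) b g)
      (tA Y b (lwhisk A (snd Y) (snd X) b g (dat \<gamma>)))"
    using assms F2 by (simp del: El_simps(2,3))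
  ultimately show ?thesis by simp
qed

text \<open>The \<sigma>-condition enters here: the inverse of the whole modification, evaluated at
  b and g, inverts the component.\<close>

lemma tU_iso [simp]:
  assumes "X \<in> Obj El_P" "Y \<in> Obj El_P" "u \<in> Ob (Hom El_P Y X)" "b \<in> Obj A" "g \<in> Ob (Hom A (snd X) b)"
    "iso_arrow (F0 P (snd X)) (snd u)"
  shows "iso_arrow (F0 E b) (tU X Y u b g)"
proof -
  let ?C = "Hom H (rep X) E"
  interpret m: cat_modif A r "all1 A" "rep X" E "T1 \<theta> (X, Y, u)"
    by (rule T1_modif [OF assms(1-3)])
  have "u \<in> Cart X Y" using assms by (auto simp: cart_arrows_op_def cart_arrows_def)
  then have iso: "iso_arrow ?C (T1 \<theta> (X, Y, u))"
    using theta assms(1,2) by (simp add: sigma_nat_def)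
  let ?n = "arr_inv ?C (T1 \<theta> (X, Y, u))"
  have "?n \<in> Ar ?C" using iso by simp
  then interpret n: cat_modif A r "all1 A" "rep X" E ?n
    by (rule H_arrow)
  have n: "fst ?n = cod (T1 \<theta> (X, Y, u))" "cod ?n = fst (T1 \<theta> (X, Y, u))"
    using arr_inv(2,3) [OF iso] by (simp_all add: H_def)
  have "dat (dat (cmp ?C ?n (T1 \<theta> (X, Y, u))) b) g = dat (dat (ide ?C (src ?C (T1 \<theta> (X, Y, u)))) b) g"
    "dat (dat (cmp ?C (T1 \<theta> (X, Y, u)) ?n) b) g = dat (dat (ide ?C (tgt ?C (T1 \<theta> (X, Y, u)))) b) g"
    using arr_inv(4,5) [OF iso] by simp_all
  then have "cmp (F0 E b) (dat (dat ?n b) g) (tU X Y u b g) = ide (F0 E b) (src (F0 E b) (tU X Y u b g))"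
    "cmp (F0 E b) (tU X Y u b g) (dat (dat ?n b) g) = ide (F0 E b) (tgt (F0 E b) (tU X Y u b g))"
    using assms T1_H [of X Y u] by simp_all
  then show ?thesis
    using assms n n.component [of b g] m.component [of b g] by (intro iso_arrowI [where g = "dat (dat ?n b) g"]) simp_all
qed

text \<open>\<open>jj\<close> is the cone cell at the cartesian arrow (leg p, 1) into (pt b p, b),
  and \<open>kk\<close> below the cone cell at (1, m), both evaluated at the identity of b. They are
  the images of the generators into which an arrow of \<open>Lcat b\<close> decomposes.\<close>

definition jj :: "'u \<Rightarrow> 'u \<Rightarrow> 'u" where
  "jj b p = tU (pt b p, b) (elt p, base p) (leg p, ide (F0 P b) (pt b p)) b (one A b)"

definition kk :: "'u \<Rightarrow> 'u \<Rightarrow> 'u" where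
  "kk b m = tU (pt b (cod (d m)), b) (pt b (fst (d m)), b) (one A b, dat (d m)) b (one A b)"

lemma jj_simps [simp]:
  assumes "b \<in> Obj A" "p \<in> nodes b"
  shows "jj b p \<in> Ar (F0 E b)" "src (F0 E b) (jj b p) = tO (elt p, base p) b (leg p)"
    "tgt (F0 E b) (jj b p) = tO (pt b p, b) b (one A b)" "iso_arrow (F0 E b) (jj b p)"
  using assms unfolding jj_def by (simp_all flip: pt_def)

lemma kk_simps [simp]:
  assumes "b \<in> Obj A" "m \<in> Ar (Lcat b)"
  shows "kk b m \<in> Ar (F0 E b)" "src (F0 E b) (kk b m) = tO (pt b (fst (d m)), b) b (one A b)"
    "tgt (F0 E b) (kk b m) = tO (pt b (cod (d m)), b) b (one A b)"
  using assms unfolding kk_def by simp_all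

lemma kk_ide:
  assumes "b \<in> Obj A" "p \<in> nodes b"
  shows "kk b (e (p, ide (F0 P b) (pt b p), p)) = ide (F0 E b) (tO (pt b p, b) b (one A b))"
  using assms unfolding kk_def by (simp add: tU_one)

lemma kk_cmp:
  assumes "b \<in> Obj A" "m \<in> Ar (Lcat b)" "n \<in> Ar (Lcat b)" "fst (d n) = cod (d m)"
  shows "kk b (cmp (Lcat b) n m) = cmp (F0 E b) (kk b n) (kk b m)"
  using assms tU_cmp [of "(pt b (cod (d n)), b)" "(pt b (cod (d m)), b)" "(pt b (fst (d m)), b)"
      "(one A b, dat (d n))" "(one A b, dat (d m))" b "one A b"]
  unfolding kk_def by simp

definition Tb :: "'u \<Rightarrow> ('u, 'u, 'u, 'u) fctr" where
  "Tb b = \<lparr>FO = (\<lambda>p\<in>nodes b. tO (elt p, base p) b (leg p)),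
     FA = (\<lambda>m\<in>Ar (Lcat b). cmp (F0 E b) (arr_inv (F0 E b) (jj b (cod (d m)))) (cmp (F0 E b) (kk b m) (jj b (fst (d m)))))\<rparr>"

lemma Tb_simps [simp]:
  "p \<in> nodes b \<Longrightarrow> FO (Tb b) p = tO (elt p, base p) b (leg p)"
  "m \<in> Ar (Lcat b) \<Longrightarrow> FA (Tb b) m
    = cmp (F0 E b) (arr_inv (F0 E b) (jj b (cod (d m)))) (cmp (F0 E b) (kk b m) (jj b (fst (d m))))"
  by (simp_all add: Tb_def)

text \<open>In the image of a composite the intermediate \<open>jj\<close> meets its inverse; what
  is left is that \<open>kk\<close> is functorial, which is the composition axiom of the
  cone.\<close>

lemma Tb_functor:
  assumes b: "b \<in> Obj A"
  shows "is_functor (Lcat b) (F0 E b) (Tb b)"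
proof (rule is_functorI, goal_cases)
  case 3
  then show ?case by (simp add: Tb_def)
next
  case 4
  then show ?case by (simp add: Tb_def)
next
  case (7 p)
  then show ?case using b by (simp add: kk_ide)
next
  case (8 m n)
  then have "cmp (Lcat b) n m \<in> Ar (Lcat b)" "fst (d (cmp (Lcat b) n m)) = fst (d m)" "cod (d (cmp (Lcat b) n m)) = cod (d n)"
    using b by simp_all
  then have "FA (Tb b) (cmp (Lcat b) n m) = cmp (F0 E b) (arr_inv (F0 E b) (jj b (cod (d n))))
    (cmp (F0 E b) (kk b (cmp (Lcat b) n m)) (jj b (fst (d m))))"
    by (simp del: Lcat_simps)
  then show ?case using b 8 kk_cmp [OF b 8(1,2)] by (simp del: Lcat_simps(5) add: Lcat_simps)
qed (use b in \<open>auto simp: category_Lcat\<close>)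

text \<open>The arrow of elements \<open>?w\<close> factors in two ways, as (g, 1) after u and as
  (1, P g \<phi>) after (g u, 1), where \<phi> is \<open>snd u\<close>. The composition axiom
  applied to both gives \<open>jj tU = kk jj\<close>, and \<open>jj\<close> is cancelled.\<close>

lemma Tb_lU:
  assumes X: "X \<in> Obj El_P" "Y \<in> Obj El_P" "u \<in> Ob (Hom El_P Y X)" and b: "b \<in> Obj A"
    and g: "g \<in> Ob (Hom A (snd X) b)"
  shows "FA (Tb b) (cone_arr X Y u b g) = tU X Y u b g"
proof -
  let ?gu = "pull X Y u b g"
  let ?p = "e (fst Y, snd Y, ?gu)" and ?q = "e (fst X, snd X, g)"
  let ?m = "cone_arr X Y u b g"
  let ?Pp = "FO (F1 P (snd Y) b ?gu) (fst Y)" and ?Pq = "FO (F1 P (snd X) b g) (fst X)"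
  let ?w = "(?gu, FA (F1 P (snd X) b g) (snd u))"
  have pq: "?p \<in> nodes b" "?q \<in> nodes b" using assms by auto
  have m: "?m \<in> Ar (Lcat b)" using assms by auto
  have "cmp (F0 E b) (jj b ?q) (tU X Y u b g) = tU (?Pq, b) Y ?w b (one A b)"
    using assms tU_cmp [of "(?Pq, b)" X Y "(g, ide (F0 P b) ?Pq)" u b "one A b" ?w] by (simp add: jj_def)
  also have "\<dots> = cmp (F0 E b) (kk b ?m) (jj b ?p)"
    using assms tU_cmp [of "(?Pq, b)" "(?Pp, b)" Y "(one A b, FA (F1 P (snd X) b g) (snd u))" "(?gu, ide (F0 P b) ?Pp)" b "one A b" ?w]
    by (simp add: jj_def kk_def)
  finally have "cmp (F0 E b) (kk b ?m) (jj b ?p) = cmp (F0 E b) (jj b ?q) (tU X Y u b g)" by simp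
  moreover have "fst (d ?m) = ?p" "cod (d ?m) = ?q" using b g by simp_all
  ultimately have "FA (Tb b) ?m = cmp (F0 E b) (arr_inv (F0 E b) (jj b ?q)) (cmp (F0 E b) (jj b ?q) (tU X Y u b g))"
    using m by (simp del: lU_component)
  also have "\<dots> = tU X Y u b g"
    using assms pq jj_simps [OF b pq(2)] by (simp del: jj_simps)
  finally show ?thesis .
qed

text \<open>The 2-cell \<alpha> : g \<Rightarrow> g' is also a 2-cell of elements from
  \<open>?w\<close> to the cartesian arrow (g', 1). The axiom for 2-cells takes the place of the
  first factorisation in \<open>Tb_lU\<close>; the second is the same.\<close>

lemma Tb_inc:
  assumes X: "X \<in> Obj El_P" and b: "b \<in> Obj A" and \<alpha>: "\<alpha> \<in> Ar (Hom A (snd X) b)"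
  shows "FA (Tb b) (FA (inc X b) \<alpha>) = tA X b \<alpha>"
proof -
  let ?g = "src (Hom A (snd X) b) \<alpha>" and ?g' = "tgt (Hom A (snd X) b) \<alpha>"
  let ?p = "e (fst X, snd X, ?g)" and ?q = "e (fst X, snd X, ?g')"
  let ?m = "FA (inc X b) \<alpha>"
  let ?Pp = "FO (F1 P (snd X) b ?g) (fst X)" and ?Pq = "FO (F1 P (snd X) b ?g') (fst X)"
  let ?w = "(?g, dat (F2 P (snd X) b \<alpha>) (fst X))"
  have pq: "?p \<in> nodes b" "?q \<in> nodes b" using assms by auto
  have m: "?m \<in> Ar (Lcat b)" using assms by auto
  have "cmp (F0 E b) (jj b ?q) (tA X b \<alpha>) = tU (?Pq, b) X ?w b (one A b)"
    using assms tU_two [of "(?Pq, b)" X "(?w, \<alpha>, (?g', ide (F0 P b) ?Pq))" b "one A b"] by (simp add: jj_def)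
  also have "\<dots> = cmp (F0 E b) (kk b ?m) (jj b ?p)"
    using assms tU_cmp [of "(?Pq, b)" "(?Pp, b)" X "(one A b, dat (F2 P (snd X) b \<alpha>) (fst X))" "(?g, ide (F0 P b) ?Pp)" b "one A b" ?w]
    by (simp add: jj_def kk_def)
  finally have "cmp (F0 E b) (kk b ?m) (jj b ?p) = cmp (F0 E b) (jj b ?q) (tA X b \<alpha>)" by simp
  moreover have "fst (d ?m) = ?p" "cod (d ?m) = ?q" using \<alpha> by simp_all
  ultimately have "FA (Tb b) ?m = cmp (F0 E b) (arr_inv (F0 E b) (jj b ?q)) (cmp (F0 E b) (jj b ?q) (tA X b \<alpha>))"
    using m by (simp del: inc_simps)
  also have "\<dots> = tA X b \<alpha>"
    using assms pq jj_simps [OF b pq(2)] by (simp del: jj_simps)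
  finally show ?thesis .
qed

text \<open>The structure cell at a node is that of \<theta> at its leg. It can be no other, since
  the coprojections have identity structure cells.\<close>

definition T :: "'u cat_transf" where
  "T = \<lparr>T0 = (\<lambda>b\<in>Obj A. Tb b),
     T1 = (\<lambda>(b, b', f)\<in>cells1 A. (fun_comp (Lcat b) (Tb b') (Lfun b b' f),
        \<lambda>p\<in>nodes b. tN (elt p, base p) b b' f (leg p), fun_comp (Lcat b) (F1 E b b' f) (Tb b)))\<rparr>"

lemma T_simps [simp]:
  "T0 T \<in> extensional (Obj A)"
  "T1 T \<in> extensional (cells1 A)"
  "b \<in> Obj A \<Longrightarrow> T0 T b = Tb b"
  "\<lbrakk>b \<in> Obj A; b' \<in> Obj A; f \<in> Ob (Hom A b b')\<rbrakk> \<Longrightarrow>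
    T1 T (b, b', f) = (fun_comp (Lcat b) (Tb b') (Lfun b b' f),
        \<lambda>p\<in>nodes b. tN (elt p, base p) b b' f (leg p), fun_comp (Lcat b) (F1 E b b' f) (Tb b))"
  by (simp_all add: T_def cells1_def)

lemma pseudo_nat_T: "pseudo_nat A (CAT r) L E T"
proof -
  have oplax: "oplax_nat A (CAT r) L E T"
  proof (rule oplax_nat_CATI, goal_cases)
    case (5 b)
    then show ?case by (simp add: Tb_functor)
  next
    case (8 b b' f m)
    \<comment> \<open>On a generator \<open>Tb\<close> gives a cone cell, and the square becomes the
      modification axiom \<open>tU_modif\<close> of that cell.\<close>
    have "cmp (F0 E b') (tN (elt (cod (d m)), base (cod (d m))) b b' f (leg (cod (d m))))
        (FA (fun_comp (Lcat b) (Tb b') (Lfun b b' f)) m)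
      = cmp (F0 E b') (FA (fun_comp (Lcat b) (F1 E b b' f) (Tb b)) m)
        (tN (elt (fst (d m)), base (fst (d m))) b b' f (leg (fst (d m))))"
    proof (rule Lcat_natural [of b], goal_cases)
      case 2
      then show ?case using 8 by (intro is_functor_comp [OF Lfun_functor Tb_functor])
    next
      case 3
      then show ?case using 8 by (intro is_functor_comp [OF Tb_functor E.F1_functor])
    next
      case X: (5 X Y u g)
      have m: "cone_arr X Y u b g \<in> Ar (Lcat b)" using 8 X by simp
      have fg: "cmp1 A (snd X) b b' f g \<in> Ob (Hom A (snd X) b')" using 8 X by simp
      have "FA (Lfun b b' f) (cone_arr X Y u b g) = cone_arr X Y u b' (cmp1 A (snd X) b b' f g)"
        using 8 X m by simp
      then show ?case
        using 8 m X Tb_lU [OF X(1-3) 8(1) X(4)] Tb_lU [OF X(1-3) 8(2) fg]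
          tU_modif [OF X(1-3) 8(1-3) X(4)]
        by (simp del: lU_component El_simps Tb_simps(2) Lfun_simps(2))
    qed (use 8 in \<open>auto simp: push_def\<close>)
    then show ?case using 8 by (simp del: Tb_simps(2) Lfun_simps(2))
  next
    case (10 a b c f g x)
    then show ?case by (simp add: tN_cmp1 push_def)
  next
    case (11 a b \<gamma> x)
    let ?X = "(elt x, base x)"
    \<comment> \<open>The component of \<open>F2 L a b \<gamma>\<close> at the node is the
      coprojection of \<gamma> whiskered by the leg. By \<open>Tb_inc\<close> the axiom becomes that
      of the leg of \<theta> at \<open>?X\<close>.\<close>
    have "e (push a b (src (Hom A a b) \<gamma>) x, dat (F2 P a b \<gamma>) (pt a x), push a b (tgt (Hom A a b) \<gamma>) x)
        = FA (inc ?X b) (rwhisk A (base x) a b \<gamma> (leg x))"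
      using 11 by (simp add: push_def pt_def)
    then show ?case using 11 Tb_inc [of ?X b "rwhisk A (base x) a b \<gamma> (leg x)"]
        tN_nat2 [of ?X a b \<gamma> "leg x"]
      by (simp del: inc_simps Tb_simps(2))
  qed (use E in \<open>auto simp: two_functor_L E.two_functor_axioms push_def tN_one\<close>)
  then show ?thesis by (subst pseudo_nat_CAT) auto
qed

lemma T_H [simp]: "T \<in> Ob (Hom H L E)"
  using pseudo_nat_T by (simp add: H_def)

text \<open>The legs agree by \<open>Tb_inc\<close> and by the choice of the cells of
  \<open>T\<close>; the cone cells agree by \<open>Tb_lU\<close>.\<close>

lemma cone_comp_T: "restr E T = \<theta>"
proof -
  let ?c = "restr E T"
  have cone: "cone_to E ?c"
    using E by (intro lcone.cone_comp_cone) simp_all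
  then interpret c: elements_cone r A P e E ?c
    using E by unfold_locales
  have T0: "cmp1 H (rep X) L E T (incT X) = T0 \<theta> X" if X: "X \<in> Obj El_P" for X
  proof -
    have "pseudo_nat A (CAT r) (rep X) E (cmp1 H (rep X) L E T (incT X))"
      using c.T0_pseudo [OF X] X by simp
    then show ?thesis
    proof (intro cat_transf_eqI [where F = "rep X" and G = E and r = r and A = A])
      fix b b' f g assume H: "b \<in> Obj A" "b' \<in> Obj A" "f \<in> Ob (Hom A b b')" "g \<in> Ob (F0 (rep X) b)"
      \<comment> \<open>The structure cell of \<open>incT X\<close> is an identity, which
        \<open>Tb\<close> preserves; only the cell of \<open>T\<close> remains in the
        composite.\<close>
      have "FA (Tb b') (e (e (fst X, snd X, cmp1 A (snd X) b b' f g), ide (F0 P b') (FO (F1 P (snd X) b' (cmp1 A (snd X) b b' f g)) (fst X)),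
          e (fst X, snd X, cmp1 A (snd X) b b' f g))) = ide (F0 E b') (tO X b' (cmp1 A (snd X) b b' f g))"
        using is_functor.FA_ide [OF Tb_functor [OF H(2)], of "e (fst X, snd X, cmp1 A (snd X) b b' f g)"] H X
        by (simp del: Tb_simps(2))
      then show "dat (T1 (cmp1 H (rep X) L E T (incT X)) (b, b', f)) g = tN X b b' f g"
        using X H H_cmp1_T1 [of T L E "incT X" "rep X" b b' f g] by (simp del: Tb_simps(2))
    qed (use X T0_pseudo [OF X] Tb_inc [OF X] in \<open>simp_all add: sigma_nat_def del: inc_simps(2) Tb_simps(2)\<close>)
  qed
  show ?thesis
  proof (rule transf_eqI [OF c.\<theta>.oplax_nat_axioms \<theta>.oplax_nat_axioms])
    fix X assume "X \<in> Obj (op2 El_P)"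
    then show "T0 ?c X = T0 \<theta> X" using T0 by simp
  next
    fix X Y u assume "X \<in> Obj (op2 El_P)" "Y \<in> Obj (op2 El_P)" "u \<in> Ob (Hom (op2 El_P) X Y)"
    then have X: "X \<in> Obj El_P" "Y \<in> Obj El_P" "u \<in> Ob (Hom El_P Y X)" by simp_all
    have T0s: "T0 ?c X = T0 \<theta> X" "T0 ?c Y = T0 \<theta> Y" using X T0 by simp_all
    have T1c: "T1 ?c (X, Y, u) = lwhisk H (rep X) L E T (lU X Y u)"
      using X by simp
    show "T1 ?c (X, Y, u) = T1 \<theta> (X, Y, u)"
    proof (rule H_eqI [OF c.T1_H(1) [OF X] T1_H(1) [OF X]])
      show "src (Hom H (rep X) E) (T1 ?c (X, Y, u)) = src (Hom H (rep X) E) (T1 \<theta> (X, Y, u))"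
        "tgt (Hom H (rep X) E) (T1 ?c (X, Y, u)) = tgt (Hom H (rep X) E) (T1 \<theta> (X, Y, u))"
        unfolding c.T1_H(2,3) [OF X] T1_H(2,3) [OF X] T0s by simp_all
      fix b g assume "b \<in> Obj A" "g \<in> Ob (F0 (rep X) b)"
      then show "dat (dat (T1 ?c (X, Y, u)) b) g = dat (dat (T1 \<theta> (X, Y, u)) b) g"
        unfolding T1c using X lU_H(1) [OF X] Tb_lU [OF X, of b g]
        by (simp del: lU_component Tb_simps(2) cone_comp_simps)
    qed
  qed
qed

end


section \<open>Restriction of 1-cells and 2-cells along the colimiting cone\<close>

context elements
begin

text \<open>Every node is the image of its leg under a coprojection, so a 1-cell out of
  \<open>L\<close> can be read off from its restriction: here on nodes, and below for structure
  cells and generating arrows.\<close>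

lemma lcone_restr_FO:
  assumes "t \<in> Ob (Hom H L E)" "b \<in> Obj A" "p \<in> nodes b"
  shows "FO (T0 (T0 (restr E t) (elt p, base p)) b) (leg p) = FO (T0 t b) p"
  using assms by simp

lemma lcone_restr_T1:
  assumes t: "t \<in> Ob (Hom H L E)" and b: "b \<in> Obj A" "b' \<in> Obj A" "f \<in> Ob (Hom A b b')" "p \<in> nodes b"
  shows "dat (T1 (T0 (restr E t) (elt p, base p)) (b, b', f)) (leg p)
    = dat (T1 t (b, b', f)) p"
proof -
  interpret t: cat_transf A r L E t using t by (rule H_transf)
  let ?q = "push b b' f p"
  have q: "e (elt p, base p, cmp1 A (base p) b b' f (leg p)) = ?q" by (simp add: push_def)
  have "FA (T0 t b') (e (?q, ide (F0 P b') (pt b' ?q), ?q)) = ide (F0 E b') (FO (T0 t b') ?q)"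
    using b t.T0_simps(5) [of b' ?q] by simp
  moreover have "incT (elt p, base p) \<in> Ob (Hom H (representable A (base p)) L)"
    using incT_H [of "(elt p, base p)"] b by simp
  ultimately show ?thesis
    using assms q t.T1_component [OF b(1-3), of p] by (simp add: H_cmp1_T1)
qed

lemma lcone_restr_lU:
  assumes t: "t \<in> Ob (Hom H L E)" and X: "X \<in> Obj El_P" "Y \<in> Obj El_P" "u \<in> Ob (Hom El_P Y X)"
    and b: "b \<in> Obj A" "g \<in> Ob (Hom A (snd X) b)"
  shows "dat (dat (T1 (restr E t) (X, Y, u)) b) g
    = FA (T0 t b) (cone_arr X Y u b g)"
  using assms lU_H(1) [OF X] by (simp del: lU_component)

lemma inj_restr:
  assumes E: "E \<in> Obj H"
  shows "inj_on (restr E) (Ob (Hom H L E))"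
proof (rule inj_onI)
  fix t t' assume t: "t \<in> Ob (Hom H L E)" and t': "t' \<in> Ob (Hom H L E)"
    and eq: "restr E t = restr E t'"
  interpret t: cat_transf A r L E t using t by (rule H_transf)
  interpret t': cat_transf A r L E t' using t' by (rule H_transf)
  have FO: "FO (T0 t b) p = FO (T0 t' b) p" if "b \<in> Obj A" "p \<in> nodes b" for b p
    using lcone_restr_FO [OF t that] lcone_restr_FO [OF t' that] eq by simp
  show "t = t'"
  proof (rule cat_transf_eqI [OF t.oplax_nat_axioms t'.oplax_nat_axioms])
    fix b m assume b: "b \<in> Obj A" and m: "m \<in> Ar (F0 L b)"
    \<comment> \<open>With identities as \<eta>, naturality says that the two functors agree on
      \<open>m\<close>, so agreement on generators is enough.\<close>
    have "cmp (F0 E b) (ide (F0 E b) (FO (T0 t b) (cod (d m)))) (FA (T0 t b) m)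
      = cmp (F0 E b) (FA (T0 t' b) m) (ide (F0 E b) (FO (T0 t b) (fst (d m))))"
    proof (rule Lcat_natural [OF b], goal_cases)
      case X: (4 X Y u g)
      have "FA (T0 t b) (cone_arr X Y u b g) = FA (T0 t' b) (cone_arr X Y u b g)"
        using lcone_restr_lU [OF t X(1-3) b X(4)] lcone_restr_lU [OF t' X(1-3) b X(4)] eq by simp
      moreover have "cone_arr X Y u b g \<in> Ar (Lcat b)" using b X by simp
      ultimately show ?case
        using b X t'.T0_simps(2-4) [of b "cone_arr X Y u b g"] by (simp add: FO)
    qed (use b m t.T0_functor [OF b] t'.T0_functor [OF b] in \<open>simp_all add: FO\<close>)
    then show "FA (T0 t b) m = FA (T0 t' b) m" using b m by (simp add: FO)
  next
    fix b b' f p assume "b \<in> Obj A" "b' \<in> Obj A" "f \<in> Ob (Hom A b b')" "p \<in> Ob (F0 L b)"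
    then show "dat (T1 t (b, b', f)) p = dat (T1 t' (b, b', f)) p"
      using lcone_restr_T1 [OF t, of b b' f p] lcone_restr_T1 [OF t', of b b' f p] eq by simp
  qed (simp add: FO)
qed

lemma bij_restr:
  assumes E: "E \<in> Obj H"
  shows "bij_betw (restr E) (Ob (Hom H L E)) {\<theta>. cone_to E \<theta>}"
proof (rule bij_betwI')
  fix t t' assume "t \<in> Ob (Hom H L E)" "t' \<in> Ob (Hom H L E)"
  then show "(restr E t = restr E t') = (t = t')"
    using inj_restr [OF E] by (auto dest: inj_onD)
next
  fix t assume "t \<in> Ob (Hom H L E)"
  then show "restr E t \<in> {\<theta>. cone_to E \<theta>}"
    using lcone.cone_comp_cone [OF E] by simp
next
  fix \<theta> assume "\<theta> \<in> {\<theta>. cone_to E \<theta>}"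
  then interpret c: elements_cone r A P e E \<theta>
    using E by unfold_locales simp_all
  show "\<exists>t\<in>Ob (Hom H L E). \<theta> = restr E t"
    using c.cone_comp_T c.T_H by metis
qed

text \<open>Surjectivity of the two-dimensional universal property. The component of \<beta> at a
  node is forced to be that of \<open>m\<close> at its leg; on generators its naturality is the
  condition that \<open>m\<close> be a modification of cones.\<close>

lemma modif_extends:
  assumes E: "E \<in> Obj H" and t: "t \<in> Ob (Hom H L E)" "t' \<in> Ob (Hom H L E)"
    and m: "m \<in> Ar (sigma_cones (op2 El_P) H Cart Diag E)"
      "fst m = restr E t" "cod m = restr E t'"
  obtains \<beta> where "\<beta> \<in> Ar (Hom H L E)" "src (Hom H L E) \<beta> = t" "tgt (Hom H L E) \<beta> = t'"
    "\<And>X. X \<in> Obj El_P \<Longrightarrow> rwhisk H (rep X) L E \<beta> (incT X) = dat m X"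
proof -
  interpret t: cat_transf A r L E t using t by (intro H_transf)
  interpret t': cat_transf A r L E t' using t by (intro H_transf)
  interpret m: modif_arrow "op2 El_P" H Cart Diag "const2 (op2 El_P) H E" m
    using m(1) by unfold_locales (simp add: sigma_cones_def)
  have mH: "dat m X \<in> Ar (Hom H (rep X) E)"
    "src (Hom H (rep X) E) (dat m X) = cmp1 H (rep X) L E t (incT X)"
    "tgt (Hom H (rep X) E) (dat m X) = cmp1 H (rep X) L E t' (incT X)"
    if "X \<in> Obj El_P" for X
    using that m.dat_simps [of X] m(2,3) by simp_all
  have mm: "cat_modif A r (all1 A) (rep X) E (dat m X)" if "X \<in> Obj El_P" for X
    using mH(1) [OF that] by (rule H_arrow)
  have dom_cod: "fst (dat m X) = cmp1 H (rep X) L E t (incT X)"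
    "cod (dat m X) = cmp1 H (rep X) L E t' (incT X)" if "X \<in> Obj El_P" for X
    using mH(2,3) [OF that] by (simp_all add: H_def)
  have comp: "dat (dat (dat m X) b) g \<in> Ar (F0 E b)"
    "src (F0 E b) (dat (dat (dat m X) b) g) = FO (T0 t b) (e (fst X, snd X, g))"
    "tgt (F0 E b) (dat (dat (dat m X) b) g) = FO (T0 t' b) (e (fst X, snd X, g))"
    if "X \<in> Obj El_P" "b \<in> Obj A" "g \<in> Ob (Hom A (snd X) b)" for X b g
    using that cat_modif.component [OF mm, of X b g] by (simp_all add: dom_cod)
  define \<mu> where "\<mu> b p = dat (dat (dat m (elt p, base p)) b) (leg p)" for b p
  define \<rho> where "\<rho> = (\<lambda>b\<in>Obj A. (T0 t b, \<lambda>p\<in>nodes b. \<mu> b p, T0 t' b))"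
  have \<mu>: "\<mu> b p \<in> Ar (F0 E b) \<and> src (F0 E b) (\<mu> b p) = FO (T0 t b) p \<and> tgt (F0 E b) (\<mu> b p) = FO (T0 t' b) p"
    if "b \<in> Obj A" "p \<in> nodes b" for b p
    using comp [of "(elt p, base p)" b "leg p"] that by (simp add: \<mu>_def)
  have gen: "cmp (F0 E b) (\<mu> b (e (fst X, snd X, g))) (FA (T0 t b) (cone_arr X Y u b g))
      = cmp (F0 E b) (FA (T0 t' b) (cone_arr X Y u b g)) (\<mu> b (e (fst Y, snd Y, pull X Y u b g)))"
    if X: "X \<in> Obj El_P" "Y \<in> Obj El_P" "u \<in> Ob (Hom El_P Y X)" and b: "b \<in> Obj A" "g \<in> Ob (Hom A (snd X) b)"
    for X Y u b g
  proof -
    have "cmp (Hom H (rep X) E) (dat m X) (T1 (fst m) (X, Y, u))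
      = cmp (Hom H (rep X) E) (T1 (cod m) (X, Y, u))
        (rwhisk H (rep X) (rep Y) E (dat m Y) (rep_T X Y u))"
      using X E m.modif [of X Y u] mH(1) [of X] by simp
    then have "dat (dat (cmp (Hom H (rep X) E) (dat m X) (T1 (fst m) (X, Y, u))) b) g
      = dat (dat (cmp (Hom H (rep X) E) (T1 (cod m) (X, Y, u))
        (rwhisk H (rep X) (rep Y) E (dat m Y) (rep_T X Y u))) b) g"
      by simp
    then show ?thesis
      using X b mH(1) [of Y] lcone_restr_lU [OF t(1) X b] lcone_restr_lU [OF t(2) X b]
      by (simp add: \<mu>_def m(2,3) del: lU_component cone_comp_simps)
  qed
  have "(t, \<rho>, t') \<in> Ar (sigma_nat_cat A (CAT r) (all1 A) L E)"
  proof (rule cat_modif_ArI)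
    show "pseudo_nat A (CAT r) L E t" "pseudo_nat A (CAT r) L E t'"
      using t by (simp_all add: H_def)
    show "\<rho> \<in> extensional (Obj A)" by (simp add: \<rho>_def)
  next
    fix b assume b: "b \<in> Obj A"
    have F: "is_functor (Lcat b) (F0 E b) (T0 t b)" "is_functor (Lcat b) (F0 E b) (T0 t' b)"
      using t.T0_functor [OF b] t'.T0_functor [OF b] by simp_all
    have "(T0 t b, \<lambda>p\<in>nodes b. \<mu> b p, T0 t' b) \<in> Ar (functor_cat (Lcat b) (F0 E b))"
    proof (rule functor_cat_ArI, goal_cases)
      case (5 n)
      then show ?case
        using Lcat_natural [OF b F, where \<eta> = "\<mu> b", OF \<mu> gen 5] b by simp
    qed (use b \<mu> F in auto)
    then show "\<rho> b \<in> Ar (functor_cat (F0 L b) (F0 E b)) \<and> fst (\<rho> b) = T0 t b \<and> cod (\<rho> b) = T0 t' b"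
      using b by (simp add: \<rho>_def)
  next
    fix b b' f p assume H: "b \<in> Obj A" "b' \<in> Obj A" "f \<in> Ob (Hom A b b')" "p \<in> Ob (F0 L b)"
    let ?X = "(elt p, base p)"
    have X: "?X \<in> Obj El_P" using H by simp
    interpret mX: cat_modif A r "all1 A" "rep ?X" E "dat m ?X"
      using X by (rule mm)
    \<comment> \<open>Compatibility with f holds because each \<open>dat m X\<close> is itself a
      modification, between the restrictions of \<open>t\<close> and \<open>t'\<close> to the
      representable at X.\<close>
    have "cmp (F0 E b') (FA (F1 E b b' f) (\<mu> b p)) (dat (T1 t (b, b', f)) p)
      = cmp (F0 E b') (dat (T1 t' (b, b', f)) p) (\<mu> b' (push b b' f p))"
      using mX.component_modif [of b b' f "leg p"] H X lcone_restr_T1 [OF t(1) H(1-3), of p] lcone_restr_T1 [OF t(2) H(1-3), of p]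
      by (simp add: dom_cod \<mu>_def push_def)
    then show "cmp (F0 E b') (FA (F1 E b b' f) (dat (\<rho> b) p)) (dat (T1 t (b, b', f)) p)
      = cmp (F0 E b') (dat (T1 t' (b, b', f)) p) (dat (\<rho> b') (FO (F1 L b b' f) p))"
      using H by (simp add: \<rho>_def)
  qed
  then have \<beta>: "(t, \<rho>, t') \<in> Ar (Hom H L E)" by (simp add: H_def)
  show ?thesis
  proof (rule that [OF \<beta>])
    show st: "src (Hom H L E) (t, \<rho>, t') = t" "tgt (Hom H L E) (t, \<rho>, t') = t'" by (simp_all add: H_def)
    fix X assume X: "X \<in> Obj El_P"
    have ar: "rwhisk H (rep X) L E (t, \<rho>, t') (incT X) \<in> Ar (Hom H (rep X) E)"
      using X E \<beta> by simp
    show "rwhisk H (rep X) L E (t, \<rho>, t') (incT X) = dat m X"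
      by (rule H_eqI [OF ar mH(1) [OF X]]) (use X E \<beta> st mH [OF X] in \<open>simp_all add: \<rho>_def \<mu>_def\<close>)
  qed
qed

text \<open>Precomposition is bijective on objects by \<open>bij_restr\<close>. On arrows,
  injectivity comes from evaluation at nodes and surjectivity from
  \<open>modif_extends\<close>.\<close>

lemma colimit:
  "sigma_colimit (op2 El_P) (Hom_p A (CAT r)) Cart Diag L lcone"
proof -
  have iso: "cat_isomorphism (Hom H L E) (sigma_cones (op2 El_P) H Cart Diag E)
      (precomposition (op2 El_P) H Diag L E lcone)" (is "cat_isomorphism ?C ?D ?F")
    if E: "E \<in> Obj H" for E
  proof (rule cat_isomorphismI)
    let ?c = "restr E"
    interpret F: is_functor ?C ?D ?F using E by (rule lcone.precomposition_functor)
    show "is_functor ?C ?D ?F" by (rule F.is_functor_axioms)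
    show "bij_betw (FO ?F) (Ob ?C) (Ob ?D)"
      using bij_restr [OF E]
      by (subst bij_betw_cong [where g = ?c]) (simp_all add: precomposition_def sigma_cones_def)
    have FA: "FA ?F \<beta> = (?c (src ?C \<beta>),
        \<lambda>X\<in>Obj (op2 El_P). rwhisk H (rep X) L E \<beta> (T0 lcone X),
        ?c (tgt ?C \<beta>))" if "\<beta> \<in> Ar ?C" for \<beta>
      using that by (simp add: precomposition_def)
    show "bij_betw (FA ?F) (Ar ?C) (Ar ?D)"
    proof (rule bij_betwI')
      fix \<beta> \<beta>' assume \<beta>: "\<beta> \<in> Ar ?C" "\<beta>' \<in> Ar ?C"
      show "(FA ?F \<beta> = FA ?F \<beta>') = (\<beta> = \<beta>')"
      proof
        assume eq: "FA ?F \<beta> = FA ?F \<beta>'"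
        then have st: "?c (src ?C \<beta>) = ?c (src ?C \<beta>')" "?c (tgt ?C \<beta>) = ?c (tgt ?C \<beta>')"
          using FA \<beta> by simp_all
        have "src ?C \<beta> = src ?C \<beta>'" "tgt ?C \<beta> = tgt ?C \<beta>'"
          by (rule inj_onD [OF inj_restr [OF E]]; use st E \<beta> in simp)+
        moreover have "dat (dat \<beta> b) p = dat (dat \<beta>' b) p" if "b \<in> Obj A" "p \<in> Ob (F0 L b)" for b p
        proof -
          \<comment> \<open>Whiskering by the coprojection at \<open>?X\<close> and evaluating at
            \<open>leg p\<close> recovers the component at p.\<close>
          let ?X = "(elt p, base p)"
          have X: "?X \<in> Obj El_P" using that by simp
          have "dat (FA ?F \<beta>) ?X = dat (FA ?F \<beta>') ?X" using eq by simp
          then have "rwhisk H (rep ?X) L E \<beta> (incT ?X)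
            = rwhisk H (rep ?X) L E \<beta>' (incT ?X)"
            using \<beta> X by (simp add: FA)
          then have "dat (dat (rwhisk H (rep ?X) L E \<beta> (incT ?X)) b) (leg p)
            = dat (dat (rwhisk H (rep ?X) L E \<beta>' (incT ?X)) b) (leg p)"
            by simp
          then show ?thesis using \<beta> X that incT_H [OF X] by simp
        qed
        ultimately show "\<beta> = \<beta>'" by (rule H_eqI [OF \<beta>])
      qed simp
    next
      fix \<beta> assume "\<beta> \<in> Ar ?C"
      then show "FA ?F \<beta> \<in> Ar ?D" by simp
    next
      fix m assume m: "m \<in> Ar ?D"
      then have "fst m \<in> ?c ` Ob ?C" "cod m \<in> ?c ` Ob ?C"
        using bij_betw_imp_surj_on [OF bij_restr [OF E]] by (auto simp: sigma_cones_def sigma_nat_cat_Ar)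
      then obtain t t' where t: "t \<in> Ob ?C" "t' \<in> Ob ?C" "fst m = ?c t" "cod m = ?c t'"
        by (elim imageE)
      obtain \<beta> where \<beta>: "\<beta> \<in> Ar ?C" "src ?C \<beta> = t" "tgt ?C \<beta> = t'"
        "\<And>X. X \<in> Obj El_P \<Longrightarrow> rwhisk H (rep X) L E \<beta> (incT X) = dat m X"
        using modif_extends [OF E t(1,2) m t(3,4)] by blast
      have "FA ?F \<beta> = m"
      proof (rule modif_eqI)
        show "FA ?F \<beta> \<in> Ar (sigma_nat_cat (op2 El_P) H Cart Diag (const2 (op2 El_P) H E))"
          "m \<in> Ar (sigma_nat_cat (op2 El_P) H Cart Diag (const2 (op2 El_P) H E))"
          using F.FA_Ar [OF \<beta>(1)] m unfolding sigma_cones_def .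
      qed (use \<beta> t in \<open>simp_all add: FA\<close>)
      then show "\<exists>\<beta>\<in>Ar ?C. m = FA ?F \<beta>" using \<beta>(1) by blast
    qed
  qed
  have "sigma_colimit (op2 El_P) H Cart Diag L lcone"
    unfolding sigma_colimit_def
    using D.two_functor_axioms wide_subcat_cart L_Obj lcone_cone iso by (simp add: sigma_cones_def)
  then show ?thesis by (simp only: H_def)
qed


section \<open>The equivalence with \<open>P\<close>\<close>

definition Kfun :: "'u \<Rightarrow> ('u, 'u, 'u, 'u) fctr" where
  "Kfun b = \<lparr>FO = (\<lambda>p\<in>nodes b. pt b p), FA = (\<lambda>m\<in>Ar (Lcat b). dat (d m))\<rparr>"

definition Jfun :: "'u \<Rightarrow> ('u, 'u, 'u, 'u) fctr" where
  "Jfun b = \<lparr>FO = (\<lambda>x\<in>Ob (F0 P b). e (x, b, one A b)),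
     FA = (\<lambda>m\<in>Ar (F0 P b). e (e (src (F0 P b) m, b, one A b), m, e (tgt (F0 P b) m, b, one A b)))\<rparr>"

definition KT :: "'u cat_transf" where
  "KT = \<lparr>T0 = (\<lambda>b\<in>Obj A. Kfun b),
     T1 = (\<lambda>(b, b', f)\<in>cells1 A. ide (functor_cat (Lcat b) (F0 P b')) (fun_comp (Lcat b) (F1 P b b' f) (Kfun b)))\<rparr>"

text \<open>The nodes (P f x, b', 1) and (x, b, f) are in general different, but
  \<open>pt b'\<close> takes both to P f x; the structure cell joins them over an identity and is
  thus invertible.\<close>

definition JT :: "'u cat_transf" where
  "JT = \<lparr>T0 = (\<lambda>b\<in>Obj A. Jfun b),
     T1 = (\<lambda>(b, b', f)\<in>cells1 A. (fun_comp (F0 P b) (Jfun b') (F1 P b b' f),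
       \<lambda>x\<in>Ob (F0 P b). e (e (FO (F1 P b b' f) x, b', one A b'), ide (F0 P b') (FO (F1 P b b' f) x), e (x, b, f)),
       fun_comp (F0 P b) (Lfun b b' f) (Jfun b)))\<rparr>"

lemma KT_simps [simp]:
  "T0 KT \<in> extensional (Obj A)" "T1 KT \<in> extensional (cells1 A)"
  "b \<in> Obj A \<Longrightarrow> FO (T0 KT b) \<in> extensional (nodes b)"
  "b \<in> Obj A \<Longrightarrow> FA (T0 KT b) \<in> extensional (Ar (Lcat b))"
  "b \<in> Obj A \<Longrightarrow> p \<in> nodes b \<Longrightarrow> FO (T0 KT b) p = pt b p"
  "b \<in> Obj A \<Longrightarrow> m \<in> Ar (Lcat b) \<Longrightarrow> FA (T0 KT b) m = dat (d m)"
  "\<lbrakk>b \<in> Obj A; b' \<in> Obj A; f \<in> Ob (Hom A b b')\<rbrakk> \<Longrightarrow> T1 KT (b, b', f)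
    = ide (functor_cat (Lcat b) (F0 P b')) (fun_comp (Lcat b) (F1 P b b' f) (T0 KT b))"
  by (simp_all add: KT_def Kfun_def cells1_def)

lemma JT_simps [simp]:
  "T0 JT \<in> extensional (Obj A)" "T1 JT \<in> extensional (cells1 A)"
  "b \<in> Obj A \<Longrightarrow> FO (T0 JT b) \<in> extensional (Ob (F0 P b))"
  "b \<in> Obj A \<Longrightarrow> FA (T0 JT b) \<in> extensional (Ar (F0 P b))"
  "b \<in> Obj A \<Longrightarrow> x \<in> Ob (F0 P b) \<Longrightarrow> FO (T0 JT b) x = e (x, b, one A b)"
  "b \<in> Obj A \<Longrightarrow> m \<in> Ar (F0 P b) \<Longrightarrow> FA (T0 JT b) m
    = e (e (src (F0 P b) m, b, one A b), m, e (tgt (F0 P b) m, b, one A b))"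
  "\<lbrakk>b \<in> Obj A; b' \<in> Obj A; f \<in> Ob (Hom A b b')\<rbrakk> \<Longrightarrow> T1 JT (b, b', f)
    = (fun_comp (F0 P b) (T0 JT b') (F1 P b b' f),
       \<lambda>x\<in>Ob (F0 P b). e (e (FO (F1 P b b' f) x, b', one A b'), ide (F0 P b') (FO (F1 P b b' f) x), e (x, b, f)),
       fun_comp (F0 P b) (Lfun b b' f) (T0 JT b))"
  by (simp_all add: JT_def Jfun_def cells1_def)

lemma KT_functor:
  assumes "b \<in> Obj A"
  shows "is_functor (Lcat b) (F0 P b) (T0 KT b)"
  by (rule is_functorI) (use assms in \<open>auto simp: category_Lcat\<close>)

lemma JT_functor:
  assumes "b \<in> Obj A"
  shows "is_functor (F0 P b) (Lcat b) (T0 JT b)"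
  by (rule is_functorI) (use assms in \<open>auto simp: category_Lcat\<close>)

lemma KT_H: "KT \<in> Ob (Hom H L P)"
proof -
  have "oplax_nat A (CAT r) L P KT"
  proof (rule oplax_nat_CATI, goal_cases)
    case (6 b b' f)
    have "fun_comp (Lcat b) (F1 P b b' f) (T0 KT b) = fun_comp (Lcat b) (T0 KT b') (Lfun b b' f)"
      by (rule fctr_eqI [OF is_functor_comp [OF KT_functor P.F1_functor] is_functor_comp [OF Lfun_functor KT_functor]])
        (use 6 in auto)
    then show ?case using 6 by simp
  qed (auto simp: two_functor_L P.two_functor_axioms KT_functor)
  then show ?thesis by (simp add: H_def pseudo_nat_CAT)
qed

lemma JT_H: "JT \<in> Ob (Hom H P L)"
proof -
  have "oplax_nat A (CAT r) P L JT"
    by (rule oplax_nat_CATI) (auto simp: two_functor_L P.two_functor_axioms JT_functor)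
  then show ?thesis by (simp add: H_def pseudo_nat_CAT iso_Lcat)
qed

text \<open>A strict equality: P 1 x = x, and the structure cells of \<open>JT\<close> lie over
  identities.\<close>

lemma KJ: "cmp1 H P L P KT JT = one H P"
proof -
  have P: "P \<in> Obj H" by (simp add: H_def P.two_functor_axioms)
  have "cmp1 H P L P KT JT \<in> Ob (Hom H P P)" "one H P \<in> Ob (Hom H P P)"
    using P KT_H JT_H by simp_all
  then have "cat_transf A r P P (cmp1 H P L P KT JT)" "cat_transf A r P P (one H P)"
    by (simp_all add: H_transf)
  then show ?thesis
  proof (intro cat_transf_eqI [where F = P and G = P and r = r and A = A])
    fix b b' f x assume b: "b \<in> Obj A" "b' \<in> Obj A" "f \<in> Ob (Hom A b b')" "x \<in> Ob (F0 P b)"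
    then have "dat (T1 (one H P) (b, b', f)) x = ide (F0 P b') (FO (F1 P b b' f) x)"
      by (simp add: H_def)
    then show "dat (T1 (cmp1 H P L P KT JT) (b, b', f)) x = dat (T1 (one H P) (b, b', f)) x"
      using b by (simp add: H_cmp1_T1 [OF KT_H JT_H])
  qed (simp_all add: cat_transf_def)
qed

text \<open>The comparison consists of the arrows (pt b p, b, 1) \<rightarrow> p over identities. As
  \<open>Lcat b\<close> composes as in P b, naturality, the modification axiom and invertibility are
  all read off there.\<close>

lemma JK_iso: "isomorphic (Hom H L L) (cmp1 H L P L JT KT) (one H L)"
proof -
  let ?JK = "cmp1 H L P L JT KT"
  have P: "P \<in> Obj H" by (simp add: H_def P.two_functor_axioms)
  have JK: "?JK \<in> Ob (Hom H L L)" and one: "one H L \<in> Ob (Hom H L L)"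
    using P KT_H JT_H by simp_all
  interpret one: cat_transf A r L L "one H L" using one by (rule H_transf)
  define \<rho> where "\<rho> = (\<lambda>b\<in>Obj A. (T0 ?JK b,
     \<lambda>p\<in>nodes b. e (e (pt b p, b, one A b), ide (F0 P b) (pt b p), p), T0 (one H L) b))"
  have T0: "is_functor (Lcat b) (Lcat b) (T0 ?JK b)" "is_functor (Lcat b) (Lcat b) (T0 (one H L) b)"
    if "b \<in> Obj A" for b
    using that one.T0_functor [OF that] is_functor_comp [OF KT_functor JT_functor, of b] by simp_all
  have nt: "\<rho> b \<in> Ar (functor_cat (Lcat b) (Lcat b))" if b: "b \<in> Obj A" for b
  proof -
    have "(T0 ?JK b, \<lambda>p\<in>nodes b. e (e (pt b p, b, one A b), ide (F0 P b) (pt b p), p), T0 (one H L) b)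
      \<in> Ar (functor_cat (Lcat b) (Lcat b))"
      by (rule functor_cat_ArI [OF T0 [OF b]]) (use b in auto)
    then show ?thesis using b by (simp add: \<rho>_def)
  qed
  have Ar: "(?JK, \<rho>, one H L) \<in> Ar (sigma_nat_cat A (CAT r) (all1 A) L L)"
  proof (rule cat_modif_ArI)
    show "pseudo_nat A (CAT r) L L ?JK" "pseudo_nat A (CAT r) L L (one H L)"
      using JK one by (simp_all add: H_def)
    show "\<rho> \<in> extensional (Obj A)" by (simp add: \<rho>_def)
    show "\<rho> b \<in> Ar (functor_cat (F0 L b) (F0 L b)) \<and> fst (\<rho> b) = T0 ?JK b \<and> cod (\<rho> b) = T0 (one H L) b"
      if "b \<in> Obj A" for b
      using nt [OF that] that by (simp add: \<rho>_def)
    fix b b' f p assume b: "b \<in> Obj A" "b' \<in> Obj A" "f \<in> Ob (Hom A b b')" "p \<in> Ob (F0 L b)"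
    then have "dat (T1 (one H L) (b, b', f)) p = e (push b b' f p, ide (F0 P b') (pt b' (push b b' f p)), push b b' f p)"
      by (simp add: H_def)
    then show "cmp (F0 L b') (FA (F1 L b b' f) (dat (\<rho> b) p)) (dat (T1 ?JK (b, b', f)) p)
      = cmp (F0 L b') (dat (T1 (one H L) (b, b', f)) p) (dat (\<rho> b') (FO (F1 L b b' f) p))"
      using b by (simp add: H_cmp1_T1 [OF JT_H KT_H] \<rho>_def)
  qed
  have "iso_arrow (Hom H L L) (?JK, \<rho>, one H L)"
    unfolding H_def Hom_p_simps
  proof (rule modif_iso, goal_cases)
    case 1
    then show ?case using Ar by (simp add: H_def)
  next
    case (2 b)
    then show ?case using nt [of b] by (simp add: iso_functor_cat) (simp add: \<rho>_def iso_Lcat)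
  qed
  then show ?thesis unfolding isomorphic_def
    by (intro bexI [of _ "(?JK, \<rho>, one H L)"])
      (use Ar in \<open>simp_all add: in_arrows H_def\<close>)
qed

lemma equivalent_L: "equivalent_in H P L"
proof -
  have P: "P \<in> Obj H" by (simp add: H_def P.two_functor_axioms)
  then have "isomorphic (Hom H P P) (cmp1 H P L P KT JT) (one H P)"
    unfolding isomorphic_def KJ by (intro bexI [of _ "ide (Hom H P P) (one H P)"]) (simp_all add: in_arrows)
  then show ?thesis
    using P JK_iso KT_H JT_H unfolding equivalent_in_def by auto
qed

end

text \<open>An infinite type is in bijection with its square; the pairing function is applied
  twice.\<close>

lemma infinite_triples:
  fixes r :: "'u rel"
  assumes "Cinfinite r"
  obtains e :: "'u \<times> 'u \<times> 'u \<Rightarrow> 'u" where "inj e"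
proof -
  have inf: "infinite (UNIV :: 'u set)"
    using assms by (meson cinfinite_def finite_subset subset_UNIV)
  have "\<exists>f. bij_betw f (UNIV \<times> UNIV :: ('u \<times> 'u) set) (UNIV :: 'u set)"
    using card_of_Times_same_infinite [OF inf] by (simp only: card_of_ordIso)
  then obtain f :: "'u \<times> 'u \<Rightarrow> 'u" where "inj f"
    by (auto simp: bij_betw_def)
  then have "inj (\<lambda>(x, y, z). f (x, f (y, z)))"
    by (auto simp: inj_eq intro!: injI)
  then show ?thesis by (rule that)
qed

text \<open>The equivalence is asserted for every colimit of the diagram, so existence is stated
  with it to exclude that the claim is vacuous.\<close>

theorem proposition2p4p14:
  fixes r :: "'u rel" and A :: "('u, 'u, 'u) twocat" and P :: "'u cat_valued"
  assumes "Cinfinite r" and "regularCard r"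
    and "small_two_category r A"
    and "two_functor A (CAT r) P"
  shows "(\<exists>L l. sigma_colimit (op2 (El A P)) (Hom_p A (CAT r)) (cart_arrows_op A P)
                  (El_diagram A P) L l) \<and>
         (\<forall>L l. sigma_colimit (op2 (El A P)) (Hom_p A (CAT r)) (cart_arrows_op A P)
                  (El_diagram A P) L l
                \<longrightarrow> equivalent_in (Hom_p A (CAT r)) P L)"
proof -
  obtain e :: "'u \<times> 'u \<times> 'u \<Rightarrow> 'u" where e: "inj e"
    using assms(1) by (rule infinite_triples)
  interpret elements r A P e
    by (intro elements.intro small_twocat.intro cat_valued.intro elements_axioms.intro assms e)
  have "equivalent_in (Hom_p A (CAT r)) P K"
    if K: "sigma_colimit (op2 (El A P)) (Hom_p A (CAT r)) (cart_arrows_op A P) (El_diagram A P) K l" for K l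
  proof -
    have "K \<in> Obj H" using K by (simp add: sigma_colimit_def H_def)
    moreover obtain t t' where "t \<in> Ob (Hom H L K)" "t' \<in> Ob (Hom H K L)"
      "cmp1 H L K L t' t = one H L" "cmp1 H K L K t t' = one H K"
      using sigma_colimit_unique [OF colimit K] unfolding H_def by metis
    ultimately have "equivalent_in H P K"
      using H.equivalent_in_iso [OF equivalent_L] by blast
    then show ?thesis by (simp only: H_def)
  qed
  with colimit show ?thesis by blast
qed

end
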